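(* Let $K$ be a trace-class integral kernel on $\mathbb{R}^d$ with respect to a Radon measure $\mu$, let $\Phi^{perm}$ be the permanental point process with kernel $K$ and, provided $\lambda_j^D\in[0,1]$ for all compact $D$ and all $j$, let $\Phi^{det}$ be the determinantal point process with kernel $K$. Both have mean measure $\alpha$ given by $\alpha(D)=\int_DK_D(x,x)\,\mu(dx)=\sum_j\lambda_j^D$ for compact $D$. Then: (1) $\Phi^{det}$ is $\alpha$-weakly sub-Poisson and $\Phi^{perm}$ is $\alpha$-weakly super-Poisson. (2) For each compact $D\subset\mathbb{R}^d$, $\Phi^{det}(D)\le_{cx}Poi\bigl(\sum_j\lambda_j^D\bigr)\le_{cx}\Phi^{perm}(D)$, the left inequality holding provided $\Phi^{det}$ exists. (3) $\Phi^{det}$ is $\nu$-weakly sub-Poisson and $\Phi^{perm}$ is $\nu$-weakly super-Poisson. Consequently $\Phi^{det}$ is weakly sub-Poisson and $\Phi^{perm}$ is weakly super-Poisson.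
   Context: Kernels. $K:\mathbb{R}^d\times\mathbb{R}^d\to\mathbb{C}$ is locally square-integrable with respect to $\mu\otimes\mu$. For compact $D$, $\mathcal{K}_Df(x)=\int_DK(x,y)f(y)\,\mu(dy)$ on $L^2(D,\mu)$ is a compact operator, assumed for every compact $D$ to be Hermitian, positive semi-definite and trace-class, i.e. its eigenvalues $\lambda_j^D\ge0$ (counted with multiplicity) satisfy $\sum_j\lambda_j^D<\infty$. Such a $K$ is called a trace-class integral kernel. Put $K_D(x,y)=\sum_j\lambda_j^D\phi_j^D(x)\overline{\phi_j^D(y)}$, where $\phi_j^D$ are the corresponding normalized eigenfunctions; this is a Hermitian positive semi-definite version of $K$ on $D$ (up to $\mu$-null sets). Point processes. The joint intensities $\rho^{(k)}$ of a simple point process with respect to $\mu$ satisfy $\mathsf{E}\prod_{i=1}^k\Phi(B_i)=\int_{B_1\times\dots\times B_k}\rho^{(k)}\,d\mu^{\otimes k}$ for mutually disjoint bounded Borel $B_i$. A simple point process is determinantal (resp. permanental) with kernel $K$ if $\rho^{(k)}(x_1,\dots,x_k)=\det(K(x_i,x_j))_{1\le i,j\le k}$ (resp. $\mathrm{per}(K(x_i,x_j))_{1\le i,j\le k}$) for all $k$. $\Phi^{perm}$ is the unique point process whose restriction to each compact $D$ is permanental with kernel $K_D$ (it exists); $\Phi^{det}$ is the unique point process whose restriction to each compact $D$ is determinantal with kernel $K_D$ (it exists iff $\lambda_j^D\in[0,1]$ for all compact $D$ and all $j$). Orders. $\Phi$ is $\alpha$-weakly sub-Poisson if $\mathsf{E}\prod_{i=1}^k\Phi(B_i)\le\prod_{i=1}^k\mathsf{E}\Phi(B_i)$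 for all $k\ge 1$ and mutually disjoint bounded Borel sets $B_i$; $\nu$-weakly sub-Poisson if $\mathsf{P}(\Phi(B)=0)\le e^{-\mathsf{E}\Phi(B)}$ for all Borel $B$; weakly sub-Poisson if both hold. The corresponding super-Poisson notions have the inequalities reversed. For real random variables (or laws), $X\le_{cx}Y$ means $\mathsf{E}f(X)\le\mathsf{E}f(Y)$ for all convex $f$ for which both expectations are finite; $Poi(\lambda)$ is the Poisson law with mean $\lambda$.
   Formalization: Joint intensities are also required to vanish a.e. on the diagonals; this is automatic for determinants and for diffuse μ, and only excludes permanental processes whose kernel is nonzero at an atom of μ, where the claim fails (e.g. a Bernoulli count at the atom of a Dirac measure). *)

theory Defs
  imports "HOL-Probability.Probability" "Jordan_Normal_Form.Determinant"
begin

section \<open>Integral kernels\<close>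

text \<open>On \<open>\<real>\<^sup>d\<close> a locally finite Borel measure is automatically regular.\<close>

definition radon_measure :: "'a::euclidean_space measure \<Rightarrow> bool" where
  "radon_measure \<mu> \<longleftrightarrow> sets \<mu> = sets borel \<and> (\<forall>C. compact C \<longrightarrow> emeasure \<mu> C < \<infinity>)"

definition L2_on :: "'a::euclidean_space measure \<Rightarrow> 'a set \<Rightarrow> ('a \<Rightarrow> complex) \<Rightarrow> bool" where
  "L2_on \<mu> D f \<longleftrightarrow> f \<in> borel_measurable borel \<and> set_integrable \<mu> D (\<lambda>x. (cmod (f x))\<^sup>2)"

definition L2_inner ::
    "'a::euclidean_space measure \<Rightarrow> 'a set \<Rightarrow> ('a \<Rightarrow> complex) \<Rightarrow> ('a \<Rightarrow> complex) \<Rightarrow> complex" where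
  "L2_inner \<mu> D f g = (LINT x:D|\<mu>. f x * cnj (g x))"

definition kernel_op ::
    "'a::euclidean_space measure \<Rightarrow> ('a \<Rightarrow> 'a \<Rightarrow> complex) \<Rightarrow> 'a set \<Rightarrow> ('a \<Rightarrow> complex) \<Rightarrow> 'a \<Rightarrow> complex" where
  "kernel_op \<mu> K D f x = (LINT y:D|\<mu>. K x y * f y)"

definition locally_square_integrable ::
    "'a::euclidean_space measure \<Rightarrow> ('a \<Rightarrow> 'a \<Rightarrow> complex) \<Rightarrow> bool" where
  "locally_square_integrable \<mu> K \<longleftrightarrow>
     case_prod K \<in> borel_measurable (borel \<Otimes>\<^sub>M borel) \<and>
     (\<forall>D. compact D \<longrightarrow>
        set_integrable (\<mu> \<Otimes>\<^sub>M \<mu>) (D \<times> D) (\<lambda>(x, y). (cmod (K x y))\<^sup>2))"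

definition hermitian_on ::
    "'a::euclidean_space measure \<Rightarrow> ('a \<Rightarrow> 'a \<Rightarrow> complex) \<Rightarrow> 'a set \<Rightarrow> bool" where
  "hermitian_on \<mu> K D \<longleftrightarrow>
     (\<forall>f g. L2_on \<mu> D f \<longrightarrow> L2_on \<mu> D g \<longrightarrow>
        L2_inner \<mu> D (kernel_op \<mu> K D f) g = L2_inner \<mu> D f (kernel_op \<mu> K D g))"

definition psd_on ::
    "'a::euclidean_space measure \<Rightarrow> ('a \<Rightarrow> 'a \<Rightarrow> complex) \<Rightarrow> 'a set \<Rightarrow> bool" where
  "psd_on \<mu> K D \<longleftrightarrow>
     (\<forall>f. L2_on \<mu> D f \<longrightarrow> L2_inner \<mu> D (kernel_op \<mu> K D f) f \<in> \<real>\<^sub>\<ge>\<^sub>0)"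

text \<open>
  An enumeration of the eigenvalues of the integral operator on \<open>L\<^sup>2(D, \<mu>)\<close>, counted with
  multiplicity, with corresponding orthonormal eigenfunctions. The last clause says that no
  nonzero eigenvalue is missed; the null space, which contributes nothing to any of the sums
  below, may or may not be enumerated. The index set is arbitrary because \<open>L\<^sup>2(D, \<mu>)\<close> may be
  finite-dimensional.
\<close>

definition eigensystem ::
    "'a::euclidean_space measure \<Rightarrow> ('a \<Rightarrow> 'a \<Rightarrow> complex) \<Rightarrow> 'a set \<Rightarrow>
     nat set \<Rightarrow> (nat \<Rightarrow> real) \<Rightarrow> (nat \<Rightarrow> 'a \<Rightarrow> complex) \<Rightarrow> bool" where
  "eigensystem \<mu> K D J lam \<phi> \<longleftrightarrow>
     (\<forall>j\<in>J. L2_on \<mu> D (\<phi> j)) \<and>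
     (\<forall>i\<in>J. \<forall>j\<in>J. L2_inner \<mu> D (\<phi> i) (\<phi> j) = (if i = j then 1 else 0)) \<and>
     (\<forall>j\<in>J. AE x in \<mu>. x \<in> D \<longrightarrow> kernel_op \<mu> K D (\<phi> j) x = complex_of_real (lam j) * \<phi> j x) \<and>
     (\<forall>f. L2_on \<mu> D f \<longrightarrow> (\<forall>j\<in>J. L2_inner \<mu> D f (\<phi> j) = 0) \<longrightarrow>
        (AE x in \<mu>. x \<in> D \<longrightarrow> kernel_op \<mu> K D f x = 0))"

text \<open>
  Compactness of the operators follows from local square-integrability, so that eigensystems
  exist by the spectral theorem; whether the eigenvalues are summable does not depend on the
  enumeration, and they are nonnegative by positive semi-definiteness.
\<close>

definition trace_class_kernel ::
    "'a::euclidean_space measure \<Rightarrow> ('a \<Rightarrow> 'a \<Rightarrow> complex) \<Rightarrow> bool" where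
  "trace_class_kernel \<mu> K \<longleftrightarrow>
     locally_square_integrable \<mu> K \<and>
     (\<forall>D. compact D \<longrightarrow>
        hermitian_on \<mu> K D \<and> psd_on \<mu> K D \<and>
        (\<forall>J lam \<phi>. eigensystem \<mu> K D J lam \<phi> \<longrightarrow> lam summable_on J))"

text \<open>
  The version \<open>K\<^sub>D\<close> of the kernel, extended by 0 outside \<open>D \<times> D\<close>. For trace-class kernels the
  series converges absolutely at all \<open>(x, y)\<close> outside a null set of \<open>x\<close>'s and of \<open>y\<close>'s.
\<close>

definition kernel_version ::
    "'a set \<Rightarrow> nat set \<Rightarrow> (nat \<Rightarrow> real) \<Rightarrow> (nat \<Rightarrow> 'a \<Rightarrow> complex) \<Rightarrow> 'a \<Rightarrow> 'a \<Rightarrow> complex" where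
  "kernel_version D J lam \<phi> x y =
     (if x \<in> D \<and> y \<in> D
      then \<Sum>\<^sub>\<infinity>j\<in>J. complex_of_real (lam j) * \<phi> j x * cnj (\<phi> j y) else 0)"


section \<open>Point processes\<close>

definition counting_measure :: "'a::euclidean_space measure \<Rightarrow> bool" where
  "counting_measure N \<longleftrightarrow>
     sets N = sets borel \<and>
     (\<forall>B\<in>sets borel. bounded B \<longrightarrow> (\<exists>n::nat. emeasure N B = of_nat n))"

definition point_process :: "'w measure \<Rightarrow> ('w \<Rightarrow> 'a::euclidean_space measure) \<Rightarrow> bool" where
  "point_process M \<Phi> \<longleftrightarrow>
     prob_space M \<and>
     (\<forall>\<omega>\<in>space M. counting_measure (\<Phi> \<omega>)) \<and>
     (\<forall>B\<in>sets borel. (\<lambda>\<omega>. emeasure (\<Phi> \<omega>) B) \<in> borel_measurable M)"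

definition simple_point_process :: "'w measure \<Rightarrow> ('w \<Rightarrow> 'a::euclidean_space measure) \<Rightarrow> bool" where
  "simple_point_process M \<Phi> \<longleftrightarrow>
     point_process M \<Phi> \<and> (AE \<omega> in M. \<forall>x. emeasure (\<Phi> \<omega>) {x} \<le> 1)"

definition restrict_process ::
    "'a::euclidean_space set \<Rightarrow> ('w \<Rightarrow> 'a measure) \<Rightarrow> 'w \<Rightarrow> 'a measure" where
  "restrict_process D \<Phi> \<omega> = density (\<Phi> \<omega>) (indicator D)"

definition mean_measure ::
    "'w measure \<Rightarrow> ('w \<Rightarrow> 'a::euclidean_space measure) \<Rightarrow> 'a set \<Rightarrow> ennreal" where
  "mean_measure M \<Phi> B = (\<integral>\<^sup>+\<omega>. emeasure (\<Phi> \<omega>) B \<partial>M)"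

text \<open>
  Moments over disjoint sets determine \<open>\<rho>\<^sup>(\<^sup>k\<^sup>)\<close> only off the diagonals. As usual for simple point
  processes (Hough, Krishnapur, Peres, Virag), joint intensities are required to vanish almost
  everywhere on the diagonals, where a simple process has no mass. By the two lemmas below this
  convention is void if \<open>\<mu>\<close> has no atoms, and for determinants. It matters for
  permanents and atomic \<open>\<mu>\<close>: a Bernoulli number of points at the atom of a Dirac measure
  would otherwise qualify as permanental, although it is less variable than a Poisson number.
\<close>

definition joint_intensity ::
    "'w measure \<Rightarrow> ('w \<Rightarrow> 'a::euclidean_space measure) \<Rightarrow> 'a measure \<Rightarrow> nat \<Rightarrow>
     ((nat \<Rightarrow> 'a) \<Rightarrow> real) \<Rightarrow> bool" where
  "joint_intensity M \<Phi> \<mu> k \<rho> \<longleftrightarrow>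
     \<rho> \<in> borel_measurable (\<Pi>\<^sub>M i\<in>{..<k}. \<mu>) \<and>
     (\<forall>x. 0 \<le> \<rho> x) \<and>
     (\<forall>B. (\<forall>i<k. B i \<in> sets borel \<and> bounded (B i)) \<and> disjoint_family_on B {..<k} \<longrightarrow>
        (\<integral>\<^sup>+\<omega>. (\<Prod>i<k. emeasure (\<Phi> \<omega>) (B i)) \<partial>M) =
        (\<integral>\<^sup>+x\<in>PiE {..<k} B. ennreal (\<rho> x) \<partial>(\<Pi>\<^sub>M i\<in>{..<k}. \<mu>))) \<and>
     (AE x in (\<Pi>\<^sub>M i\<in>{..<k}. \<mu>). (\<exists>i<k. \<exists>j<k. i \<noteq> j \<and> x i = x j) \<longrightarrow> \<rho> x = 0)"

definition kernel_mat :: "('a \<Rightarrow> 'a \<Rightarrow> complex) \<Rightarrow> nat \<Rightarrow> (nat \<Rightarrow> 'a) \<Rightarrow> complex mat" where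
  "kernel_mat K k x = mat k k (\<lambda>(i, j). K (x i) (x j))"

definition permanent :: "'a::comm_ring_1 mat \<Rightarrow> 'a" where
  "permanent A = (\<Sum>p | p permutes {0..<dim_row A}. \<Prod>i = 0..<dim_row A. A $$ (i, p i))"

definition determinantal ::
    "'w measure \<Rightarrow> ('w \<Rightarrow> 'a::euclidean_space measure) \<Rightarrow> 'a measure \<Rightarrow>
     ('a \<Rightarrow> 'a \<Rightarrow> complex) \<Rightarrow> bool" where
  "determinantal M \<Phi> \<mu> K \<longleftrightarrow>
     simple_point_process M \<Phi> \<and>
     (\<forall>k\<ge>1. \<exists>\<rho>. joint_intensity M \<Phi> \<mu> k \<rho> \<and>
        (AE x in (\<Pi>\<^sub>M i\<in>{..<k}. \<mu>).
           complex_of_real (\<rho> x) = Determinant.det (kernel_mat K k x)))"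

definition permanental ::
    "'w measure \<Rightarrow> ('w \<Rightarrow> 'a::euclidean_space measure) \<Rightarrow> 'a measure \<Rightarrow>
     ('a \<Rightarrow> 'a \<Rightarrow> complex) \<Rightarrow> bool" where
  "permanental M \<Phi> \<mu> K \<longleftrightarrow>
     simple_point_process M \<Phi> \<and>
     (\<forall>k\<ge>1. \<exists>\<rho>. joint_intensity M \<Phi> \<mu> k \<rho> \<and>
        (AE x in (\<Pi>\<^sub>M i\<in>{..<k}. \<mu>).
           complex_of_real (\<rho> x) = permanent (kernel_mat K k x)))"

text \<open>
  The processes \<open>\<Phi>\<^sup>d\<^sup>e\<^sup>t\<close> and \<open>\<Phi>\<^sup>p\<^sup>e\<^sup>r\<^sup>m\<close> of a kernel given with eigensystems
  \<open>(J D, lam D, \<phi> D)\<close> for all compact \<open>D\<close>.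
\<close>

definition determinantal_process ::
    "'w measure \<Rightarrow> ('w \<Rightarrow> 'a::euclidean_space measure) \<Rightarrow> 'a measure \<Rightarrow>
     ('a set \<Rightarrow> nat set) \<Rightarrow> ('a set \<Rightarrow> nat \<Rightarrow> real) \<Rightarrow> ('a set \<Rightarrow> nat \<Rightarrow> 'a \<Rightarrow> complex) \<Rightarrow> bool" where
  "determinantal_process M \<Phi> \<mu> J lam \<phi> \<longleftrightarrow>
     point_process M \<Phi> \<and>
     (\<forall>D. compact D \<longrightarrow>
        determinantal M (restrict_process D \<Phi>) \<mu> (kernel_version D (J D) (lam D) (\<phi> D)))"

definition permanental_process ::
    "'w measure \<Rightarrow> ('w \<Rightarrow> 'a::euclidean_space measure) \<Rightarrow> 'a measure \<Rightarrow>
     ('a set \<Rightarrow> nat set) \<Rightarrow> ('a set \<Rightarrow> nat \<Rightarrow> real) \<Rightarrow> ('a set \<Rightarrow> nat \<Rightarrow> 'a \<Rightarrow> complex) \<Rightarrow> bool" where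
  "permanental_process M \<Phi> \<mu> J lam \<phi> \<longleftrightarrow>
     point_process M \<Phi> \<and>
     (\<forall>D. compact D \<longrightarrow>
        permanental M (restrict_process D \<Phi>) \<mu> (kernel_version D (J D) (lam D) (\<phi> D)))"

lemma AE_PiM_distinct_if_no_atoms:
  fixes \<mu> :: "'a::euclidean_space measure" and k :: nat
  assumes \<mu>: "radon_measure \<mu>" and atoms: "\<And>x. emeasure \<mu> {x} = 0"
  shows "AE x in (\<Pi>\<^sub>M i\<in>{..<k}. \<mu>). \<not> (\<exists>i<k. \<exists>j<k. i \<noteq> j \<and> x i = x j)"
proof -
  have sets_\<mu>: "sets \<mu> = sets borel"
    using \<mu> by (simp add: radon_measure_def)
  have "(\<Union>n. cball (0::'a) (real n)) = UNIV"
    using real_arch_simple by (auto simp: dist_norm)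
  then have "\<exists>A. countable A \<and> A \<subseteq> sets \<mu> \<and> \<Union>A = space \<mu> \<and> (\<forall>a\<in>A. emeasure \<mu> a \<noteq> \<infinity>)"
    using \<mu> sets_eq_imp_space_eq[OF sets_\<mu>]
    by (intro exI[of _ "range (\<lambda>n. cball (0::'a) (real n))"]) (auto simp: radon_measure_def less_top)
  then interpret sigma_finite_measure \<mu>
    by unfold_locales
  interpret product_sigma_finite "\<lambda>_::nat. \<mu>"
    by unfold_locales
  have "AE x in (\<Pi>\<^sub>M i\<in>{..<k}. \<mu>). x i \<noteq> x j" if ij: "i < k" "j < k" "i \<noteq> j" for i j
  proof -
    let ?P = "\<Pi>\<^sub>M i\<in>{..<k}. \<mu>" and ?I = "{..<k} - {i}"
    let ?A = "{x \<in> space ?P. x i = x j}"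
    have ins: "insert i ?I = {..<k}" using ij by auto
    have comp: "(\<lambda>x. x l) \<in> borel_measurable ?P" if "l < k" for l
      using measurable_component_singleton[of l "{..<k}" "\<lambda>_. \<mu>"] that
      by (simp add: measurable_cong_sets[OF refl sets_\<mu>])
    have meas: "?A \<in> sets ?P"
      using measurable_equality_set[OF comp[OF ij(1)] comp[OF ij(2)]] .
    have "emeasure ?P ?A = (\<integral>\<^sup>+x. indicator ?A x \<partial>(\<Pi>\<^sub>M i\<in>insert i ?I. \<mu>))"
      using meas by (simp only: ins nn_integral_indicator)
    also have "\<dots> = (\<integral>\<^sup>+x. \<integral>\<^sup>+y. indicator ?A (x(i := y)) \<partial>\<mu> \<partial>(\<Pi>\<^sub>M i\<in>?I. \<mu>))"
      proof (rule product_nn_integral_insert[of ?I i "indicator ?A"])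
      show "indicator ?A \<in> borel_measurable (\<Pi>\<^sub>M i\<in>insert i ?I. \<mu>)"
        unfolding ins using meas by (rule borel_measurable_indicator)
    qed auto
    also have "\<dots> \<le> (\<integral>\<^sup>+x. \<integral>\<^sup>+y. indicator {x j} y \<partial>\<mu> \<partial>(\<Pi>\<^sub>M i\<in>?I. \<mu>))"
      using ij by (intro nn_integral_mono) (auto simp: indicator_def)
    also have "\<dots> = 0"
      by (simp add: sets_\<mu> atoms)
    finally have "emeasure ?P ?A = 0" by simp
    then show ?thesis
      using meas by (intro AE_I[of _ _ ?A]) auto
  qed
  then have "AE x in (\<Pi>\<^sub>M i\<in>{..<k}. \<mu>). \<forall>i\<in>{..<k}. \<forall>j\<in>{..<k} - {i}. x i \<noteq> x j"
    by (intro AE_finite_allI) auto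
  then show ?thesis
    by eventually_elim blast
qed

lemma det_kernel_mat_eq_0:
  assumes "i < k" "j < k" "i \<noteq> j" "x i = x j"
  shows "Determinant.det (kernel_mat K k x) = 0"
  using assms
  by (intro det_identical_rows[of _ k i j]) (auto simp: kernel_mat_def)


section \<open>Comparison with Poisson\<close>

definition alpha_weakly_sub_Poisson ::
    "'w measure \<Rightarrow> ('w \<Rightarrow> 'a::euclidean_space measure) \<Rightarrow> bool" where
  "alpha_weakly_sub_Poisson M \<Phi> \<longleftrightarrow>
     (\<forall>k\<ge>1. \<forall>B. (\<forall>i<k. B i \<in> sets borel \<and> bounded (B i)) \<and>
        disjoint_family_on B {..<k::nat} \<longrightarrow>
        (\<integral>\<^sup>+\<omega>. (\<Prod>i<k. emeasure (\<Phi> \<omega>) (B i)) \<partial>M) \<le> (\<Prod>i<k. mean_measure M \<Phi> (B i)))"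

definition alpha_weakly_super_Poisson ::
    "'w measure \<Rightarrow> ('w \<Rightarrow> 'a::euclidean_space measure) \<Rightarrow> bool" where
  "alpha_weakly_super_Poisson M \<Phi> \<longleftrightarrow>
     (\<forall>k\<ge>1. \<forall>B. (\<forall>i<k. B i \<in> sets borel \<and> bounded (B i)) \<and>
        disjoint_family_on B {..<k::nat} \<longrightarrow>
        (\<integral>\<^sup>+\<omega>. (\<Prod>i<k. emeasure (\<Phi> \<omega>) (B i)) \<partial>M) \<ge> (\<Prod>i<k. mean_measure M \<Phi> (B i)))"

definition exp_minus :: "ennreal \<Rightarrow> real" where
  "exp_minus a = (if a = \<infinity> then 0 else exp (- enn2real a))"

definition void_prob :: "'w measure \<Rightarrow> ('w \<Rightarrow> 'a::euclidean_space measure) \<Rightarrow> 'a set \<Rightarrow> real" where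
  "void_prob M \<Phi> B = measure M {\<omega> \<in> space M. emeasure (\<Phi> \<omega>) B = 0}"

definition nu_weakly_sub_Poisson ::
    "'w measure \<Rightarrow> ('w \<Rightarrow> 'a::euclidean_space measure) \<Rightarrow> bool" where
  "nu_weakly_sub_Poisson M \<Phi> \<longleftrightarrow>
     (\<forall>B\<in>sets borel. void_prob M \<Phi> B \<le> exp_minus (mean_measure M \<Phi> B))"

definition nu_weakly_super_Poisson ::
    "'w measure \<Rightarrow> ('w \<Rightarrow> 'a::euclidean_space measure) \<Rightarrow> bool" where
  "nu_weakly_super_Poisson M \<Phi> \<longleftrightarrow>
     (\<forall>B\<in>sets borel. void_prob M \<Phi> B \<ge> exp_minus (mean_measure M \<Phi> B))"

definition weakly_sub_Poisson ::
    "'w measure \<Rightarrow> ('w \<Rightarrow> 'a::euclidean_space measure) \<Rightarrow> bool" where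
  "weakly_sub_Poisson M \<Phi> \<longleftrightarrow> alpha_weakly_sub_Poisson M \<Phi> \<and> nu_weakly_sub_Poisson M \<Phi>"

definition weakly_super_Poisson ::
    "'w measure \<Rightarrow> ('w \<Rightarrow> 'a::euclidean_space measure) \<Rightarrow> bool" where
  "weakly_super_Poisson M \<Phi> \<longleftrightarrow> alpha_weakly_super_Poisson M \<Phi> \<and> nu_weakly_super_Poisson M \<Phi>"

text \<open>Convex order of a random variable \<open>X\<close> on \<open>M\<close> and a random variable \<open>Y\<close> on \<open>N\<close>.\<close>

definition convex_order :: "'v measure \<Rightarrow> ('v \<Rightarrow> real) \<Rightarrow> 'w measure \<Rightarrow> ('w \<Rightarrow> real) \<Rightarrow> bool" where
  "convex_order M X N Y \<longleftrightarrow>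
     (\<forall>f. convex_on UNIV f \<longrightarrow> integrable M (\<lambda>\<omega>. f (X \<omega>)) \<longrightarrow> integrable N (\<lambda>\<omega>. f (Y \<omega>)) \<longrightarrow>
        (LINT \<omega>|M. f (X \<omega>)) \<le> (LINT \<omega>|N. f (Y \<omega>)))"

text \<open>\<^const>\<open>poisson_pmf\<close> is specified for positive rates only.\<close>

definition Poi :: "real \<Rightarrow> nat pmf" where
  "Poi r = (if r = 0 then return_pmf 0 else poisson_pmf r)"

end

(*
  Let N be the number of points in a compact set D, and lam_1, lam_2, ... the eigenvalues of the
  operator on L^2(D). The kernel is a Gram kernel sum_j w_j(x) cnj (w_j(y)) with orthogonal
  w_j = sqrt(lam_j) phi_j, so integrating the determinant (permanent) over D^k shows that the
  binomial moments E(N choose k) are the elementary (complete homogeneous) symmetric functions of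
  the eigenvalues. These are the binomial moments of a sum of independent Bernoulli (geometric)
  variables with means lam_j; bounded by a power of k they determine the law, so N is such a sum.
  Each summand is comparable to a Poisson variable in the convex order, and the order is stable
  under convolution and limits; the event N = 0 gives the void probabilities. The comparison of
  moments is pointwise: for a Gram matrix the determinant is at most, and the permanent at least,
  the product of the diagonal entries.
*)

theory Submission
  imports Defs
begin

section \<open>Determinants and permanents of Gram matrices\<close>

text \<open>Joint intensities are tested on disjoint sets only, whereas moments of a single count
  need the integral over all of \<open>D^k\<close>. The bridge is a refining sequence of partitions:
  sums over tuples of distinct cells exhaust the tuples of distinct points. Simplicity of the
  process and the vanishing of the intensities on the diagonals make both sides converge
  monotonically. The kernel is an infinite series that converges almost everywhere only, so
  determinants and permanents are computed for finite truncations. They and their increments are, up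
  to a factorial, sums of squares over labellings; hence they increase, and monotone convergence
  needs no dominating function. With moments bounded by \<open>L ^ k\<close> the generating function
  may have radius of convergence below 1 about the point 1. The probabilities, its coefficients at
  0, are reached by re-expanding in short steps across the unit interval. The convex order is
  handled through the expectations of \<open>(k - X)^+\<close>. On the naturals these are finite
  sums of probabilities, so they survive pointwise limits, and conditioning on a summand gives the
  same kind of expectation. Equal means bring back all convex functions.\<close>

definition wsign :: "bool \<Rightarrow> ('i \<Rightarrow> 'i) \<Rightarrow> complex" where
  "wsign b p = (if b then of_int (sign p) else 1)"

text \<open>The determinant if \<open>b\<close> holds and the permanent otherwise.\<close>

definition imm :: "bool \<Rightarrow> 'i set \<Rightarrow> ('i \<Rightarrow> 'i \<Rightarrow> complex) \<Rightarrow> complex" where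
  "imm b S A = (\<Sum>p | p permutes S. wsign b p * (\<Prod>i\<in>S. A i (p i)))"

text \<open>With \<open>wsign_inv\<close>, \<open>wsign_mult_self\<close> and
  \<open>cnj_wsign\<close> this says that \<open>wsign b\<close> is a real character of order at
  most two. The averaging argument uses nothing else about signs, so one proof serves determinants
  and permanents.\<close>

lemma wsign_compose:
  assumes "finite S" "p permutes S" "q permutes S"
  shows "wsign b (p \<circ> q) = wsign b p * wsign b q"
proof -
  have "permutation p" "permutation q"
    using assms permutation_permutes by blast+
  then show ?thesis by (simp add: wsign_def sign_compose)
qed

lemma wsign_inv:
  assumes "finite S" "p permutes S"
  shows "wsign b (inv_into UNIV p) = wsign b p"
proof -
  have "permutation p"
    using assms permutation_permutes by blast
  then show ?thesis by (simp add: wsign_def sign_inverse)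
qed

lemma wsign_mult_self: "wsign b p * wsign b p = 1"
  by (auto simp: wsign_def sign_def)

lemma cnj_wsign [simp]: "cnj (wsign b p) = wsign b p"
  by (simp add: wsign_def)

text \<open>Averaging over the relabellings \<open>J \<mapsto> J \<circ> q\<close> turns the sum into a sum of squares.\<close>

lemma sum_orbit_eq_sum_squares:
  fixes v :: "'j \<Rightarrow> 'i \<Rightarrow> complex"
  assumes S: "finite S" and T: "\<And>J p. J \<in> T \<Longrightarrow> p permutes S \<Longrightarrow> J \<circ> p \<in> T"
  shows "of_nat (fact (card S)) *
     (\<Sum>J\<in>T. \<Sum>p | p permutes S. wsign b p * (\<Prod>i\<in>S. v (J i) i * cnj (v (J i) (p i)))) =
     of_real (\<Sum>J\<in>T. (cmod (\<Sum>q | q permutes S. wsign b q * (\<Prod>i\<in>S. v (J (q i)) i)))\<^sup>2)"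
    (is "_ * ?X = of_real (\<Sum>J\<in>T. (cmod (?F J))\<^sup>2)")
proof -
  have one: "(\<Sum>J\<in>T. \<Sum>r | r permutes S. wsign b q * wsign b r *
      ((\<Prod>i\<in>S. v (J (q i)) i) * (\<Prod>i\<in>S. cnj (v (J (r i)) i)))) = ?X"
    if q: "q permutes S" for q
  proof -
    \<comment> \<open>Relabelling by the inverse of \<open>q\<close> clears \<open>q\<close> from
      the first product; what remains depends only on how \<open>r\<close> differs from
      \<open>q\<close>.\<close>
    have "bij_betw (\<lambda>J. J \<circ> inv_into UNIV q) T T"
      using T permutes_inv[OF q] q permutes_inv_o[OF q]
      by (intro bij_betw_byWitness[where f' = "\<lambda>J. J \<circ> q"]) (auto simp: comp_assoc)
    then have "(\<Sum>J\<in>T. \<Sum>r | r permutes S. wsign b q * wsign b r *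
        ((\<Prod>i\<in>S. v (J (q i)) i) * (\<Prod>i\<in>S. cnj (v (J (r i)) i)))) =
       (\<Sum>J\<in>T. \<Sum>r | r permutes S. wsign b q * wsign b r *
        ((\<Prod>i\<in>S. v ((J \<circ> inv_into UNIV q) (q i)) i) * (\<Prod>i\<in>S. cnj (v ((J \<circ> inv_into UNIV q) (r i)) i))))"
      by (rule sum.reindex_bij_betw[symmetric])
    also have "\<dots> = ?X"
    proof (rule sum.cong[OF refl])
      fix J
      \<comment> \<open>The difference is parametrised by \<open>p\<close> through
        \<open>r = q \<circ> inv p\<close>. Shifting the index of the second product by
        \<open>p\<close> then gives the factors \<open>v (J i) (p i)\<close>.\<close>
      have bij: "bij_betw (\<lambda>p. q \<circ> inv_into UNIV p) {p. p permutes S} {r. r permutes S}"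
      proof (intro bij_betw_byWitness[where f' = "\<lambda>r. inv_into UNIV r \<circ> q"] ballI, goal_cases)
        case (1 p)
        then have p: "p permutes S" by simp
        have "inv_into UNIV (q \<circ> inv_into UNIV p) = p \<circ> inv_into UNIV q"
          using p q permutes_inv[OF p]
          by (simp add: o_inv_distrib permutes_bij inv_inv_eq)
        then show ?case
          using permutes_inv_o[OF q] by (simp add: comp_assoc)
      next
        case (2 r)
        then have r: "r permutes S" by simp
        have "inv_into UNIV (inv_into UNIV r \<circ> q) = inv_into UNIV q \<circ> r"
          using r q permutes_inv[OF r]
          by (simp add: o_inv_distrib permutes_bij inv_inv_eq)
        then show ?case
          using permutes_inv_o[OF q] by (simp flip: comp_assoc)
      qed (auto intro!: permutes_compose permutes_inv q)
      have "(\<Sum>r | r permutes S. wsign b q * wsign b r *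
        ((\<Prod>i\<in>S. v ((J \<circ> inv_into UNIV q) (q i)) i) * (\<Prod>i\<in>S. cnj (v ((J \<circ> inv_into UNIV q) (r i)) i)))) =
        (\<Sum>p | p permutes S. wsign b q * wsign b (q \<circ> inv_into UNIV p) *
        ((\<Prod>i\<in>S. v ((J \<circ> inv_into UNIV q) (q i)) i) * (\<Prod>i\<in>S. cnj (v ((J \<circ> inv_into UNIV q) ((q \<circ> inv_into UNIV p) i)) i))))"
        by (rule sum.reindex_bij_betw[OF bij, symmetric])
      also have "\<dots> = (\<Sum>p | p permutes S. wsign b p * (\<Prod>i\<in>S. v (J i) i * cnj (v (J i) (p i))))"
      proof (rule sum.cong[OF refl], goal_cases)
        case (1 p)
        then have p: "p permutes S" by simp
        have w: "wsign b q * wsign b (q \<circ> inv_into UNIV p) = wsign b p"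
          using wsign_compose[OF S q permutes_inv[OF p], of b] wsign_inv[OF S p, of b]
            wsign_mult_self[of b q] by (simp flip: mult.assoc)
        have "(\<Prod>i\<in>S. cnj (v ((J \<circ> inv_into UNIV q) ((q \<circ> inv_into UNIV p) i)) i)) = (\<Prod>i\<in>S. cnj (v (J (inv_into UNIV p i)) i))"
          using permutes_inverses[OF q] by simp
        also have "\<dots> = (\<Prod>i\<in>S. cnj (v (J (inv_into UNIV p (p i))) (p i)))"
          by (rule prod.reindex_bij_betw[OF permutes_imp_bij[OF p], symmetric])
        also have "\<dots> = (\<Prod>i\<in>S. cnj (v (J i) (p i)))"
          using permutes_inverses[OF p] by simp
        finally show ?case
          using w permutes_inverses[OF q] by (simp add: prod.distrib)
      qed
      finally show "(\<Sum>r | r permutes S. wsign b q * wsign b r *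
        ((\<Prod>i\<in>S. v ((J \<circ> inv_into UNIV q) (q i)) i) * (\<Prod>i\<in>S. cnj (v ((J \<circ> inv_into UNIV q) (r i)) i)))) =
        (\<Sum>p | p permutes S. wsign b p * (\<Prod>i\<in>S. v (J i) i * cnj (v (J i) (p i))))" .
    qed
    finally show ?thesis .
  qed
  have "of_real (\<Sum>J\<in>T. (cmod (?F J))\<^sup>2) = (\<Sum>J\<in>T. ?F J * cnj (?F J))"
    by (simp only: of_real_sum complex_norm_square)
  also have "\<dots> = (\<Sum>J\<in>T. \<Sum>q | q permutes S. \<Sum>r | r permutes S. wsign b q * wsign b r *
      ((\<Prod>i\<in>S. v (J (q i)) i) * (\<Prod>i\<in>S. cnj (v (J (r i)) i))))"
    by (simp add: sum_product cnj_sum cnj_prod mult_ac)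
  also have "\<dots> = (\<Sum>q | q permutes S. ?X)"
    by (subst sum.swap) (simp add: one)
  also have "\<dots> = of_nat (fact (card S)) * ?X"
    using card_permutations[OF refl S] by simp
  finally show ?thesis ..
qed

text \<open>Kept for any set \<open>T\<close> of labellings that is stable under permuting
  positions. Besides all labellings by \<open>I\<close>, it is applied to those that leave a smaller
  index set and to those that use an extra label exactly once.\<close>

lemma sum_orbit_nonneg:
  fixes v :: "'j \<Rightarrow> 'i \<Rightarrow> complex"
  assumes "finite S" and "\<And>J p. J \<in> T \<Longrightarrow> p permutes S \<Longrightarrow> J \<circ> p \<in> T"
  shows "(\<Sum>J\<in>T. \<Sum>p | p permutes S. wsign b p * (\<Prod>i\<in>S. v (J i) i * cnj (v (J i) (p i)))) \<in> \<real>\<^sub>\<ge>\<^sub>0"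
    (is "?X \<in> _")
proof -
  obtain r :: real where r: "r \<ge> 0" "of_nat (fact (card S)) * ?X = of_real r"
    using sum_orbit_eq_sum_squares[OF assms, where b = b and v = v] by (meson sum_nonneg zero_le_power2)
  have "of_nat (fact (card S)) \<noteq> (0 :: complex)"
    by (metis fact_nonzero of_nat_0_eq_iff of_nat_eq_iff)
  then have "?X = of_real (r / fact (card S))"
    using r(2) by (auto simp: field_simps)
  then show ?thesis
    using r(1) by (metis divide_nonneg_pos fact_gt_zero nonneg_Reals_of_real_iff)
qed

text \<open>Multilinearity: expanding the product of the entries picks one label per row, that is a
  labelling \<open>J\<close>.\<close>

lemma imm_gram:
  fixes v :: "'j \<Rightarrow> 'i \<Rightarrow> complex"
  assumes "finite S" "finite I"
  shows "imm b S (\<lambda>x y. \<Sum>j\<in>I. v j x * cnj (v j y)) =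
    (\<Sum>J\<in>S \<rightarrow>\<^sub>E I. \<Sum>p | p permutes S. wsign b p * (\<Prod>i\<in>S. v (J i) i * cnj (v (J i) (p i))))"
proof -
  have "(\<Prod>i\<in>S. \<Sum>j\<in>I. v j i * cnj (v j (p i))) =
      (\<Sum>J\<in>S \<rightarrow>\<^sub>E I. \<Prod>i\<in>S. v (J i) i * cnj (v (J i) (p i)))" for p
    using assms by (rule prod_sum_PiE)
  then show ?thesis
    unfolding imm_def by (subst sum.swap) (simp add: sum_distrib_left)
qed

lemma comp_permutes_PiE: "J \<in> PiE S B \<Longrightarrow> p permutes S \<Longrightarrow> J \<circ> p \<in> PiE S (B \<circ> p)"
  by (auto simp: PiE_def Pi_def extensional_def permutes_in_image permutes_not_in)

lemma imm_gram_nonneg: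
  fixes v :: "'j \<Rightarrow> 'i \<Rightarrow> complex"
  assumes "finite S" "finite I"
  shows "imm b S (\<lambda>x y. \<Sum>j\<in>I. v j x * cnj (v j y)) \<in> \<real>\<^sub>\<ge>\<^sub>0"
  unfolding imm_gram[OF assms] using comp_permutes_PiE[of _ S "\<lambda>_. I"]
  by (intro sum_orbit_nonneg assms) (auto simp: comp_def)

text \<open>The difference is the same sum over the labellings that use some label outside
  \<open>I'\<close>, and this set is stable under permuting positions. Truncated kernels owe their
  monotone convergence to this.\<close>

lemma imm_gram_mono:
  fixes v :: "'j \<Rightarrow> 'i \<Rightarrow> complex"
  assumes "finite S" "finite I" "I' \<subseteq> I"
  shows "imm b S (\<lambda>x y. \<Sum>j\<in>I. v j x * cnj (v j y)) -
    imm b S (\<lambda>x y. \<Sum>j\<in>I'. v j x * cnj (v j y)) \<in> \<real>\<^sub>\<ge>\<^sub>0"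
proof -
  have fin: "finite I'" using assms finite_subset by auto
  have sub: "(S \<rightarrow>\<^sub>E I') \<subseteq> (S \<rightarrow>\<^sub>E I)" using assms by (intro PiE_mono) auto
  have "finite (S \<rightarrow>\<^sub>E I)" using assms by (intro finite_PiE)
  have "J \<circ> p \<in> (S \<rightarrow>\<^sub>E I) - (S \<rightarrow>\<^sub>E I')" if J: "J \<in> (S \<rightarrow>\<^sub>E I) - (S \<rightarrow>\<^sub>E I')" and p: "p permutes S" for J p
  proof -
    have "J \<circ> p \<in> S \<rightarrow>\<^sub>E I"
      using comp_permutes_PiE[of J S "\<lambda>_. I" p] J p by (auto simp: comp_def)
    moreover have "J \<circ> p \<notin> S \<rightarrow>\<^sub>E I'"
    proof
      assume "J \<circ> p \<in> S \<rightarrow>\<^sub>E I'"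
      moreover have "(J \<circ> p) \<circ> inv_into UNIV p = J"
        using permutes_inv_o[OF p] by (simp add: comp_assoc)
      ultimately have "J \<in> S \<rightarrow>\<^sub>E I'"
        using comp_permutes_PiE[of "J \<circ> p" S "\<lambda>_. I'" "inv_into UNIV p"] permutes_inv[OF p]
        by (simp add: comp_def)
      with J show False by simp
    qed
    ultimately show ?thesis by simp
  qed
  then show ?thesis
    unfolding imm_gram[OF assms(1,2)] imm_gram[OF assms(1) fin]
    unfolding sum_diff[OF \<open>finite (S \<rightarrow>\<^sub>E I)\<close> sub, symmetric]
    by (intro sum_orbit_nonneg[OF assms(1)])
qed

text \<open>A permutation of \<open>insert x S\<close> either fixes \<open>x\<close> or arises from
  a permutation \<open>p\<close> of \<open>S\<close> by inserting \<open>x\<close> into a cycle,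
  between some \<open>c\<close> and \<open>p c\<close>. The insertion is one transposition, hence
  the sign \<open>-1\<close> for determinants.\<close>

lemma imm_insert:
  assumes S: "finite S" and x: "x \<notin> S"
  shows "imm b (insert x S) A = A x x * imm b S A + (if b then -1 else 1) *
    (\<Sum>c\<in>S. \<Sum>p | p permutes S. wsign b p * (A c x * A x (p c) * (\<Prod>i\<in>S - {c}. A i (p i))))"
proof -
  let ?f = "\<lambda>p. wsign b p * (\<Prod>i\<in>insert x S. A i (p i))"
  let ?g = "\<lambda>p c. wsign b p * (A c x * A x (p c) * (\<Prod>i\<in>S - {c}. A i (p i)))"
  have swap: "?f (Transposition.transpose x (p c) \<circ> p) = (if b then -1 else 1) * ?g p c"
    if p: "p permutes S" and c: "c \<in> S" for p c
  proof -
    have pc: "p c \<in> S" using p c by (simp add: permutes_in_image)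
    have px: "p x = x" using p x by (simp add: permutes_not_in)
    have ne: "x \<noteq> p c" using pc x by auto
    have "permutation p" using S p permutation_permutes by blast
    then have "sign (Transposition.transpose x (p c) \<circ> p) = - sign p"
      using ne by (simp add: sign_compose permutation_swap_id sign_swap_id)
    then have w: "wsign b (Transposition.transpose x (p c) \<circ> p) = (if b then -1 else 1) * wsign b p"
      by (simp add: wsign_def)
    have "(\<Prod>i\<in>S - {c}. A i ((Transposition.transpose x (p c) \<circ> p) i)) = (\<Prod>i\<in>S - {c}. A i (p i))"
    proof (rule prod.cong[OF refl])
      fix i assume i: "i \<in> S - {c}"
      then have "p i \<noteq> p c" using permutes_inj[OF p] by (auto dest: injD)
      moreover have "p i \<in> S" using i p by (simp add: permutes_in_image)
      ultimately show "A i ((Transposition.transpose x (p c) \<circ> p) i) = A i (p i)"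
        using x by (auto simp: Transposition.transpose_def)
    qed
    then have "(\<Prod>i\<in>insert x S. A i ((Transposition.transpose x (p c) \<circ> p) i)) =
        A x (p c) * (A c x * (\<Prod>i\<in>S - {c}. A i (p i)))"
      using S x c px by (simp add: prod.insert prod.remove[OF S c])
    then show ?thesis
      using w by (simp add: mult_ac)
  qed
  have "imm b (insert x S) A =
      (\<Sum>d\<in>insert x S. \<Sum>p | p permutes S. ?f (Transposition.transpose x d \<circ> p))"
    unfolding imm_def by (rule sum_over_permutations_insert[OF S x])
  also have "\<dots> = (\<Sum>p | p permutes S. ?f p) + (\<Sum>d\<in>S. \<Sum>p | p permutes S. ?f (Transposition.transpose x d \<circ> p))"
    using S x by simp
  also have "(\<Sum>p | p permutes S. ?f p) = A x x * imm b S A"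
    unfolding imm_def sum_distrib_left using S x
    by (intro sum.cong) (auto simp: permutes_not_in)
  also have "(\<Sum>d\<in>S. \<Sum>p | p permutes S. ?f (Transposition.transpose x d \<circ> p)) =
      (\<Sum>p | p permutes S. \<Sum>d\<in>S. ?f (Transposition.transpose x d \<circ> p))"
    by (rule sum.swap)
  \<comment> \<open>The sum over the image \<open>d\<close> of \<open>x\<close> becomes a sum over
    the predecessor \<open>c\<close> of \<open>x\<close>, with \<open>d = p c\<close>.\<close>
  also have "\<dots> = (\<Sum>p | p permutes S. \<Sum>c\<in>S. ?f (Transposition.transpose x (p c) \<circ> p))"
    by (intro sum.cong refl sum.reindex_bij_betw[symmetric] permutes_imp_bij) simp
  also have "\<dots> = (\<Sum>p | p permutes S. \<Sum>c\<in>S. (if b then -1 else 1) * ?g p c)"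
    by (intro sum.cong refl swap) auto
  also have "\<dots> = (if b then -1 else 1) * (\<Sum>c\<in>S. \<Sum>p | p permutes S. ?g p c)"
    by (subst sum.swap) (simp only: sum_distrib_left)
  finally show ?thesis .
qed

text \<open>The factor \<open>A c x * A x (p c)\<close> is a rank-one Gram entry, built from the
  vector \<open>A a x\<close> in \<open>a\<close>. So the remainder is again a sum over labellings,
  with this vector as an additional label \<open>None\<close> that is used at exactly one position
  \<open>c\<close>.\<close>

lemma imm_insert_remainder_nonneg:
  fixes v :: "'j \<Rightarrow> 'i \<Rightarrow> complex"
  assumes S: "finite S" and I: "finite I"
    and A: "\<And>x y. A x y = (\<Sum>j\<in>I. v j x * cnj (v j y))"
  shows "(\<Sum>c\<in>S. \<Sum>p | p permutes S. wsign b p *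
     (A c x * A x (p c) * (\<Prod>i\<in>S - {c}. A i (p i)))) \<in> \<real>\<^sub>\<ge>\<^sub>0"
proof -
  define u where "u j = (case j of None \<Rightarrow> (\<lambda>a. A a x) | Some j \<Rightarrow> v j)" for j
  define B where "B c = (\<lambda>i. if i = c then {None} else Some ` I)" for c :: 'i
  define T where "T = (\<Union>c\<in>S. PiE S (B c))"
  have herm: "cnj (A y z) = A z y" for y z
    unfolding A by (simp add: mult.commute)
  have "(\<Sum>J\<in>PiE S (B c). \<Prod>i\<in>S. u (J i) i * cnj (u (J i) (p i))) =
      A c x * A x (p c) * (\<Prod>i\<in>S - {c}. A i (p i))" if c: "c \<in> S" for c p
  proof -
    have "(\<Sum>J\<in>PiE S (B c). \<Prod>i\<in>S. u (J i) i * cnj (u (J i) (p i))) =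
        (\<Prod>i\<in>S. \<Sum>j\<in>B c i. u j i * cnj (u j (p i)))"
      using S I by (intro prod_sum_PiE[symmetric]) (auto simp: B_def)
    also have "\<dots> = (\<Sum>j\<in>B c c. u j c * cnj (u j (p c))) *
        (\<Prod>i\<in>S - {c}. \<Sum>j\<in>B c i. u j i * cnj (u j (p i)))"
      by (rule prod.remove[OF S c])
    also have "(\<Sum>j\<in>B c c. u j c * cnj (u j (p c))) = A c x * A x (p c)"
      by (simp add: B_def u_def herm)
    also have "(\<Prod>i\<in>S - {c}. \<Sum>j\<in>B c i. u j i * cnj (u j (p i))) = (\<Prod>i\<in>S - {c}. A i (p i))"
      by (intro prod.cong refl) (auto simp: B_def u_def A sum.reindex)
    finally show ?thesis .
  qed
  then have "(\<Sum>c\<in>S. \<Sum>p | p permutes S. wsign b p *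
      (A c x * A x (p c) * (\<Prod>i\<in>S - {c}. A i (p i)))) =
      (\<Sum>c\<in>S. \<Sum>p | p permutes S. wsign b p *
      (\<Sum>J\<in>PiE S (B c). \<Prod>i\<in>S. u (J i) i * cnj (u (J i) (p i))))"
    by simp
  also have "\<dots> = (\<Sum>c\<in>S. \<Sum>J\<in>PiE S (B c). \<Sum>p | p permutes S. wsign b p *
      (\<Prod>i\<in>S. u (J i) i * cnj (u (J i) (p i))))"
    unfolding sum_distrib_left by (intro sum.cong refl sum.swap)
  also have "\<dots> = (\<Sum>J\<in>T. \<Sum>p | p permutes S. wsign b p *
      (\<Prod>i\<in>S. u (J i) i * cnj (u (J i) (p i))))"
    unfolding T_def
  proof (rule sum.UNION_disjoint[symmetric, OF S])
    show "\<forall>c\<in>S. finite (PiE S (B c))"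
      using S I by (auto intro!: finite_PiE simp: B_def)
    show "\<forall>c\<in>S. \<forall>d\<in>S. c \<noteq> d \<longrightarrow> PiE S (B c) \<inter> PiE S (B d) = {}"
    proof (intro ballI impI)
      fix c d assume *: "c \<in> S" "d \<in> S" "c \<noteq> d"
      have False if "J \<in> PiE S (B c)" "J \<in> PiE S (B d)" for J
        using PiE_mem[OF that(1) *(1)] PiE_mem[OF that(2) *(1)] *(3) by (auto simp: B_def)
      then show "PiE S (B c) \<inter> PiE S (B d) = {}" by auto
    qed
  qed
  also have "\<dots> \<in> \<real>\<^sub>\<ge>\<^sub>0"
  proof (rule sum_orbit_nonneg[OF S])
    fix J p assume "J \<in> T" and p: "p permutes S"
    then obtain c where c: "c \<in> S" "J \<in> PiE S (B c)" by (auto simp: T_def)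
    have "J \<circ> p \<in> PiE S (B c \<circ> p)"
      using c p by (intro comp_permutes_PiE)
    \<comment> \<open>Permuting positions only moves the place of the label \<open>None\<close>, so
      the union over all places is stable.\<close>
    moreover have "B c \<circ> p = B (inv_into UNIV p c)"
      by (auto simp: B_def fun_eq_iff permutes_inverses[OF p])
    moreover have "inv_into UNIV p c \<in> S"
      using c p permutes_inv permutes_in_image by metis
    ultimately show "J \<circ> p \<in> T" by (auto simp: T_def)
  qed
  finally show ?thesis .
qed

text \<open>Hadamard's inequality and its analogue for permanents. Adding one index multiplies by a
  diagonal entry, up to the remainder of \<open>imm_insert\<close>; this is nonnegative and enters
  with a minus sign for determinants and a plus sign for permanents.\<close>

lemma imm_gram_compare_prod:
  fixes v :: "'j \<Rightarrow> 'i \<Rightarrow> complex"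
  assumes S: "finite S" and I: "finite I"
    and A: "\<And>x y. A x y = (\<Sum>j\<in>I. v j x * cnj (v j y))"
  shows "Re (imm True S A) \<le> (\<Prod>i\<in>S. Re (A i i))" "(\<Prod>i\<in>S. Re (A i i)) \<le> Re (imm False S A)"
proof -
  have A': "A = (\<lambda>x y. \<Sum>j\<in>I. v j x * cnj (v j y))" using A by (intro ext)
  have "A x x = of_real (\<Sum>j\<in>I. (cmod (v j x))\<^sup>2)" for x
    unfolding A by (simp only: of_real_sum complex_norm_square)
  then have diag: "Im (A x x) = 0" "Re (A x x) \<ge> 0" for x
    by (simp_all add: sum_nonneg)
  have *: "(if b then -1 else 1) * (Re (imm b (insert x S)  A) - Re (A x x) * Re (imm b S A)) \<ge> 0"
    if fx: "finite S" "x \<notin> S" for x S b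
  proof -
    define R where "R = (\<Sum>c\<in>S. \<Sum>p | p permutes S. wsign b p * (A c x * A x (p c) * (\<Prod>i\<in>S - {c}. A i (p i))))"
    have R: "Re R \<ge> 0"
      using imm_insert_remainder_nonneg[where A = A and v = v and b = b and x = x, OF fx(1) I A]
      unfolding R_def[symmetric] by (simp add: complex_nonneg_Reals_iff)
    have "imm b (insert x S) A = A x x * imm b S A + (if b then -1 else 1) * R"
      unfolding R_def by (rule imm_insert[OF fx])
    then show ?thesis
      using R diag(1)[of x] by (cases b) simp_all
  qed
  show "Re (imm True S A) \<le> (\<Prod>i\<in>S. Re (A i i))"
    using S
  proof (induction rule: finite_induct)
    case (insert x F)
    then show ?case
      using *[OF insert(1,2), where b = True] mult_left_mono[OF insert(3) diag(2)[of x]] by simp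
  qed (simp add: imm_def wsign_def)
  show "(\<Prod>i\<in>S. Re (A i i)) \<le> Re (imm False S A)"
    using S
  proof (induction rule: finite_induct)
    case (insert x F)
    then show ?case
      using *[OF insert(1,2), where b = False] mult_left_mono[OF insert(3) diag(2)[of x]] by simp
  qed (simp add: imm_def wsign_def)
qed

section \<open>Binomial moments of laws on the natural numbers\<close>

text \<open>Newton's series with exponent \<open>- (k + 1)\<close>. It serves twice: as the majorant
  of a Taylor series and for the binomial moments of the geometric law.\<close>

lemma negative_binomial_sums:
  fixes x :: real
  assumes "0 \<le> x" "x < 1"
  shows "(\<lambda>l. real (l + k choose k) * x ^ l) sums (1 / (1 - x) ^ Suc k)"
proof -
  have "(\<lambda>l. ((- real (Suc k)) gchoose l) * (- x) ^ l) sums (1 + (- x)) powr (- real (Suc k))"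
    using assms by (intro gen_binomial_real) auto
  moreover have "((- real (Suc k)) gchoose l) * (- x) ^ l = real (l + k choose k) * x ^ l" for l
  proof -
    have "(- real (Suc k)) gchoose l = (-1) ^ l * (real (l + k) gchoose l)"
      by (subst gbinomial_negated_upper) (simp add: algebra_simps)
    also have "real (l + k) gchoose l = real (l + k choose k)"
      by (subst binomial_gbinomial[symmetric], subst binomial_symmetric) simp_all
    finally have e: "(- real (Suc k)) gchoose l = (-1) ^ l * real (l + k choose k)" .
    have "(- x) ^ l = (-1) ^ l * x ^ l"
      by (metis mult_minus1 power_mult_distrib)
    then show ?thesis
      unfolding e by (simp flip: power_mult_distrib mult.assoc)
  qed
  moreover have "(1 + (- x)) powr (- real (Suc k)) = 1 / (1 - x) ^ Suc k"
    using assms by (simp add: powr_minus_divide powr_realpow flip: of_nat_Suc)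
  ultimately show ?thesis by simp
qed

section \<open>Taylor coefficients of probability generating functions\<close>

definition bmom :: "nat pmf \<Rightarrow> nat \<Rightarrow> ennreal" where
  "bmom p k = (\<integral>\<^sup>+x. of_nat (x choose k) \<partial>measure_pmf p)"

text \<open>Where the truncated subtraction \<open>x - k\<close> differs from the true one, the
  binomial coefficient is 0. For \<open>0 \<le> z \<le> 1\<close> the expectation exists as soon as
  \<open>bmom p k\<close> is finite.\<close>

definition thin_mom :: "nat pmf \<Rightarrow> real \<Rightarrow> nat \<Rightarrow> real" where
  "thin_mom p z k = measure_pmf.expectation p (\<lambda>x. real (x choose k) * z ^ (x - k))"

lemma bmom_real:
  assumes "bmom p k \<le> ennreal c"
  shows "integrable (measure_pmf p) (\<lambda>x. real (x choose k))"
    and "ennreal (measure_pmf.expectation p (\<lambda>x. real (x choose k))) = bmom p k"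
proof -
  have "(\<integral>\<^sup>+x. ennreal (real (x choose k)) \<partial>measure_pmf p) = bmom p k"
    by (simp add: bmom_def ennreal_of_nat_eq_real_of_nat)
  then show "integrable (measure_pmf p) (\<lambda>x. real (x choose k))"
    using assms by (intro integrableI_nonneg) (auto simp: top_unique less_top[symmetric])
  then show "ennreal (measure_pmf.expectation p (\<lambda>x. real (x choose k))) = bmom p k"
    by (subst nn_integral_eq_integral[symmetric])
      (auto simp: bmom_def ennreal_of_nat_eq_real_of_nat)
qed

lemma thin_mom_bounds:
  assumes "bmom p k \<le> ennreal c" "0 \<le> c" "0 \<le> z" "z \<le> 1"
  shows "integrable (measure_pmf p) (\<lambda>x. real (x choose k) * z ^ (x - k))"
    and "0 \<le> thin_mom p z k" "thin_mom p z k \<le> c"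
proof -
  have le: "real (x choose k) * z ^ (x - k) \<le> real (x choose k)" for x
    using assms by (simp add: mult_left_le power_le_one)
  show int: "integrable (measure_pmf p) (\<lambda>x. real (x choose k) * z ^ (x - k))"
    by (rule Bochner_Integration.integrable_bound[OF bmom_real(1)[OF assms(1)]])
      (use le assms in auto)
  show "0 \<le> thin_mom p z k"
    using assms by (simp add: thin_mom_def)
  have "thin_mom p z k \<le> measure_pmf.expectation p (\<lambda>x. real (x choose k))"
    unfolding thin_mom_def using le by (intro integral_mono int bmom_real(1)[OF assms(1)])
  also have "\<dots> \<le> c"
    using bmom_real(2)[OF assms(1)] assms(1,2) by (metis ennreal_le_iff)
  finally show "thin_mom p z k \<le> c" .
qed

text \<open>Taylor's formula for a derivative of \<open>z ^ x\<close>. The identity \<open>(x choose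
  (l + k)) * (l + k choose k) = (x choose k) * (x - k choose l)\<close> reduces it to the binomial
  theorem; the terms with \<open>l > x - k\<close> vanish.\<close>

lemma thin_expansion_point:
  fixes h z :: real
  shows "(\<lambda>l. (- h) ^ l * real (l + k choose k) * (real (x choose (l + k)) * z ^ (x - (l + k)))) sums
     (real (x choose k) * (z - h) ^ (x - k))"
proof (cases "k \<le> x")
  case True
  have "(\<lambda>l. (- h) ^ l * real (l + k choose k) * (real (x choose (l + k)) * z ^ (x - (l + k)))) sums
     (\<Sum>l\<in>{..x - k}. (- h) ^ l * real (l + k choose k) * (real (x choose (l + k)) * z ^ (x - (l + k))))"
    by (rule sums_finite) auto
  also have "(\<Sum>l\<in>{..x - k}. (- h) ^ l * real (l + k choose k) * (real (x choose (l + k)) * z ^ (x - (l + k)))) =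
     (\<Sum>l\<in>{..x - k}. real (x choose k) * (real (x - k choose l) * (- h) ^ l * z ^ (x - k - l)))"
  proof (rule sum.cong[OF refl])
    fix l assume "l \<in> {..x - k}"
    then have "(x choose (l + k)) * (l + k choose k) = (x choose k) * (x - k choose l)"
      using True by (subst choose_mult) auto
    then have "real (x choose (l + k)) * real (l + k choose k) = real (x choose k) * real (x - k choose l)"
      by (metis of_nat_mult)
    then show "(- h) ^ l * real (l + k choose k) * (real (x choose (l + k)) * z ^ (x - (l + k))) =
       real (x choose k) * (real (x - k choose l) * (- h) ^ l * z ^ (x - k - l))"
      by (simp add: mult_ac add.commute)
  qed
  also have "\<dots> = real (x choose k) * (z - h) ^ (x - k)"
    using binomial_ring[of "- h" z "x - k"] by (simp add: sum_distrib_left)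
  finally show ?thesis .
qed (simp add: binomial_eq_0)

text \<open>All Taylor coefficients of order \<open>k\<close> on the unit interval are at most
  \<open>L ^ k\<close>, so the expansion about \<open>z\<close> converges for steps with
  \<open>h * L < 1\<close>, and the same majorant justifies exchanging expectation and series. It
  does not depend on \<open>p\<close>, which later allows a limit under the sum.\<close>

lemma thin_mom_step:
  assumes L: "\<And>k. bmom p k \<le> ennreal (L ^ k)" "0 \<le> L" and h: "0 \<le> h" "h * L < 1"
    and z: "0 \<le> z" "z \<le> 1"
  shows "thin_mom p (z - h) k = (\<Sum>l. (- h) ^ l * real (l + k choose k) * thin_mom p z (l + k))"
    and "\<bar>(- h) ^ l * real (l + k choose k) * thin_mom p z (l + k)\<bar> \<le>
        L ^ k * (real (l + k choose k) * (h * L) ^ l)"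
    and "summable (\<lambda>l. L ^ k * (real (l + k choose k) * (h * L) ^ l))"
proof -
  note th = thin_mom_bounds[OF L(1) zero_le_power[OF L(2)] z]
  have bd: "\<bar>(- h) ^ l * real (l + k choose k) * thin_mom p z (l + k)\<bar> \<le>
        L ^ k * (real (l + k choose k) * (h * L) ^ l)" for l
  proof -
    have "\<bar>(- h) ^ l * real (l + k choose k) * thin_mom p z (l + k)\<bar> =
        (h ^ l * real (l + k choose k)) * thin_mom p z (l + k)"
      using h th(2) by (simp add: abs_mult power_abs)
    also have "\<dots> \<le> (h ^ l * real (l + k choose k)) * L ^ (l + k)"
      using h th(3) by (intro mult_left_mono) auto
    finally show ?thesis by (simp add: power_add power_mult_distrib mult_ac)
  qed
  then show "\<bar>(- h) ^ l * real (l + k choose k) * thin_mom p z (l + k)\<bar> \<le>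
        L ^ k * (real (l + k choose k) * (h * L) ^ l)" .
  show summ: "summable (\<lambda>l. L ^ k * (real (l + k choose k) * (h * L) ^ l))"
    using negative_binomial_sums[of "h * L" k] h L(2) by (intro summable_mult) (auto simp: sums_iff)
  let ?f = "\<lambda>l x. (- h) ^ l * real (l + k choose k) * (real (x choose (l + k)) * z ^ (x - (l + k)))"
  have "thin_mom p (z - h) k = measure_pmf.expectation p (\<lambda>x. \<Sum>l. ?f l x)"
    unfolding thin_mom_def using thin_expansion_point by (simp add: sums_iff)
  also have "\<dots> = (\<Sum>l. measure_pmf.expectation p (?f l))"
  proof (rule integral_suminf)
    show "integrable (measure_pmf p) (?f l)" for l
      using th(1) by (intro integrable_mult_right) auto
    have "summable (\<lambda>l. norm (?f l x))" for x
      by (rule summable_finite[of "{..x}"]) (auto simp: binomial_eq_0)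
    then show "AE x in measure_pmf p. summable (\<lambda>l. norm (?f l x))"
      by simp
    have "(\<integral>x. norm (?f l x) \<partial>measure_pmf p) = \<bar>(- h) ^ l * real (l + k choose k) * thin_mom p z (l + k)\<bar>" for l
      unfolding thin_mom_def using z
      by (subst abs_mult, subst abs_of_nonneg[of "measure_pmf.expectation p f" for f])
         (auto simp: abs_mult power_abs intro!: integral_nonneg_AE)
    then show "summable (\<lambda>l. \<integral>x. norm (?f l x) \<partial>measure_pmf p)"
      using bd by (intro summable_comparison_test'[OF summ]) auto
  qed
  also have "\<dots> = (\<Sum>l. (- h) ^ l * real (l + k choose k) * thin_mom p z (l + k))"
    unfolding thin_mom_def by simp
  finally show "thin_mom p (z - h) k = (\<Sum>l. (- h) ^ l * real (l + k choose k) * thin_mom p z (l + k))" .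
qed

text \<open>
  The probability generating function has Taylor coefficients \<^term>\<open>thin_mom p z k\<close> at \<open>z\<close>,
  bounded by \<open>L\<^sup>k\<close> uniformly in \<open>z \<in> {0..1}\<close>. So convergence of the coefficients propagates
  from \<open>z = 1\<close>, where they are the binomial moments, to \<open>z = 0\<close> in finitely many steps.
\<close>

lemma pmf_tendsto_of_bmom_tendsto:
  assumes P: "\<And>n k. bmom (P n) k \<le> ennreal (L ^ k)" and p: "\<And>k. bmom p k \<le> ennreal (L ^ k)"
    and L: "0 \<le> L" and lim: "\<And>k. (\<lambda>n. bmom (P n) k) \<longlonglongrightarrow> bmom p k"
  shows "(\<lambda>n. pmf (P n) m) \<longlonglongrightarrow> pmf p m"
proof -
  \<comment> \<open>Steps of length \<open>1 / N\<close> with \<open>N > L\<close> stay within the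
    radius of convergence and land exactly on 0 after \<open>N\<close> of them.\<close>
  obtain N :: nat where N: "real N > L"
    using reals_Archimedean2 by blast
  define h where "h = 1 / real N"
  have N0: "real N > 0" using N L by simp
  then have h: "0 \<le> h" "h * L < 1" "real N * h = 1"
    using N by (auto simp: h_def)
  have one: "ennreal (thin_mom q 1 k) = bmom q k" if "bmom q k \<le> ennreal (L ^ k)" for q k
    using bmom_real(2)[OF that] by (simp add: thin_mom_def)
  have zero: "thin_mom q 0 k = pmf q k" for q k
  proof -
    \<comment> \<open>By truncated subtraction and \<open>0 ^ 0 = 1\<close> the power is 1 for all
      \<open>x \<le> k\<close>; the binomial coefficient removes \<open>x < k\<close>.\<close>
    have "(\<lambda>x. real (x choose k) * 0 ^ (x - k)) = (indicator {k} :: nat \<Rightarrow> real)"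
      by (auto simp: fun_eq_iff indicator_def power_0_left)
    then show ?thesis
      by (simp add: thin_mom_def pmf.rep_eq)
  qed
  have "(\<lambda>n. thin_mom (P n) (1 - real r * h) k) \<longlonglongrightarrow> thin_mom p (1 - real r * h) k" if "r \<le> N" for r k
    using that
  proof (induction r arbitrary: k)
    case 0
    have "(\<lambda>n. ennreal (thin_mom (P n) 1 k)) \<longlonglongrightarrow> ennreal (thin_mom p 1 k)"
      using lim[of k] by (simp add: one P p)
    then show ?case
      using thin_mom_bounds(2)[OF P zero_le_power[OF L], of 1]
        thin_mom_bounds(2)[OF p zero_le_power[OF L], of 1]
      by (subst (asm) tendsto_ennreal_iff) auto
  next
    case (Suc r)
    have "real r * h \<le> real N * h"
      using Suc.prems h by (intro mult_right_mono) auto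
    then have z: "0 \<le> 1 - real r * h" "1 - real r * h \<le> 1"
      using h by simp_all
    have e: "1 - real (Suc r) * h = (1 - real r * h) - h"
      by (simp add: algebra_simps)
    note st = thin_mom_step[OF P L h(1,2) z]
    note sp = thin_mom_step[OF p L h(1,2) z]
    have "(\<lambda>n. \<Sum>l. (- h) ^ l * real (l + k choose k) * thin_mom (P n) (1 - real r * h) (l + k)) \<longlonglongrightarrow>
        (\<Sum>l. (- h) ^ l * real (l + k choose k) * thin_mom p (1 - real r * h) (l + k))"
    proof (rule conjunct2[OF conjunct2[OF tannerys_theorem]])
      show "(\<lambda>n. (- h) ^ l * real (l + k choose k) * thin_mom (P n) (1 - real r * h) (l + k)) \<longlonglongrightarrow>
        (- h) ^ l * real (l + k choose k) * thin_mom p (1 - real r * h) (l + k)" for l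
        using Suc by (intro tendsto_intros) auto
      show "summable (\<lambda>l. L ^ k * (real (l + k choose k) * (h * L) ^ l))"
        by (rule st(3))
      show "\<forall>\<^sub>F (l, n) in sequentially \<times>\<^sub>F sequentially.
          norm ((- h) ^ l * real (l + k choose k) * thin_mom (P n) (1 - real r * h) (l + k)) \<le>
          L ^ k * (real (l + k choose k) * (h * L) ^ l)"
        using st(2) by (intro always_eventually) auto
    qed auto
    then show ?case
      unfolding e st(1) sp(1) .
  qed
  from this[of N m] show ?thesis
    by (simp add: h zero)
qed

section \<open>The convex order on the natural numbers\<close>

text \<open>Truncated subtraction makes \<open>k - x\<close> the positive part. For laws with equal means,
  \<open>put_le\<close> is the convex order.\<close>

definition put :: "nat pmf \<Rightarrow> nat \<Rightarrow> ennreal" where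
  "put p k = (\<integral>\<^sup>+x. of_nat (k - x) \<partial>measure_pmf p)"

definition put_le :: "nat pmf \<Rightarrow> nat pmf \<Rightarrow> bool" where
  "put_le p q \<longleftrightarrow> (\<forall>k. put p k \<le> put q k)"

definition conv_pmf :: "nat pmf \<Rightarrow> nat pmf \<Rightarrow> nat pmf" where
  "conv_pmf p q = bind_pmf p (\<lambda>x. map_pmf (\<lambda>y. x + y) q)"

lemma conv_pmf_commute: "conv_pmf p q = conv_pmf q p"
  unfolding conv_pmf_def map_pmf_def by (subst bind_commute_pmf) (simp add: add.commute)

text \<open>Truncated subtraction satisfies \<open>k - (x + y) = (k - x) - y\<close>, so
  conditioning on one summand yields a put on the other whose strike is again a natural
  number.\<close>

lemma put_conv_pmf: "put (conv_pmf p q) k = (\<integral>\<^sup>+x. put q (k - x) \<partial>measure_pmf p)"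
  by (simp add: put_def conv_pmf_def)

text \<open>One summand is exchanged at a time; commutativity covers the second exchange.\<close>

lemma put_le_conv_pmf:
  assumes "put_le p p'" "put_le q q'"
  shows "put_le (conv_pmf p q) (conv_pmf p' q')"
proof -
  have mono: "put_le (conv_pmf r s) (conv_pmf r s')" if "put_le s s'" for r s s'
    using that by (auto simp: put_le_def put_conv_pmf intro!: nn_integral_mono)
  have "put_le (conv_pmf p q) (conv_pmf p q')" "put_le (conv_pmf q' p) (conv_pmf q' p')"
    using mono assms by auto
  then show ?thesis
    unfolding put_le_def by (metis conv_pmf_commute order_trans)
qed

text \<open>Vandermonde's identity: generating functions of binomial moments multiply under
  convolution. In \<open>ennreal\<close> this holds whether or not the moments are finite.\<close>

lemma bmom_conv_pmf: "bmom (conv_pmf p q) k = (\<Sum>i\<le>k. bmom p i * bmom q (k - i))"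
proof -
  have "bmom (conv_pmf p q) k =
      (\<integral>\<^sup>+x. \<integral>\<^sup>+y. (\<Sum>i\<le>k. of_nat (x choose i) * of_nat (y choose (k - i))) \<partial>q \<partial>p)"
    by (simp add: bmom_def conv_pmf_def vandermonde[symmetric])
  also have "\<dots> = (\<Sum>i\<le>k. bmom p i * bmom q (k - i))"
    by (simp add: bmom_def nn_integral_sum nn_integral_cmult nn_integral_multc)
  finally show ?thesis .
qed

primrec sum_law :: "(nat \<Rightarrow> nat pmf) \<Rightarrow> nat \<Rightarrow> nat pmf" where
  "sum_law s 0 = return_pmf 0"
| "sum_law s (Suc n) = conv_pmf (s n) (sum_law s n)"

lemma put_le_sum_law: "(\<And>n. put_le (s n) (t n)) \<Longrightarrow> put_le (sum_law s n) (sum_law t n)"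
  by (induction n) (auto intro: put_le_conv_pmf simp: put_le_def[of p p for p])

text \<open>Only values below the strike contribute, and these are finitely many. Hence
  \<open>put_le\<close> passes to pointwise limits of the probabilities.\<close>

lemma put_eq_sum: "put p k = ennreal (\<Sum>i<k. real (k - i) * pmf p i)"
proof -
  have "put p k = (\<integral>\<^sup>+x. ennreal (real (k - x)) * indicator {..<k} x \<partial>measure_pmf p)"
    unfolding put_def by (intro nn_integral_cong) (auto simp: ennreal_of_nat_eq_real_of_nat indicator_def)
  also have "\<dots> = (\<Sum>i<k. ennreal (real (k - i)) * emeasure (measure_pmf p) {i})"
    by (rule nn_integral_indicator_finite) auto
  also have "\<dots> = ennreal (\<Sum>i<k. real (k - i) * pmf p i)"
    by (subst sum_ennreal[symmetric]) (auto simp: emeasure_pmf_single ennreal_mult simp del: of_nat_diff)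
  finally show ?thesis .
qed

lemma put_le_iff: "put_le p q \<longleftrightarrow>
   (\<forall>k. (\<Sum>i<k. real (k - i) * pmf p i) \<le> (\<Sum>i<k. real (k - i) * pmf q i))"
proof -
  have "0 \<le> (\<Sum>i<k. real (k - i) * pmf q i)" for k
    by (intro sum_nonneg mult_nonneg_nonneg) auto
  then show ?thesis
    by (simp add: put_le_def put_eq_sum del: of_nat_diff)
qed

lemma put_le_tendsto:
  assumes "\<And>m. (\<lambda>n. pmf (P n) m) \<longlonglongrightarrow> pmf p m" "\<And>m. (\<lambda>n. pmf (Q n) m) \<longlonglongrightarrow> pmf q m"
    and "\<And>n. put_le (P n) (Q n)"
  shows "put_le p q"
  unfolding put_le_iff
proof
  fix k
  have "(\<lambda>n. \<Sum>i<k. real (k - i) * pmf (P n) i) \<longlonglongrightarrow> (\<Sum>i<k. real (k - i) * pmf p i)"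
    "(\<lambda>n. \<Sum>i<k. real (k - i) * pmf (Q n) i) \<longlonglongrightarrow> (\<Sum>i<k. real (k - i) * pmf q i)"
    by (intro tendsto_intros assms)+
  then show "(\<Sum>i<k. real (k - i) * pmf p i) \<le> (\<Sum>i<k. real (k - i) * pmf q i)"
    by (rule LIMSEQ_le) (use assms(3) in \<open>auto simp: put_le_iff simp del: of_nat_diff\<close>)
qed

text \<open>The put with strike 1 is the probability of 0. This is how void probabilities follow
  from the convex comparison.\<close>

lemma put_le_pmf_0: "put_le p q \<Longrightarrow> pmf p 0 \<le> pmf q 0"
  by (auto simp: put_le_iff dest: spec[of _ 1])

text \<open>When \<open>f\<close> is a probability mass function: the increment of a put in its
  strike is the distribution function.\<close>

lemma sum_hockey_Suc:
  fixes f :: "nat \<Rightarrow> real"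
  shows "(\<Sum>i<Suc k. real (Suc k - i) * f i) = (\<Sum>i<k. real (k - i) * f i) + (\<Sum>i\<le>k. f i)"
proof -
  have "(\<Sum>i<Suc k. real (Suc k - i) * f i) = (\<Sum>i<Suc k. real (k - i) * f i + f i)"
    by (intro sum.cong refl) (auto simp: Suc_diff_le algebra_simps)
  also have "\<dots> = (\<Sum>i<k. real (k - i) * f i) + (\<Sum>i\<le>k. f i)"
    by (simp add: sum.distrib lessThan_Suc_atMost[symmetric] del: lessThan_Suc_atMost)
  finally show ?thesis .
qed

section \<open>Bernoulli and geometric laws against the Poisson law\<close>

definition weight_pmf :: "bool \<Rightarrow> real \<Rightarrow> nat pmf" where
  "weight_pmf b r = (if b then map_pmf of_bool (bernoulli_pmf r) else geometric_pmf (1 / (1 + r)))"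

lemma pmf_Poi: "0 \<le> r \<Longrightarrow> pmf (Poi r) k = r ^ k / fact k * exp (- r)"
  by (cases k) (auto simp: Poi_def)

lemma nn_integral_nat_pmf: "(\<integral>\<^sup>+x. f x \<partial>measure_pmf p) = (\<Sum>m. f m * ennreal (pmf p m))"
  for p :: "nat pmf"
  by (simp add: nn_integral_measure_pmf nn_integral_count_space_nat mult.commute)

lemma bmom_eq_of_sums:
  assumes "(\<lambda>l. real (l + k choose k) * pmf p (l + k)) sums c"
  shows "bmom p k = ennreal c"
proof -
  have "(\<lambda>m. real (m choose k) * pmf p m) sums c"
    using assms by (subst (asm) sums_iff_shift) (simp add: binomial_eq_0)
  moreover have "bmom p k = (\<Sum>m. ennreal (real (m choose k) * pmf p m))"
    by (simp add: bmom_def nn_integral_nat_pmf ennreal_of_nat_eq_real_of_nat ennreal_mult)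
  ultimately show ?thesis
    by (simp add: suminf_ennreal2 sums_iff)
qed

lemma bmom_Poi:
  assumes "0 \<le> r"
  shows "bmom (Poi r) k = ennreal (r ^ k / fact k)"
proof (rule bmom_eq_of_sums)
  have "(\<lambda>l. r ^ k / fact k * exp (- r) * (r ^ l / fact l)) sums (r ^ k / fact k * exp (- r) * exp r)"
    using exp_converges[of r] by (intro sums_mult) (simp add: field_simps)
  moreover have "real (l + k choose k) * pmf (Poi r) (l + k) = r ^ k / fact k * exp (- r) * (r ^ l / fact l)" for l
    using assms by (simp add: pmf_Poi binomial_fact power_add)
  ultimately show "(\<lambda>l. real (l + k choose k) * pmf (Poi r) (l + k)) sums (r ^ k / fact k)"
    by (simp add: mult.assoc flip: exp_add)
qed

text \<open>The generating functions of the binomial moments are \<open>1 + r t\<close> and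
  \<open>1 / (1 - r t)\<close>. The geometric law has mean \<open>r\<close> for success probability
  \<open>1 / (1 + r)\<close>; the number \<open>x\<close> in the proof is its failure probability,
  whose odds are \<open>r\<close>.\<close>

lemma bmom_weight_pmf:
  assumes "0 \<le> r" "b \<Longrightarrow> r \<le> 1"
  shows "bmom (weight_pmf b r) k = ennreal ((if b \<and> 1 < k then 0 else 1) * r ^ k)"
proof (cases b)
  case True
  then show ?thesis
    using assms by (cases k) (auto simp: bmom_def weight_pmf_def binomial_eq_0 ennreal_plus[symmetric] simp del: ennreal_plus)
next
  case False
  define x where "x = r / (1 + r)"
  have x: "0 \<le> x" "x < 1" "1 - 1 / (1 + r) = x" "1 / (1 + r) = 1 - x"
    using assms by (auto simp: x_def field_simps)
  have "(\<lambda>l. (1 - x) * x ^ k * (real (l + k choose k) * x ^ l)) sums ((1 - x) * x ^ k * (1 / (1 - x) ^ Suc k))"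
    by (intro sums_mult negative_binomial_sums x)
  moreover have "(1 - x) * x ^ k * (1 / (1 - x) ^ Suc k) = r ^ k"
  proof -
    have "x / (1 - x) = r" using assms by (auto simp: x_def field_simps)
    then show ?thesis using x by (auto simp flip: power_divide)
  qed
  ultimately show ?thesis
    using False assms x by (intro bmom_eq_of_sums) (simp add: weight_pmf_def power_add mult_ac)
qed

lemma Poi_mean:
  assumes "0 \<le> r"
  shows "integrable (measure_pmf (Poi r)) real" "measure_pmf.expectation (Poi r) real = r"
proof -
  have b: "bmom (Poi r) 1 = ennreal r" using bmom_Poi[OF assms, of 1] by simp
  show "integrable (measure_pmf (Poi r)) real"
    using bmom_real(1)[of "Poi r" 1 r] b by simp
  have "ennreal (measure_pmf.expectation (Poi r) real) = ennreal r"
    using bmom_real(2)[of "Poi r" 1 r] b by simp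
  then show "measure_pmf.expectation (Poi r) real = r"
    using assms by (subst (asm) ennreal_inj) auto
qed

text \<open>For strike 1 the claim is \<open>1 - r \<le> exp (- r)\<close>. A larger strike
  \<open>k\<close> is never exceeded by a Bernoulli variable, so its put is \<open>k - r\<close>;
  this bounds the Poisson put from below, because both means are \<open>r\<close> and
  \<open>k - x\<close> is at most its positive part.\<close>

lemma put_le_Bernoulli_Poi:
  assumes "0 \<le> r" "r \<le> 1"
  shows "put_le (weight_pmf True r) (Poi r)"
proof -
  have pm: "pmf (weight_pmf True r) i = (if i = 0 then 1 - r else if i = 1 then r else 0)" for i
  proof -
    have "pmf (weight_pmf True r) i = measure (measure_pmf (bernoulli_pmf r)) ((\<lambda>b. of_bool b) -` {i})"
      by (simp add: weight_pmf_def pmf_map)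
    also have "(\<lambda>b. of_bool b) -` {i} = (if i = 0 then {False} else if i = 1 then {True} else {})"
    proof (rule Set.set_eqI)
      show "b \<in> (\<lambda>b. of_bool b) -` {i} \<longleftrightarrow> b \<in> (if i = 0 then {False} else if i = 1 then {True} else {})" for b
        by (cases b) auto
    qed
    finally show ?thesis using assms by (simp add: measure_pmf_single)
  qed
  show ?thesis
    unfolding put_le_iff
  proof
    fix k :: nat
    consider "k = 0" | "k = 1" | "k \<ge> 2" by linarith
    then show "(\<Sum>i<k. real (k - i) * pmf (weight_pmf True r) i) \<le> (\<Sum>i<k. real (k - i) * pmf (Poi r) i)"
    proof cases
      case 2
      then show ?thesis
        using assms exp_ge_add_one_self[of "- r"] by (simp add: pm pmf_Poi)
    next
      case 3
      then obtain n where k: "k = Suc (Suc n)" by (metis add_2_eq_Suc le_Suc_ex)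
      have "(\<Sum>i<k. real (k - i) * pmf (weight_pmf True r) i) = (\<Sum>i<2. real (k - i) * pmf (weight_pmf True r) i)"
        using 3 by (intro sum.mono_neutral_right) (auto simp: pm)
      also have "\<dots> = real k - r"
      proof -
        have "{..<2::nat} = {0, 1}" by auto
        then show ?thesis using 3 by (simp add: pm of_nat_diff algebra_simps)
      qed
      also have "real k - r \<le> (\<Sum>i<k. real (k - i) * pmf (Poi r) i)"
      proof -
        note int = Poi_mean(1)[OF assms(1)]
        have "real k - r = measure_pmf.expectation (Poi r) (\<lambda>x. real k - real x)"
          using int Poi_mean(2)[OF assms(1)] by simp
        also have "\<dots> \<le> measure_pmf.expectation (Poi r) (\<lambda>x. real (k - x))"
          by (intro integral_mono measure_pmf.integrable_const_bound[where B = "real k"] Bochner_Integration.integrable_diff int) auto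
        also have "\<dots> = (\<Sum>i<k. real (k - i) * pmf (Poi r) i)"
          by (rule integral_measure_pmf_real) auto
        finally show ?thesis .
      qed
      finally show ?thesis .
    qed simp
  qed
qed

text \<open>With \<open>s k\<close> the put of strike \<open>k\<close>, the combination
  \<open>(1 + r) * s (k + 1) - r * s k\<close> equals \<open>k + 1\<close> for the geometric law and
  \<open>(k + 1) * F (k + 1)\<close> for the Poisson law, where \<open>F \<le> 1\<close> is the
  Poisson distribution function. Induction on the strike compares the two. The combination comes
  from the recursion \<open>(1 + r) * g (k + 1) = r * g k\<close> of the geometric
  probabilities.\<close>

lemma put_le_Poi_geometric:
  assumes r: "0 \<le> r"
  shows "put_le (Poi r) (weight_pmf False r)"
proof -
  define p where "p = pmf (Poi r)"
  define g where "g = pmf (weight_pmf False r)"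
  define s where "s f k = (\<Sum>i<k. real (k - i) * f i)" for f :: "nat \<Rightarrow> real" and k
  have s_Suc: "s f (Suc k) = s f k + (\<Sum>i\<le>k. f i)" for f k
    unfolding s_def by (rule sum_hockey_Suc)
  have p_Suc: "real (Suc k) * p (Suc k) = r * p k" for k
    using r by (simp add: p_def pmf_Poi fact_Suc del: of_nat_Suc)
  have g0: "(1 + r) * g 0 = 1" and g_Suc: "(1 + r) * g (Suc k) = r * g k" for k
  proof -
    have e: "1 - 1 / (1 + r) = r / (1 + r)" using r by (simp add: field_simps)
    show "(1 + r) * g 0 = 1" "(1 + r) * g (Suc k) = r * g k"
      using r unfolding g_def weight_pmf_def by (simp_all add: e)
  qed
  have "s p 0 = 0" "s g 0 = 0"
    by (simp_all add: s_def)
  have sp: "(1 + r) * s p (Suc k) - r * s p k = real (Suc k) * (\<Sum>i\<le>Suc k. p i)" for k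
  proof (induction k)
    case 0
    then show ?case using p_Suc[of 0] by (simp add: s_Suc \<open>s p 0 = 0\<close> algebra_simps)
  next
    case (Suc k)
    have "(1 + r) * s p (Suc (Suc k)) - r * s p (Suc k) =
        ((1 + r) * s p (Suc k) - r * s p k) + (\<Sum>i\<le>Suc k. p i) + r * p (Suc k)"
      by (simp add: s_Suc[of p "Suc k"] s_Suc[of p k] algebra_simps)
    also have "\<dots> = real (Suc (Suc k)) * (\<Sum>i\<le>Suc (Suc k). p i)"
      unfolding Suc.IH using p_Suc[of "Suc k"] by (simp add: algebra_simps)
    finally show ?case .
  qed
  have G: "(1 + r) * (\<Sum>i\<le>Suc k. g i) - r * (\<Sum>i\<le>k. g i) = 1" for k
  proof (induction k)
    case (Suc k)
    then show ?case using g_Suc[of "Suc k"] by (simp add: algebra_simps)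
  qed (use g_Suc[of 0] g0 in \<open>simp add: algebra_simps\<close>)
  have sg: "(1 + r) * s g (Suc k) - r * s g k = real (Suc k)" for k
  proof (induction k)
    case 0
    then show ?case using g0 by (simp add: s_Suc \<open>s g 0 = 0\<close>)
  next
    case (Suc k)
    have "(1 + r) * s g (Suc (Suc k)) - r * s g (Suc k) =
        ((1 + r) * s g (Suc k) - r * s g k) + ((1 + r) * (\<Sum>i\<le>Suc k. g i) - r * (\<Sum>i\<le>k. g i))"
      by (simp only: s_Suc algebra_simps)
    then show ?case unfolding Suc.IH G by simp
  qed
  have "s p k \<le> s g k" for k
  proof (induction k)
    case (Suc k)
    have "(\<Sum>i\<le>Suc k. p i) \<le> 1"
      unfolding p_def by (subst measure_measure_pmf_finite[symmetric]) (auto intro: measure_pmf.prob_le_1)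
    then have "real (Suc k) * (\<Sum>i\<le>Suc k. p i) \<le> real (Suc k)"
      by (metis mult.right_neutral mult_left_mono of_nat_0_le_iff)
    then have "(1 + r) * s p (Suc k) - r * s p k \<le> (1 + r) * s g (Suc k) - r * s g k"
      by (simp only: sp sg)
    moreover have "r * s p k \<le> r * s g k"
      using Suc r by (rule mult_left_mono)
    ultimately have "(1 + r) * s p (Suc k) \<le> (1 + r) * s g (Suc k)" by linarith
    then show ?case using r by simp
  qed (simp add: s_def)
  then show ?thesis
    by (simp add: put_le_iff s_def p_def g_def)
qed

section \<open>Convex functions as mixtures of puts\<close>

text \<open>
  The convex function is approximated from below by functions that agree with it up to \<open>n\<close> and
  continue linearly; consecutive ones differ by a multiple of a put.
\<close>

primrec trunc_fun :: "(nat \<Rightarrow> real) \<Rightarrow> nat \<Rightarrow> nat \<Rightarrow> real" where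
  "trunc_fun f 0 x = f 0 + (f 1 - f 0) * real x"
| "trunc_fun f (Suc n) x =
     trunc_fun f n x + (f (n + 2) - 2 * f (n + 1) + f n) * (real x - real (Suc n) + real (Suc n - x))"

text \<open>By put-call parity the term added at stage \<open>n + 1\<close> is a multiple of the
  positive part of \<open>x - (n + 1)\<close>, so it bends the function at \<open>n + 1\<close>
  only. The slope therefore follows \<open>f\<close> up to \<open>n\<close> and is frozen
  afterwards.\<close>

lemma trunc_fun_Suc_eq:
  "trunc_fun f n (Suc x) = trunc_fun f n x + (f (Suc (min n x)) - f (min n x))"
proof (induction n)
  case (Suc n)
  show ?case
  proof (cases "x \<ge> Suc n")
    case True
    then show ?thesis using Suc by (simp add: min_def algebra_simps)
  next
    case False
    then have "min n x = x" "min (Suc n) x = x" by auto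
    with False Suc show ?thesis by (simp add: algebra_simps of_nat_diff)
  qed
qed (simp add: algebra_simps)

lemma trunc_fun_eq: "x \<le> Suc n \<Longrightarrow> trunc_fun f n x = f x"
proof (induction x)
  case 0
  then show ?case
    by (induction n) (auto simp: algebra_simps)
qed (auto simp: trunc_fun_Suc_eq min_def)

text \<open>Slopes of a convex sequence increase, and a truncation freezes them. The bounds, an
  affine function and \<open>f\<close> itself, dominate all truncations at once.\<close>

lemma trunc_fun_bounds:
  assumes conv: "\<And>n. f (Suc n) - f n \<le> f (Suc (Suc n)) - f (Suc n)"
  shows "trunc_fun f 0 x \<le> trunc_fun f n x" "trunc_fun f n x \<le> f x"
proof -
  have mono: "m \<le> n \<Longrightarrow> f (Suc m) - f m \<le> f (Suc n) - f n" for m n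
    by (rule lift_Suc_mono_le[of "\<lambda>n. f (Suc n) - f n"]) (use conv in auto)
  show "trunc_fun f n x \<le> f x"
  proof (induction x)
    case (Suc x)
    then show ?case using mono[of "min n x" x] by (simp add: trunc_fun_Suc_eq)
  qed (simp add: trunc_fun_eq)
  show "trunc_fun f 0 x \<le> trunc_fun f n x"
  proof (induction x)
    case (Suc x)
    then show ?case using mono[of 0 "min n x"] by (simp add: trunc_fun_Suc_eq del: trunc_fun.simps)
  qed (simp add: trunc_fun_eq del: trunc_fun.simps)
qed

lemma put_expectation: "put p k = ennreal (measure_pmf.expectation p (\<lambda>x. real (k - x)))"
  and put_integrable: "integrable (measure_pmf p) (\<lambda>x. real (k - x))"
proof -
  show int: "integrable (measure_pmf p) (\<lambda>x. real (k - x))"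
    by (intro measure_pmf.integrable_const_bound[where B = "real k"]) auto
  show "put p k = ennreal (measure_pmf.expectation p (\<lambda>x. real (k - x)))"
    by (subst nn_integral_eq_integral[symmetric])
      (use int in \<open>auto simp: put_def ennreal_of_nat_eq_real_of_nat simp del: of_nat_diff\<close>)
qed

text \<open>Equal means make affine functions agree in expectation. Each further corner of a
  truncation adds a nonnegative second difference times a call, whose expectation differs from that
  of the put with the same strike by a term that depends on the mean only. Dominated convergence
  removes the truncation.\<close>

lemma put_le_imp_convex_le:
  fixes f :: "real \<Rightarrow> real"
  assumes le: "put_le p q"
    and int: "integrable (measure_pmf p) real" "integrable (measure_pmf q) real"
    and mean: "measure_pmf.expectation p real = measure_pmf.expectation q real"
    and f: "convex_on UNIV f"
    and fint: "integrable (measure_pmf p) (\<lambda>x. f (real x))" "integrable (measure_pmf q) (\<lambda>x. f (real x))"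
  shows "measure_pmf.expectation p (\<lambda>x. f (real x)) \<le> measure_pmf.expectation q (\<lambda>x. f (real x))"
proof -
  define g where "g = (\<lambda>n. f (real n))"
  have conv: "g (Suc n) - g n \<le> g (Suc (Suc n)) - g (Suc n)" for n
  proof -
    have "f ((1 - 1/2) *\<^sub>R real n + (1/2) *\<^sub>R real (Suc (Suc n))) \<le>
        (1 - 1/2) * f (real n) + (1/2) * f (real (Suc (Suc n)))"
      using f by (intro convex_onD[of UNIV]) auto
    moreover have "(1 - 1/2) *\<^sub>R real n + (1/2) *\<^sub>R real (Suc (Suc n)) = real (Suc n)"
      by (simp add: field_simps)
    ultimately show ?thesis unfolding g_def by (simp del: of_nat_Suc)
  qed
  have tint: "integrable (measure_pmf r) (trunc_fun g n)" if "integrable (measure_pmf r) real" for r n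
  proof (induction n)
    case (Suc n)
    then show ?case using that put_integrable[of r "Suc n"]
      by (simp del: of_nat_diff)
  qed (use that in simp)
  have tle: "measure_pmf.expectation p (trunc_fun g n) \<le> measure_pmf.expectation q (trunc_fun g n)" for n
  proof (induction n)
    case 0
    then show ?case using int mean by simp
  next
    case (Suc n)
    have "measure_pmf.expectation p (\<lambda>x. real (Suc n - x)) \<le> measure_pmf.expectation q (\<lambda>x. real (Suc n - x))"
    proof -
      have "0 \<le> measure_pmf.expectation q (\<lambda>x. real (Suc n - x))"
        by (intro integral_nonneg_AE AE_I2 of_nat_0_le_iff)
      then show ?thesis
        using le unfolding put_le_def put_expectation by (metis ennreal_le_iff)
    qed
    moreover have "measure_pmf.expectation r (trunc_fun g (Suc n)) = measure_pmf.expectation r (trunc_fun g n) +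
        (g (n + 2) - 2 * g (n + 1) + g n) * (measure_pmf.expectation r real - real (Suc n) +
          measure_pmf.expectation r (\<lambda>x. real (Suc n - x)))"
      if "integrable (measure_pmf r) real" for r
    proof -
      have "trunc_fun g (Suc n) = (\<lambda>x. trunc_fun g n x +
          (g (n + 2) - 2 * g (n + 1) + g n) * (real x - real (Suc n) + real (Suc n - x)))"
        by (rule ext) simp
      then show ?thesis
        using that tint[OF that, of n] put_integrable[of r "Suc n"]
        by (simp del: of_nat_diff of_nat_Suc trunc_fun.simps)
    qed
    moreover have "0 \<le> g (n + 2) - 2 * g (n + 1) + g n"
      using conv[of n] by simp
    ultimately show ?case
      using Suc int mean by (auto intro!: add_mono mult_left_mono simp del: trunc_fun.simps)
  qed
  have tlim: "(\<lambda>n. measure_pmf.expectation r (trunc_fun g n)) \<longlonglongrightarrow> measure_pmf.expectation r g"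
    if r: "integrable (measure_pmf r) real" and gint: "integrable (measure_pmf r) g" for r
  proof (rule integral_dominated_convergence)
    show "integrable (measure_pmf r) (\<lambda>x. \<bar>g x\<bar> + \<bar>trunc_fun g 0 x\<bar>)"
      using tint[OF r, of 0] gint by (intro Bochner_Integration.integrable_add integrable_abs)
    show "AE x in measure_pmf r. (\<lambda>n. trunc_fun g n x) \<longlonglongrightarrow> g x"
    proof (rule AE_I2)
      fix x
      have "eventually (\<lambda>n. trunc_fun g n x = g x) sequentially"
        using eventually_ge_at_top[of x] by eventually_elim (simp add: trunc_fun_eq)
      then show "(\<lambda>n. trunc_fun g n x) \<longlonglongrightarrow> g x" by (rule tendsto_eventually)
    qed
    show "AE x in measure_pmf r. norm (trunc_fun g n x) \<le> \<bar>g x\<bar> + \<bar>trunc_fun g 0 x\<bar>" for n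
    proof (rule AE_I2)
      fix x
      show "norm (trunc_fun g n x) \<le> \<bar>g x\<bar> + \<bar>trunc_fun g 0 x\<bar>"
        using trunc_fun_bounds[where f = g and x = x and n = n, OF conv] by (simp del: trunc_fun.simps)
    qed
  qed auto
  show ?thesis
    using LIMSEQ_le[OF tlim[OF int(1)] tlim[OF int(2)]] tle fint by (auto simp: g_def)
qed

section \<open>Factorial moments of simple point processes\<close>

definition separating :: "(nat \<Rightarrow> 'a::euclidean_space set) \<Rightarrow> bool" where
  "separating U \<longleftrightarrow> (\<forall>n. U n \<in> sets borel) \<and> (\<forall>x y. x \<noteq> y \<longrightarrow> (\<exists>n. x \<in> U n \<and> y \<notin> U n))"

text \<open>A countable base works: the open set \<open>- {y}\<close> is a union of base sets, and
  one of them contains \<open>x\<close>.\<close>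

lemma ex_separating: "\<exists>U :: nat \<Rightarrow> 'a::euclidean_space set. separating U"
proof -
  obtain U :: "nat \<Rightarrow> 'a set" where U: "\<And>n. open (U n)" "\<And>S. open S \<Longrightarrow> \<exists>k. S = \<Union>{U n |n. n \<in> k}"
    by (rule univ_second_countable_sequence[where 'a = 'a]) blast
  have "\<exists>n. x \<in> U n \<and> y \<notin> U n" if "x \<noteq> y" for x y
  proof -
    obtain k where k: "- {y} = \<Union>{U n |n. n \<in> k}"
      using exE[OF U(2)[OF open_Compl[OF closed_singleton[of y]]]] .
    have "x \<in> \<Union>{U n |n. n \<in> k}" unfolding k[symmetric] using that by simp
    then obtain n where n: "n \<in> k" "x \<in> U n" by auto
    have "U n \<subseteq> - {y}" unfolding k using n(1) by auto
    with n have "x \<in> U n \<and> y \<notin> U n" by auto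
    then show ?thesis by (rule exI)
  qed
  then show ?thesis using U(1) by (intro exI[of _ U]) (auto simp: separating_def)
qed

primrec shrink :: "'a measure \<Rightarrow> (nat \<Rightarrow> 'a set) \<Rightarrow> 'a set \<Rightarrow> nat \<Rightarrow> 'a set" where
  "shrink N U D 0 = D"
| "shrink N U D (Suc n) = (if emeasure N (shrink N U D n \<inter> U n) > 0
     then shrink N U D n \<inter> U n else shrink N U D n - U n)"

text \<open>The set \<open>D\<close> is split again and again by a separating sequence, always
  keeping a part of positive mass. Masses are integers, so they stay at least 1; the intersection
  has mass at least 1 by continuity from above and is a single point since the sequence separates
  points.\<close>

lemma counting_measure_atom:
  fixes N :: "'a::euclidean_space measure"
  assumes sets: "sets N = sets borel" and D: "D \<in> sets borel"
    and cnt: "\<And>B. B \<in> sets borel \<Longrightarrow> B \<subseteq> D \<Longrightarrow> \<exists>m::nat. emeasure N B = of_nat m"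
    and pos: "emeasure N D > 0"
  shows "\<exists>x\<in>D. emeasure N {x} \<ge> 1"
proof -
  obtain U :: "nat \<Rightarrow> 'a set" where U: "separating U" using ex_separating by blast
  have Um: "U n \<in> sets borel" for n using U by (simp add: separating_def)
  define A where "A = shrink N U D"
  have Am: "A n \<in> sets borel \<and> A n \<subseteq> D" for n
    unfolding A_def using D Um by (induction n) auto
  have Apos: "emeasure N (A n) > 0" for n
  proof (induction n)
    case (Suc n)
    show ?case
    proof (cases "emeasure N (A n \<inter> U n) > 0")
      case False
      then have "emeasure N (A n \<inter> U n) = 0" by simp
      moreover have "emeasure N (A n) = emeasure N (A n \<inter> U n) + emeasure N (A n - U n)"
        using Am Um sets by (subst plus_emeasure) (auto simp: Int_Diff_Un)
      ultimately show ?thesis using Suc False by (simp add: A_def)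
    qed (simp add: A_def)
  qed (simp add: A_def pos)
  have A1: "emeasure N (A n) \<ge> 1" for n
  proof -
    obtain m :: nat where "emeasure N (A n) = of_nat m" using cnt Am by blast
    then show ?thesis using Apos[of n] by (cases m) auto
  qed
  have "decseq A"
    unfolding A_def by (rule decseq_SucI) auto
  moreover have "emeasure N (A i) \<noteq> \<infinity>" for i
    using cnt[of "A i"] Am[of i] by auto
  ultimately have "(INF n. emeasure N (A n)) = emeasure N (\<Inter>n. A n)"
    using Am sets by (intro INF_emeasure_decseq) auto
  moreover have "(INF n. emeasure N (A n)) \<ge> 1"
    by (intro INF_greatest A1)
  ultimately have ge: "emeasure N (\<Inter>n. A n) \<ge> 1" by simp
  then have "(\<Inter>n. A n) \<noteq> {}" by (metis emeasure_empty not_one_le_zero)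
  then obtain x where x: "x \<in> (\<Inter>n. A n)" by blast
  have "y = x" if y: "y \<in> (\<Inter>n. A n)" for y
  proof (rule ccontr)
    assume "y \<noteq> x"
    then obtain n where n: "x \<in> U n" "y \<notin> U n" using U by (metis separating_def)
    have "x \<in> A (Suc n)" "y \<in> A (Suc n)" using x y by blast+
    then show False using n by (auto simp: A_def split: if_splits)
  qed
  with x have "(\<Inter>n. A n) = {x}" by blast
  moreover have "x \<in> D" using x Am by blast
  ultimately show ?thesis using ge by (intro bexI[of _ x]) simp_all
qed

text \<open>Induction on the mass: an atom has mass exactly 1 by simplicity, and removing it lowers
  the mass by one. Products of masses thereby become numbers of tuples of points.\<close>

lemma simple_counting_measure_card:
  fixes N :: "'a::euclidean_space measure"
  assumes sets: "sets N = sets borel" and simple: "\<And>x. emeasure N {x} \<le> 1"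
    and "D \<in> sets borel" and "emeasure N D = of_nat n"
    and "\<And>B. B \<in> sets borel \<Longrightarrow> B \<subseteq> D \<Longrightarrow> \<exists>m::nat. emeasure N B = of_nat m"
  shows "\<exists>F. finite F \<and> F \<subseteq> D \<and> card F = n \<and>
    (\<forall>B\<in>sets borel. B \<subseteq> D \<longrightarrow> emeasure N B = of_nat (card (F \<inter> B)))"
  using assms(3-)
proof (induction n arbitrary: D)
  case 0
  have "emeasure N B = 0" if "B \<in> sets borel" "B \<subseteq> D" for B
    using emeasure_mono[OF that(2), of N] 0 sets that by simp
  then show ?case by (intro exI[of _ "{}"]) auto
next
  case (Suc n)
  have "emeasure N D > 0" using Suc.prems(2) by (simp add: zero_less_iff_neq_zero del: of_nat_Suc)
  then obtain x where x: "x \<in> D" "emeasure N {x} \<ge> 1"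
    using counting_measure_atom[OF sets Suc.prems(1) Suc.prems(3)] by blast
  then have x1: "emeasure N {x} = 1" using simple[of x] by simp
  have split: "emeasure N B = emeasure N (B - {x}) + (if x \<in> B then 1 else 0)" if "B \<in> sets borel" for B
  proof (cases "x \<in> B")
    case True
    then have "emeasure N B = emeasure N (B - {x}) + emeasure N {x}"
      using that sets by (subst plus_emeasure) (auto simp: insert_absorb)
    then show ?thesis using True x1 by simp
  qed simp
  have "emeasure N (D - {x}) = of_nat n"
  proof -
    obtain m :: nat where m: "emeasure N (D - {x}) = of_nat m"
      using Suc.prems(3)[of "D - {x}"] Suc.prems(1) by auto
    have "(of_nat (Suc n) :: ennreal) = of_nat (Suc m)"
      using split[OF Suc.prems(1)] Suc.prems(2) x(1) m by simp
    then have "n = m" by (simp del: of_nat_Suc)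
    then show ?thesis using m by simp
  qed
  then have ex: "\<exists>F. finite F \<and> F \<subseteq> D - {x} \<and> card F = n \<and>
      (\<forall>B\<in>sets borel. B \<subseteq> D - {x} \<longrightarrow> emeasure N B = of_nat (card (F \<inter> B)))"
  proof (intro Suc.IH)
    show "D - {x} \<in> sets borel" using Suc.prems(1) by simp
    show "\<exists>m::nat. emeasure N B = of_nat m" if "B \<in> sets borel" "B \<subseteq> D - {x}" for B
      using Suc.prems(3)[of B] that by blast
  qed
  obtain F where F: "finite F" "F \<subseteq> D - {x}" "card F = n"
    "\<And>B. B \<in> sets borel \<Longrightarrow> B \<subseteq> D - {x} \<Longrightarrow> emeasure N B = of_nat (card (F \<inter> B))"
    using ex by blast
  have "emeasure N B = of_nat (card (insert x F \<inter> B))" if B: "B \<in> sets borel" "B \<subseteq> D" for B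
  proof -
    have "emeasure N (B - {x}) = of_nat (card (F \<inter> (B - {x})))"
      using B by (intro F(4)) auto
    moreover have "F \<inter> (B - {x}) = F \<inter> B" "x \<notin> F" using F(2) by auto
    ultimately show ?thesis using split[OF B(1)] F(1) by (auto simp: Int_insert_left)
  qed
  then show ?case
    using F x by (intro exI[of _ "insert x F"]) (auto simp: card_insert_if)
qed

section \<open>Tuples of distinct points through partitions into cells\<close>

definition code :: "(nat \<Rightarrow> 'a set) \<Rightarrow> nat \<Rightarrow> 'a \<Rightarrow> nat set" where
  "code U n x = {i. i < n \<and> x \<in> U i}"

definition cell :: "(nat \<Rightarrow> 'a set) \<Rightarrow> 'a set \<Rightarrow> nat \<Rightarrow> nat set \<Rightarrow> 'a set" where
  "cell U D n c = {x \<in> D. code U n x = c}"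

definition cell_codes :: "nat \<Rightarrow> nat \<Rightarrow> (nat \<Rightarrow> nat set) set" where
  "cell_codes n k = {c \<in> {..<k} \<rightarrow>\<^sub>E Pow {..<n}. inj_on c {..<k}}"

lemma finite_cell_codes: "finite (cell_codes n k)"
  unfolding cell_codes_def by (rule finite_subset[of _ "{..<k} \<rightarrow>\<^sub>E Pow {..<n}"]) (auto intro!: finite_PiE)

lemma cell_borel:
  fixes U :: "nat \<Rightarrow> 'a::euclidean_space set"
  assumes "separating U" "D \<in> sets borel"
  shows "cell U D n c \<in> sets borel"
proof (cases "c \<subseteq> {..<n}")
  case True
  then have "cell U D n c = D \<inter> (\<Inter>i\<in>{..<n}. if i \<in> c then U i else - U i)"
    by (auto simp: cell_def code_def split: if_splits)
  moreover have "(\<Inter>i\<in>{..<n}. if i \<in> c then U i else - U i) \<in> sets borel"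
  proof (cases "n = 0")
    case False
    have "(if i \<in> c then U i else - U i) \<in> sets borel" for i
      using assms by (auto simp: separating_def borel_comp)
    then show ?thesis using False by (intro sets.finite_INT) auto
  qed simp
  ultimately show ?thesis using assms by auto
next
  case False
  then have "cell U D n c = {}" by (auto simp: cell_def code_def)
  then show ?thesis by simp
qed

definition sep_ind :: "(nat \<Rightarrow> 'a set) \<Rightarrow> 'a set \<Rightarrow> nat \<Rightarrow> nat \<Rightarrow> (nat \<Rightarrow> 'a) \<Rightarrow> ennreal" where
  "sep_ind U D k n x = (\<Sum>c\<in>cell_codes n k. indicator (PiE {..<k} (\<lambda>i. cell U D n (c i))) x)"

text \<open>A tuple in \<open>D\<close> lies in exactly one product of cells, the one given by its
  own codes, and this product occurs in the sum iff the codes are distinct.\<close>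

lemma sep_ind_eq:
  "sep_ind U D k n x = indicator {x \<in> {..<k} \<rightarrow>\<^sub>E D. inj_on (\<lambda>i. code U n (x i)) {..<k}} x"
proof -
  let ?c = "restrict (\<lambda>i. code U n (x i)) {..<k}"
  have eq: "x \<in> PiE {..<k} (\<lambda>i. cell U D n (c i)) \<longleftrightarrow> x \<in> {..<k} \<rightarrow>\<^sub>E D \<and> c = ?c"
    if "c \<in> cell_codes n k" for c
  proof -
    have "c \<in> extensional {..<k}" using that by (auto simp: cell_codes_def PiE_def)
    then have "c = ?c \<longleftrightarrow> (\<forall>i<k. code U n (x i) = c i)"
      by (auto simp: restrict_def fun_eq_iff extensional_def)
    then show ?thesis
      by (auto simp: PiE_iff cell_def)
  qed
  show ?thesis
  proof (cases "x \<in> {..<k} \<rightarrow>\<^sub>E D \<and> inj_on (\<lambda>i. code U n (x i)) {..<k}")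
    case True
    then have "?c \<in> cell_codes n k" by (auto simp: cell_codes_def code_def)
    then have "sep_ind U D k n x = (\<Sum>c\<in>{?c}. indicator (PiE {..<k} (\<lambda>i. cell U D n (c i))) x)"
      unfolding sep_ind_def using eq
      by (intro sum.mono_neutral_right finite_cell_codes) (auto simp: indicator_def)
    then show ?thesis using True eq[OF \<open>?c \<in> cell_codes n k\<close>] by simp
  next
    case False
    have "x \<notin> PiE {..<k} (\<lambda>i. cell U D n (c i))" if c: "c \<in> cell_codes n k" for c
    proof
      assume "x \<in> PiE {..<k} (\<lambda>i. cell U D n (c i))"
      then have "x \<in> {..<k} \<rightarrow>\<^sub>E D" "c = ?c" using eq[OF c] by auto
      moreover have "inj_on c {..<k}" using c by (simp add: cell_codes_def)
      ultimately show False using False by (metis inj_on_restrict_eq)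
    qed
    then have "sep_ind U D k n x = 0" by (simp add: sep_ind_def)
    with False show ?thesis by auto
  qed
qed

lemma sep_ind_mono: "sep_ind U D k n x \<le> sep_ind U D k (Suc n) x"
proof -
  have "code U n y = code U (Suc n) y \<inter> {..<n}" for y by (auto simp: code_def)
  then have "inj_on (\<lambda>i. code U n (x i)) {..<k} \<Longrightarrow> inj_on (\<lambda>i. code U (Suc n) (x i)) {..<k}"
    by (auto simp: inj_on_def)
  then show ?thesis
    unfolding sep_ind_eq by (auto simp: indicator_def)
qed

text \<open>Finitely many distinct points are separated at a finite stage, while equal coordinates
  never receive different codes. With \<open>sep_ind_mono\<close> the off-diagonal indicator is thus
  a monotone limit of sums over products of disjoint cells.\<close>

lemma sep_ind_tendsto:
  fixes D :: "'a::euclidean_space set"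
  assumes "separating U"
  shows "(\<lambda>n. sep_ind U D k n x) \<longlonglongrightarrow> indicator {x \<in> {..<k} \<rightarrow>\<^sub>E D. inj_on x {..<k}} x"
proof (cases "inj_on x {..<k}")
  case True
  have "\<exists>n. x i \<noteq> x j \<longrightarrow> x i \<in> U n \<and> x j \<notin> U n" for i j
    using assms by (auto simp: separating_def)
  then obtain m where m: "\<And>i j. x i \<noteq> x j \<Longrightarrow> x i \<in> U (m i j) \<and> x j \<notin> U (m i j)"
    by metis
  \<comment> \<open>A crude number above all the indices \<open>m i j\<close>.\<close>
  define N where "N = (\<Sum>i<k. \<Sum>j<k. Suc (m i j))"
  have mN: "m i j < N" if "i < k" "j < k" for i j
  proof -
    have "Suc (m i j) \<le> (\<Sum>j<k. Suc (m i j))" using that by (intro member_le_sum) auto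
    also have "\<dots> \<le> N" unfolding N_def using that by (intro member_le_sum[of i "{..<k}"]) auto
    finally show ?thesis by simp
  qed
  have "inj_on (\<lambda>i. code U n (x i)) {..<k}" if "n \<ge> N" for n
  proof (rule inj_onI, rule ccontr)
    fix i j assume *: "i \<in> {..<k}" "j \<in> {..<k}" "code U n (x i) = code U n (x j)" "i \<noteq> j"
    then have "x i \<noteq> x j" using inj_on_eq_iff[OF True] by simp
    then have "x i \<in> U (m i j)" "x j \<notin> U (m i j)" by (simp_all add: m)
    moreover have "m i j < n" using mN[of i j] *(1,2) that by simp
    ultimately have "m i j \<in> code U n (x i)" "m i j \<notin> code U n (x j)"
      by (simp_all add: code_def)
    with *(3) show False by simp
  qed
  then have "sep_ind U D k n x = indicator {x \<in> {..<k} \<rightarrow>\<^sub>E D. inj_on x {..<k}} x" if "n \<ge> N" for n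
    using True that unfolding sep_ind_eq by (simp add: indicator_def)
  then have "eventually (\<lambda>n. sep_ind U D k n x = indicator {x \<in> {..<k} \<rightarrow>\<^sub>E D. inj_on x {..<k}} x) sequentially"
    by (rule eventually_sequentiallyI)
  then show ?thesis by (rule tendsto_eventually)
next
  case False
  then have "\<not> inj_on (\<lambda>i. code U n (x i)) {..<k}" for n
    using inj_on_imageI2[of "code U n" x "{..<k}"] by (auto simp: comp_def)
  then show ?thesis using False by (simp add: sep_ind_eq)
qed

lemma card_injections:
  assumes "finite F"
  shows "card {y \<in> {..<k::nat} \<rightarrow>\<^sub>E F. inj_on y {..<k}} = fact k * (card F choose k)"
proof -
  have "(\<Prod>i = 0..<k. n - i) = fact k * (n choose k)" for n :: nat
  proof (induction k)
    case (Suc k)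
    have "Suc k * (n choose Suc k) = (n choose k) * (n - k)"
      by (metis binomial_absorb_comp binomial_absorption mult.commute)
    then have "fact k * (n choose k) * (n - k) = fact k * (Suc k * (n choose Suc k))"
      by simp
    then show ?case using Suc by (simp add: algebra_simps)
  qed simp
  then show ?thesis
    using card_inj_on_subset_funcset[of "{..<k}" F "{..<k}"] assms by simp
qed

text \<open>The mass of a cell is a sum of indicators over the points of \<open>F\<close>, and a
  product of such sums runs over all tuples of these points.\<close>

lemma sum_prod_emeasure_cells:
  fixes N :: "'a::euclidean_space measure"
  assumes U: "separating U" and D: "D \<in> sets borel" and F: "finite F"
    and N: "\<And>B. B \<in> sets borel \<Longrightarrow> B \<subseteq> D \<Longrightarrow> emeasure N B = of_nat (card (F \<inter> B))"
  shows "(\<Sum>c\<in>cell_codes n k. \<Prod>i<k. emeasure N (cell U D n (c i))) = (\<Sum>y\<in>{..<k} \<rightarrow>\<^sub>E F. sep_ind U D k n y)"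
proof -
  have "(\<Prod>i<k. emeasure N (cell U D n (c i))) =
      (\<Sum>y\<in>{..<k} \<rightarrow>\<^sub>E F. indicator (PiE {..<k} (\<lambda>i. cell U D n (c i))) y)" for c
  proof -
    have "emeasure N (cell U D n (c i)) = (\<Sum>y\<in>F. indicator (cell U D n (c i)) y)" for i
    proof -
      have "cell U D n (c i) \<subseteq> D" by (auto simp: cell_def)
      then have "emeasure N (cell U D n (c i)) = of_nat (card (F \<inter> cell U D n (c i)))"
        by (intro N cell_borel[OF U D])
      also have "\<dots> = (\<Sum>y\<in>F. indicator (cell U D n (c i)) y)"
        using F by (simp add: indicator_def sum.If_cases)
      finally show ?thesis .
    qed
    then have "(\<Prod>i<k. emeasure N (cell U D n (c i))) =
        (\<Sum>y\<in>{..<k} \<rightarrow>\<^sub>E F. \<Prod>i<k. indicator (cell U D n (c i)) (y i))"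
      using F by (simp add: prod_sum_PiE)
    also have "\<dots> = (\<Sum>y\<in>{..<k} \<rightarrow>\<^sub>E F. indicator (PiE {..<k} (\<lambda>i. cell U D n (c i))) y)"
    proof (rule sum.cong[OF refl])
      fix y assume "y \<in> {..<k} \<rightarrow>\<^sub>E F"
      then have "y \<in> PiE {..<k} (\<lambda>i. cell U D n (c i)) \<longleftrightarrow> (\<forall>i<k. y i \<in> cell U D n (c i))"
        by (auto simp: PiE_iff)
      then show "(\<Prod>i<k. indicator (cell U D n (c i)) (y i)) =
          (indicator (PiE {..<k} (\<lambda>i. cell U D n (c i))) y :: ennreal)"
        by (auto simp: indicator_def prod_zero_iff)
    qed
    finally show ?thesis .
  qed
  then show ?thesis
    unfolding sep_ind_def by (simp only:) (rule sum.swap)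
qed

text \<open>On bounded Borel sets the measure is a natural number and the floor loses nothing; an
  infinite mass would give 0.\<close>

definition npoints :: "('w \<Rightarrow> 'a::euclidean_space measure) \<Rightarrow> 'a set \<Rightarrow> 'w \<Rightarrow> nat" where
  "npoints \<Phi> D \<omega> = nat \<lfloor>measure (\<Phi> \<omega>) D\<rfloor>"

lemma npoints_eq:
  assumes "point_process M \<Phi>" "\<omega> \<in> space M" "D \<in> sets borel" "bounded D"
  shows "emeasure (\<Phi> \<omega>) D = of_nat (npoints \<Phi> D \<omega>)" "measure (\<Phi> \<omega>) D = real (npoints \<Phi> D \<omega>)"
proof -
  have "counting_measure (\<Phi> \<omega>)" using assms(1,2) by (simp add: point_process_def)
  then obtain n :: nat where n: "emeasure (\<Phi> \<omega>) D = of_nat n"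
    using assms(3,4) unfolding counting_measure_def by blast
  then have "measure (\<Phi> \<omega>) D = real n" by (simp add: measure_def)
  then show "emeasure (\<Phi> \<omega>) D = of_nat (npoints \<Phi> D \<omega>)" "measure (\<Phi> \<omega>) D = real (npoints \<Phi> D \<omega>)"
    using n by (simp_all add: npoints_def)
qed

lemma npoints_measurable:
  assumes "point_process M \<Phi>" "D \<in> sets borel"
  shows "npoints \<Phi> D \<in> measurable M (count_space UNIV)"
proof -
  have "(\<lambda>\<omega>. emeasure (\<Phi> \<omega>) D) \<in> borel_measurable M"
    using assms by (auto simp: point_process_def)
  then have "(\<lambda>\<omega>. nat \<lfloor>enn2real (emeasure (\<Phi> \<omega>) D)\<rfloor>) \<in> measurable M (count_space UNIV)"
    by measurable
  then show ?thesis by (simp add: npoints_def[abs_def] measure_def)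
qed

lemma SUP_eq_of_tendsto:
  fixes f :: "nat \<Rightarrow> ennreal"
  assumes "f \<longlonglongrightarrow> l" "\<And>n. f n \<le> f (Suc n)"
  shows "(SUP n. f n) = l"
  using LIMSEQ_SUP[of f] assms by (intro LIMSEQ_unique[of f]) (auto intro: incseq_SucI)

text \<open>Distinct cells are disjoint, so the joint intensity applies to each tuple of them.
  Summed over these tuples, the products of counts increase to the number of ordered
  \<open>k\<close>-tuples of distinct points, a falling factorial of the count, and the integrals
  increase to the integral off the diagonals.\<close>

lemma factorial_moment_eq:
  fixes \<Phi> :: "'w \<Rightarrow> 'a::euclidean_space measure"
  assumes simple: "simple_point_process M \<Phi>" and ji: "joint_intensity M \<Phi> \<mu> k \<rho>"
    and \<mu>: "sets \<mu> = sets borel" and D: "D \<in> sets borel" "bounded D"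
  shows "(\<integral>\<^sup>+\<omega>. of_nat (fact k * (npoints \<Phi> D \<omega> choose k)) \<partial>M) =
    (\<integral>\<^sup>+x\<in>{..<k} \<rightarrow>\<^sub>E D. ennreal (\<rho> x) \<partial>(\<Pi>\<^sub>M i\<in>{..<k}. \<mu>))"
proof -
  let ?P = "\<Pi>\<^sub>M i\<in>{..<k}. \<mu>"
  have pp: "point_process M \<Phi>" using simple by (simp add: simple_point_process_def)
  have em: "(\<lambda>\<omega>. emeasure (\<Phi> \<omega>) B) \<in> borel_measurable M" if "B \<in> sets borel" for B
    using pp that by (simp add: point_process_def)
  have jiD: "(\<integral>\<^sup>+\<omega>. (\<Prod>i<k. emeasure (\<Phi> \<omega>) (B i)) \<partial>M) =
      (\<integral>\<^sup>+x\<in>PiE {..<k} B. ennreal (\<rho> x) \<partial>?P)"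
    if "\<And>i. B i \<in> sets borel" "\<And>i. bounded (B i)" "disjoint_family_on B {..<k}" for B
    using ji that by (simp add: joint_intensity_def)
  have \<rho>[measurable]: "\<rho> \<in> borel_measurable ?P" using ji by (simp add: joint_intensity_def)
  obtain U :: "nat \<Rightarrow> 'a set" where U: "separating U" using ex_separating by (rule exE)
  note cb = cell_borel[OF U D(1)]
  have PiE_meas: "PiE {..<k} B \<in> sets ?P" if "\<And>i. B i \<in> sets borel" for B :: "nat \<Rightarrow> 'a set"
    using that \<mu> by (intro sets_PiM_I_finite) auto
  define f where "f n \<omega> = (\<Sum>c\<in>cell_codes n k. \<Prod>i<k. emeasure (\<Phi> \<omega>) (cell U D n (c i)))" for n \<omega>
  define h where "h n x = ennreal (\<rho> x) * sep_ind U D k n x" for n x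
  have f_meas: "f n \<in> borel_measurable M" for n
    unfolding f_def[abs_def] by (intro borel_measurable_sum borel_measurable_prod_ennreal em cb)
  have ind_meas: "indicator (PiE {..<k} (\<lambda>i. cell U D n (c i))) \<in> borel_measurable ?P" for n c
    by (intro borel_measurable_indicator PiE_meas cb)
  have h_meas: "h n \<in> borel_measurable ?P" for n
    unfolding h_def[abs_def] sep_ind_def[abs_def]
    by (intro borel_measurable_times_ennreal borel_measurable_sum ind_meas measurable_compose[OF \<rho> measurable_ennreal])
  have fh: "(\<integral>\<^sup>+\<omega>. f n \<omega> \<partial>M) = (\<integral>\<^sup>+x. h n x \<partial>?P)" for n
  proof -
    have "(\<integral>\<^sup>+\<omega>. f n \<omega> \<partial>M) = (\<Sum>c\<in>cell_codes n k. \<integral>\<^sup>+\<omega>. (\<Prod>i<k. emeasure (\<Phi> \<omega>) (cell U D n (c i))) \<partial>M)"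
      unfolding f_def by (intro nn_integral_sum borel_measurable_prod_ennreal em cb)
    also have "\<dots> = (\<Sum>c\<in>cell_codes n k. \<integral>\<^sup>+x\<in>PiE {..<k} (\<lambda>i. cell U D n (c i)). ennreal (\<rho> x) \<partial>?P)"
    proof (rule sum.cong[OF refl])
      fix c assume c: "c \<in> cell_codes n k"
      have "bounded (cell U D n (c i))" for i
        by (rule bounded_subset[OF D(2)]) (auto simp: cell_def)
      moreover have "disjoint_family_on (\<lambda>i. cell U D n (c i)) {..<k}"
        using c by (auto simp: cell_codes_def disjoint_family_on_def cell_def inj_on_def)
      ultimately show "(\<integral>\<^sup>+\<omega>. (\<Prod>i<k. emeasure (\<Phi> \<omega>) (cell U D n (c i))) \<partial>M) =
          (\<integral>\<^sup>+x\<in>PiE {..<k} (\<lambda>i. cell U D n (c i)). ennreal (\<rho> x) \<partial>?P)"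
        by (intro jiD cb)
    qed
    also have "\<dots> = (\<integral>\<^sup>+x. (\<Sum>c\<in>cell_codes n k. ennreal (\<rho> x) * indicator (PiE {..<k} (\<lambda>i. cell U D n (c i))) x) \<partial>?P)"
      by (intro nn_integral_sum[symmetric] borel_measurable_times_ennreal ind_meas measurable_compose[OF \<rho> measurable_ennreal])
    also have "\<dots> = (\<integral>\<^sup>+x. h n x \<partial>?P)"
      by (simp add: h_def sep_ind_def sum_distrib_left)
    finally show ?thesis .
  qed
  have f_conv: "AE \<omega> in M. (\<forall>n. f n \<omega> \<le> f (Suc n) \<omega>) \<and>
      (\<lambda>n. f n \<omega>) \<longlonglongrightarrow> of_nat (fact k * (npoints \<Phi> D \<omega> choose k))"
  proof -
    have "AE \<omega> in M. \<forall>x. emeasure (\<Phi> \<omega>) {x} \<le> 1"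
      using simple by (simp add: simple_point_process_def)
    then show ?thesis
    proof (rule AE_mp, intro AE_I2 impI)
      fix \<omega> assume \<omega>: "\<omega> \<in> space M" and 1: "\<forall>x. emeasure (\<Phi> \<omega>) {x} \<le> 1"
      have cm: "counting_measure (\<Phi> \<omega>)" using pp \<omega> by (simp add: point_process_def)
      have "\<exists>F. finite F \<and> F \<subseteq> D \<and> card F = npoints \<Phi> D \<omega> \<and>
          (\<forall>B\<in>sets borel. B \<subseteq> D \<longrightarrow> emeasure (\<Phi> \<omega>) B = of_nat (card (F \<inter> B)))"
      proof (rule simple_counting_measure_card)
        show "sets (\<Phi> \<omega>) = sets borel" using cm by (simp add: counting_measure_def)
        show "emeasure (\<Phi> \<omega>) D = of_nat (npoints \<Phi> D \<omega>)" using npoints_eq(1)[OF pp \<omega> D] .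
        show "\<exists>m::nat. emeasure (\<Phi> \<omega>) B = of_nat m" if "B \<in> sets borel" "B \<subseteq> D" for B
          using cm that bounded_subset[OF D(2) that(2)] by (simp add: counting_measure_def)
      qed (use 1 D in auto)
      then obtain F where F: "finite F" "F \<subseteq> D" "card F = npoints \<Phi> D \<omega>"
        "\<And>B. B \<in> sets borel \<Longrightarrow> B \<subseteq> D \<Longrightarrow> emeasure (\<Phi> \<omega>) B = of_nat (card (F \<inter> B))" by auto
      have fe: "f n \<omega> = (\<Sum>y\<in>{..<k} \<rightarrow>\<^sub>E F. sep_ind U D k n y)" for n
        unfolding f_def by (intro sum_prod_emeasure_cells U D F)
      have fin: "finite ({..<k} \<rightarrow>\<^sub>E F)" using F(1) by (intro finite_PiE) auto
      have "(\<lambda>n. f n \<omega>) \<longlonglongrightarrow> (\<Sum>y\<in>{..<k} \<rightarrow>\<^sub>E F. indicator {x \<in> {..<k} \<rightarrow>\<^sub>E D. inj_on x {..<k}} y)"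
        unfolding fe by (intro tendsto_sum sep_ind_tendsto U)
      also have "(\<Sum>y\<in>{..<k} \<rightarrow>\<^sub>E F. indicator {x \<in> {..<k} \<rightarrow>\<^sub>E D. inj_on x {..<k}} y :: ennreal) =
          of_nat (card (({..<k} \<rightarrow>\<^sub>E F) \<inter> {x \<in> {..<k} \<rightarrow>\<^sub>E D. inj_on x {..<k}}))"
        using fin by (simp add: indicator_def sum.If_cases)
      also have "({..<k} \<rightarrow>\<^sub>E F) \<inter> {x \<in> {..<k} \<rightarrow>\<^sub>E D. inj_on x {..<k}} = {x \<in> {..<k} \<rightarrow>\<^sub>E F. inj_on x {..<k}}"
        using F(2) PiE_mono[of "{..<k}" "\<lambda>_. F" "\<lambda>_. D"] by auto
      also have "card {x \<in> {..<k} \<rightarrow>\<^sub>E F. inj_on x {..<k}} = fact k * (npoints \<Phi> D \<omega> choose k)"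
        using card_injections[OF F(1), of k] F(3) by simp
      finally show "(\<forall>n. f n \<omega> \<le> f (Suc n) \<omega>) \<and>
          (\<lambda>n. f n \<omega>) \<longlonglongrightarrow> of_nat (fact k * (npoints \<Phi> D \<omega> choose k))"
        by (simp add: fe sum_mono sep_ind_mono)
    qed
  qed
  have h_conv: "AE x in ?P. (SUP n. h n x) = ennreal (\<rho> x) * indicator ({..<k} \<rightarrow>\<^sub>E D) x"
  proof -
    \<comment> \<open>On the diagonals the limit of \<open>h\<close> is 0; it agrees with the full
      integrand because the intensity vanishes there almost everywhere.\<close>
    have "AE x in ?P. (\<exists>i<k. \<exists>j<k. i \<noteq> j \<and> x i = x j) \<longrightarrow> \<rho> x = 0"
      using ji by (simp add: joint_intensity_def)
    then show ?thesis
    proof eventually_elim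
      case (elim x)
      have "(\<lambda>n. h n x) \<longlonglongrightarrow> ennreal (\<rho> x) * indicator {x \<in> {..<k} \<rightarrow>\<^sub>E D. inj_on x {..<k}} x"
        unfolding h_def by (intro ennreal_tendsto_cmult sep_ind_tendsto U) auto
      moreover have "h n x \<le> h (Suc n) x" for n
        unfolding h_def by (intro mult_left_mono sep_ind_mono) auto
      ultimately have "(SUP n. h n x) = ennreal (\<rho> x) * indicator {x \<in> {..<k} \<rightarrow>\<^sub>E D. inj_on x {..<k}} x"
        by (rule SUP_eq_of_tendsto)
      also have "\<dots> = ennreal (\<rho> x) * indicator ({..<k} \<rightarrow>\<^sub>E D) x"
      proof (cases "inj_on x {..<k}")
        case False
        then have "\<rho> x = 0" using elim by (auto simp: inj_on_def)
        then show ?thesis by simp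
      qed (simp add: indicator_def)
      finally show ?case .
    qed
  qed
  have "(\<integral>\<^sup>+\<omega>. of_nat (fact k * (npoints \<Phi> D \<omega> choose k)) \<partial>M) = (\<integral>\<^sup>+\<omega>. (SUP n. f n \<omega>) \<partial>M)"
    using f_conv by (intro nn_integral_cong_AE) (elim AE_mp, auto intro!: AE_I2 SUP_eq_of_tendsto[symmetric])
  also have "\<dots> = (SUP n. \<integral>\<^sup>+\<omega>. f n \<omega> \<partial>M)"
    by (rule nn_integral_monotone_convergence_SUP_AE[OF _ f_meas]) (use f_conv in eventually_elim, blast)
  also have "\<dots> = (SUP n. \<integral>\<^sup>+x. h n x \<partial>?P)"
    by (simp add: fh)
  also have "\<dots> = (\<integral>\<^sup>+x. (SUP n. h n x) \<partial>?P)"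
    by (rule nn_integral_monotone_convergence_SUP_AE[symmetric, OF _ h_meas])
      (auto simp: h_def intro!: mult_left_mono sep_ind_mono)
  also have "\<dots> = (\<integral>\<^sup>+x\<in>{..<k} \<rightarrow>\<^sub>E D. ennreal (\<rho> x) \<partial>?P)"
    using h_conv by (intro nn_integral_cong_AE)
  finally show ?thesis .
qed

section \<open>Symmetric functions of the eigenvalues\<close>

text \<open>The coefficients of \<open>1 + t\<close> and of \<open>1 / (1 - t)\<close>. By
  \<open>sum_wsign\<close> this is also the mean of \<open>wsign b\<close> over the permutations of
  a set with \<open>k\<close> elements.\<close>

definition sym_coeff :: "bool \<Rightarrow> nat \<Rightarrow> real" where
  "sym_coeff b k = (if b \<and> 1 < k then 0 else 1)"

text \<open>Multiplication of \<open>\<Sum>\<^sub>k sym_fun b l n k t\<^sup>k\<close> by \<open>1 + l n t\<close> if \<open>b\<close> holds, and by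
  \<open>1 / (1 - l n t)\<close> otherwise.\<close>

fun sym_fun :: "bool \<Rightarrow> (nat \<Rightarrow> real) \<Rightarrow> nat \<Rightarrow> nat \<Rightarrow> real" where
  "sym_fun b l 0 k = (if k = 0 then 1 else 0)"
| "sym_fun b l (Suc n) k = (\<Sum>i\<le>k. sym_coeff b i * l n ^ i * sym_fun b l n (k - i))"

lemma sym_fun_nonneg: "(\<And>j. 0 \<le> l j) \<Longrightarrow> 0 \<le> sym_fun b l n k"
  by (induction n arbitrary: k) (auto intro!: sum_nonneg mult_nonneg_nonneg simp: sym_coeff_def)

lemma bmom_sum_law:
  assumes "\<And>j. 0 \<le> l j" "\<And>j. b \<Longrightarrow> l j \<le> 1"
  shows "bmom (sum_law (\<lambda>j. weight_pmf b (l j)) n) k = ennreal (sym_fun b l n k)"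
proof (induction n arbitrary: k)
  case 0
  show ?case by (simp add: bmom_def binomial_eq_0_iff)
next
  case (Suc n)
  have "bmom (sum_law (\<lambda>j. weight_pmf b (l j)) (Suc n)) k =
      (\<Sum>i\<le>k. ennreal (sym_coeff b i * l n ^ i) * ennreal (sym_fun b l n (k - i)))"
    using assms by (simp add: bmom_conv_pmf Suc.IH bmom_weight_pmf sym_coeff_def)
  also have "\<dots> = (\<Sum>i\<le>k. ennreal (sym_coeff b i * l n ^ i * sym_fun b l n (k - i)))"
    using assms sym_fun_nonneg[of l b n] by (intro sum.cong refl ennreal_mult[symmetric]) (auto simp: sym_coeff_def)
  also have "\<dots> = ennreal (sym_fun b l (Suc n) k)"
    unfolding sym_fun.simps using assms sym_fun_nonneg[of l b n] by (intro sum_ennreal) (auto simp: sym_coeff_def)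
  finally show ?case .
qed

text \<open>The coefficients \<open>sym_coeff\<close> are at most the binomial ones, and with these
  the recursion is the binomial theorem. For summable eigenvalues the bound becomes uniform in
  \<open>n\<close>.\<close>

lemma sym_fun_le_power:
  assumes "\<And>j. 0 \<le> l j"
  shows "sym_fun b l n k \<le> (\<Sum>j<n. l j) ^ k"
proof (induction n arbitrary: k)
  case (Suc n)
  have s: "0 \<le> (\<Sum>j<n. l j)" using assms by (intro sum_nonneg) auto
  have "sym_fun b l (Suc n) k \<le> (\<Sum>i\<le>k. real (k choose i) * l n ^ i * (\<Sum>j<n. l j) ^ (k - i))"
    unfolding sym_fun.simps
  proof (intro sum_mono, rule mult_mono)
    fix i assume "i \<in> {..k}"
    then have "1 \<le> real (k choose i)" by (simp add: Suc_le_eq)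
    then show "sym_coeff b i * l n ^ i \<le> real (k choose i) * l n ^ i"
      using assms by (intro mult_right_mono) (auto simp: sym_coeff_def)
  qed (use assms s sym_fun_nonneg Suc.IH in auto)
  also have "\<dots> = (\<Sum>j<Suc n. l j) ^ k"
    using binomial_ring[of "l n" "\<Sum>j<n. l j" k] by (simp add: add.commute)
  finally show ?case .
qed (simp add: power_0_left)

text \<open>Independent Poisson variables add up to a Poisson variable, here at the level of
  binomial moments, where the limit argument takes place.\<close>

lemma bmom_Poi_sum_law:
  assumes "\<And>j. 0 \<le> l j"
  shows "bmom (sum_law (\<lambda>j. Poi (l j)) n) k = ennreal ((\<Sum>j<n. l j) ^ k / fact k)"
proof (induction n arbitrary: k)
  case 0
  show ?case by (simp add: bmom_def binomial_eq_0_iff power_0_left)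
next
  case (Suc n)
  define s where "s = (\<Sum>j<n. l j)"
  have s: "0 \<le> s" unfolding s_def using assms by (intro sum_nonneg) auto
  have "bmom (sum_law (\<lambda>j. Poi (l j)) (Suc n)) k =
      (\<Sum>i\<le>k. ennreal (l n ^ i / fact i) * ennreal (s ^ (k - i) / fact (k - i)))"
    using assms by (simp add: bmom_conv_pmf Suc.IH bmom_Poi s_def)
  also have "\<dots> = (\<Sum>i\<le>k. ennreal (real (k choose i) * l n ^ i * s ^ (k - i) / fact k))"
    using assms s by (intro sum.cong refl, subst ennreal_mult[symmetric]) (auto simp: binomial_fact)
  also have "\<dots> = ennreal (\<Sum>i\<le>k. real (k choose i) * l n ^ i * s ^ (k - i) / fact k)"
    using assms s by (intro sum_ennreal) auto
  also have "(\<Sum>i\<le>k. real (k choose i) * l n ^ i * s ^ (k - i) / fact k) = (\<Sum>j<Suc n. l j) ^ k / fact k"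
    using binomial_ring[of "l n" s k] by (simp add: s_def add.commute flip: sum_divide_distrib)
  finally show ?case .
qed

text \<open>Composing with a fixed transposition reverses all signs, so for determinants they cancel
  on two or more elements; on fewer the identity is the only permutation. For permanents the sum
  counts permutations.\<close>

lemma sum_wsign:
  assumes "finite B"
  shows "(\<Sum>p | p permutes B. wsign b p) = of_real (sym_coeff b (card B) * fact (card B))"
proof (cases "b \<and> 1 < card B")
  case True
  then have "\<exists>x\<in>B. \<exists>y\<in>B. x \<noteq> y"
    using card_le_Suc0_iff_eq[OF assms] by (metis One_nat_def not_le)
  then obtain x y where xy: "x \<in> B" "y \<in> B" "x \<noteq> y" by blast
  let ?t = "Transposition.transpose x y"
  have t: "?t permutes B" using xy by (simp add: permutes_swap_id)
  have "(\<Sum>p | p permutes B. wsign b p) = (\<Sum>p | p permutes B. wsign b (?t \<circ> p))"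
    by (rule sum.reindex_bij_betw[symmetric], rule bij_betw_byWitness[where f' = "\<lambda>p. ?t \<circ> p"])
      (auto simp: fun_eq_iff intro!: permutes_compose t)
  also have "\<dots> = (\<Sum>p | p permutes B. - wsign b p)"
    using xy True by (intro sum.cong refl) (simp add: wsign_compose[OF assms t], simp add: wsign_def sign_swap_id)
  finally have "(\<Sum>p | p permutes B. wsign b p) = 0" by (simp add: sum_negf)
  then show ?thesis using True by (simp add: sym_coeff_def)
next
  case False
  have "wsign b p = 1" if p: "p permutes B" for p
  proof (cases b)
    case True
    with False have "\<forall>x\<in>B. \<forall>y\<in>B. x = y"
      using card_le_Suc0_iff_eq[OF assms] by simp
    then have "p = id"
      using p by (metis eq_id_iff permutes_in_image permutes_not_in)
    then show ?thesis by (simp add: wsign_def)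
  qed (simp add: wsign_def)
  then show ?thesis
    using False card_permutations[OF refl assms] by (simp add: sym_coeff_def)
qed

lemma sum_Pow_card:
  fixes F :: "nat \<Rightarrow> 'b::comm_semiring_1"
  assumes "finite A"
  shows "(\<Sum>B\<in>Pow A. F (card B)) = (\<Sum>i\<le>card A. of_nat (card A choose i) * F i)"
proof -
  have "(\<Sum>B\<in>Pow A. F (card B)) = (\<Sum>i\<le>card A. \<Sum>B | B \<in> Pow A \<and> card B = i. F (card B))"
    using assms by (intro sum.group[symmetric]) (auto intro: card_mono)
  also have "\<dots> = (\<Sum>i\<le>card A. of_nat (card A choose i) * F i)"
    using n_subsets[OF assms] by (intro sum.cong refl) simp
  finally show ?thesis .
qed

text \<open>The sum over \<open>p\<close> is the integral of a product of orthonormal functions along \<open>J\<close>.\<close>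

definition label_sum :: "bool \<Rightarrow> (nat \<Rightarrow> real) \<Rightarrow> nat \<Rightarrow> 'i set \<Rightarrow> complex" where
  "label_sum b l n A = (\<Sum>J\<in>A \<rightarrow>\<^sub>E {..<n}. of_real (\<Prod>i\<in>A. l (J i)) *
     (\<Sum>p | p permutes A \<and> (\<forall>i\<in>A. J (p i) = J i). wsign b p))"

text \<open>Inverse to splitting a labelling into the set \<open>B\<close> of positions labelled
  \<open>n\<close> and the smaller labels elsewhere.\<close>

definition glue :: "'i set \<Rightarrow> nat \<Rightarrow> ('i \<Rightarrow> nat) \<Rightarrow> 'i \<Rightarrow> nat" where
  "glue B n J i = (if i \<in> B then n else J i)"

text \<open>A permutation that preserves labels maps \<open>B\<close>, the class of the label
  \<open>n\<close>, to itself, and likewise its complement. It splits into one permutation of each,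
  and the signs multiply.\<close>

lemma sum_wsign_glue:
  assumes A: "finite A" and B: "B \<subseteq> A" and J: "J \<in> (A - B) \<rightarrow>\<^sub>E {..<n}"
  shows "(\<Sum>p | p permutes A \<and> (\<forall>i\<in>A. glue B n J (p i) = glue B n J i). wsign b p) =
    (\<Sum>q | q permutes B. wsign b q) * (\<Sum>r | r permutes (A - B) \<and> (\<forall>i\<in>A - B. J (r i) = J i). wsign b r)"
proof -
  have Jn: "J i \<noteq> n" if "i \<in> A - B" for i using PiE_mem[OF J that] by auto
  have fin: "finite B" "finite (A - B)" using A B finite_subset by auto
  let ?P = "{p. p permutes A \<and> (\<forall>i\<in>A. glue B n J (p i) = glue B n J i)}"
  let ?R = "{r. r permutes (A - B) \<and> (\<forall>i\<in>A - B. J (r i) = J i)}"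
  let ?res = "\<lambda>C p x. if x \<in> C then p x else x"
  have P: "(\<forall>i\<in>B. p i \<in> B) \<and> (\<forall>i\<in>A - B. p i \<in> A - B \<and> J (p i) = J i)" if "p \<in> ?P" for p
  proof -
    have p: "p permutes A" and c: "\<And>i. i \<in> A \<Longrightarrow> glue B n J (p i) = glue B n J i" using that by auto
    have "p i \<in> A" if "i \<in> A" for i using p that by (simp add: permutes_in_image)
    then show ?thesis
      using c B Jn by (fastforce simp: glue_def split: if_splits)
  qed
  have res_perm: "?res C p permutes C" if "p permutes A" "\<And>i. i \<in> C \<Longrightarrow> p i \<in> C" "finite C" for C p
  proof (rule bij_imp_permutes)
    have "p ` C \<subseteq> C" "inj_on p C"
      using that(2) permutes_inj[OF that(1)] by (auto intro: inj_on_subset)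
    then have "bij_betw p C C"
      using endo_inj_surj[OF that(3)] by (simp add: bij_betw_def)
    then show "bij_betw (?res C p) C C"
      by (simp cong: bij_betw_cong)
  qed auto
  have "(\<Sum>q | q permutes B. wsign b q) * (\<Sum>r\<in>?R. wsign b r) =
      (\<Sum>(q, r)\<in>{q. q permutes B} \<times> ?R. wsign b q * wsign b r)"
    by (simp add: sum_product sum.cartesian_product)
  also have "\<dots> = (\<Sum>p\<in>?P. wsign b p)"
  proof (rule sum.reindex_bij_witness[where i = "\<lambda>p. (?res B p, ?res (A - B) p)" and j = "\<lambda>(q, r). q \<circ> r"])
    fix a assume a: "a \<in> {q. q permutes B} \<times> ?R"
    obtain q r where a': "a = (q, r)" by (cases a)
    have q: "q permutes B" and r: "r permutes (A - B)" and c: "\<And>i. i \<in> A - B \<Longrightarrow> J (r i) = J i"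
      using a a' by auto
    have qA: "q permutes A" and rA: "r permutes A"
      using permutes_subset[OF q B] permutes_subset[OF r] by auto
    have rB: "r i = i" if "i \<in> B" for i using r that by (simp add: permutes_not_in)
    have rAB: "r i \<in> A - B" if "i \<in> A - B" for i using permutes_in_image[OF r] that by blast
    have qB: "q i \<in> B" if "i \<in> B" for i using permutes_in_image[OF q] that by blast
    have q0: "q i = i" if "i \<notin> B" for i using q that by (simp add: permutes_not_in)
    show "(?res B ((\<lambda>(q, r). q \<circ> r) a), ?res (A - B) ((\<lambda>(q, r). q \<circ> r) a)) = a"
      unfolding a' using rB rAB q0 permutes_not_in[OF r] by (auto simp: fun_eq_iff)
    have "glue B n J (q (r i)) = glue B n J i" if "i \<in> A" for i
      using that rB rAB[of i] qB[of i] q0[of "r i"] c[of i] by (cases "i \<in> B") (simp_all add: glue_def)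
    then show "(\<lambda>(q, r). q \<circ> r) a \<in> ?P"
      unfolding a' using permutes_compose[OF rA qA] by simp
    show "wsign b ((\<lambda>(q, r). q \<circ> r) a) = (case a of (q, r) \<Rightarrow> wsign b q * wsign b r)"
      unfolding a' using wsign_compose[OF A qA rA] by simp
  next
    fix p assume p: "p \<in> ?P"
    note pp = P[OF p]
    have pA: "p permutes A" using p by simp
    show "(\<lambda>(q, r). q \<circ> r) (?res B p, ?res (A - B) p) = p"
      using pp permutes_not_in[OF pA] B by (auto simp: fun_eq_iff)
    show "(?res B p, ?res (A - B) p) \<in> {q. q permutes B} \<times> ?R"
      using res_perm[OF pA _ fin(1)] res_perm[OF pA _ fin(2)] pp by simp
  qed
  finally show ?thesis ..
qed

text \<open>Labellings are sorted by the set \<open>B\<close> of positions with the newest label.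
  Permutations inside \<open>B\<close> are unconstrained and contribute the sum of signs over
  \<open>B\<close>.\<close>

lemma label_sum_Suc:
  assumes A: "finite A"
  shows "label_sum b l (Suc n) A =
    (\<Sum>B\<in>Pow A. of_real (l n ^ card B * sym_coeff b (card B) * fact (card B)) * label_sum b l n (A - B))"
proof -
  let ?f = "\<lambda>J. of_real (\<Prod>i\<in>A. l (J i)) * (\<Sum>p | p permutes A \<and> (\<forall>i\<in>A. J (p i) = J i). wsign b p)"
  have "label_sum b l (Suc n) A = (\<Sum>(B, J)\<in>Sigma (Pow A) (\<lambda>B. (A - B) \<rightarrow>\<^sub>E {..<n}). ?f (glue B n J))"
    unfolding label_sum_def
  proof (rule sum.reindex_bij_witness[where i = "\<lambda>(B, J). glue B n J" and
        j = "\<lambda>J. ({i \<in> A. J i = n}, restrict J {i \<in> A. J i \<noteq> n})"])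
    fix a assume "a \<in> Sigma (Pow A) (\<lambda>B. (A - B) \<rightarrow>\<^sub>E {..<n})"
    then obtain B J where a: "a = (B, J)" and B: "B \<subseteq> A" and J: "J \<in> (A - B) \<rightarrow>\<^sub>E {..<n}" by auto
    have Jn: "J i < n" if "i \<in> A - B" for i using PiE_mem[OF J that] by simp
    have Ju: "J i = undefined" if "i \<notin> A - B" for i using PiE_arb[OF J that] .
    have 1: "{i \<in> A. glue B n J i = n} = B"
      using B Jn by (force simp: glue_def)
    moreover have "{i \<in> A. glue B n J i \<noteq> n} = A - B" using 1 by auto
    moreover have "restrict (glue B n J) (A - B) = J"
      using Ju by (auto simp: fun_eq_iff restrict_def glue_def)
    ultimately show "({i \<in> A. (\<lambda>(B, J). glue B n J) a i = n},
        restrict ((\<lambda>(B, J). glue B n J) a) {i \<in> A. (\<lambda>(B, J). glue B n J) a i \<noteq> n}) = a"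
      by (simp add: a)
    show "(\<lambda>(B, J). glue B n J) a \<in> A \<rightarrow>\<^sub>E {..<Suc n}"
      unfolding a using Jn Ju B by (auto simp: PiE_iff glue_def extensional_def less_Suc_eq)
  next
    fix J assume J: "J \<in> A \<rightarrow>\<^sub>E {..<Suc n}"
    have "J i < Suc n" if "i \<in> A" for i using PiE_mem[OF J that] by simp
    then show "({i \<in> A. J i = n}, restrict J {i \<in> A. J i \<noteq> n}) \<in> Sigma (Pow A) (\<lambda>B. (A - B) \<rightarrow>\<^sub>E {..<n})"
      by (auto simp: less_Suc_eq PiE_iff extensional_def)
    have Ju: "J i = undefined" if "i \<notin> A" for i using PiE_arb[OF J that] .
    show g: "(\<lambda>(B, J). glue B n J) ({i \<in> A. J i = n}, restrict J {i \<in> A. J i \<noteq> n}) = J"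
      using Ju by (auto simp: fun_eq_iff glue_def)
    show "(case ({i \<in> A. J i = n}, restrict J {i \<in> A. J i \<noteq> n}) of (B, J) \<Rightarrow> ?f (glue B n J)) = ?f J"
      using g by simp
  qed
  also have "\<dots> = (\<Sum>B\<in>Pow A. \<Sum>J\<in>(A - B) \<rightarrow>\<^sub>E {..<n}. ?f (glue B n J))"
    using A by (intro sum.Sigma[symmetric]) (auto intro!: finite_PiE)
  also have "\<dots> = (\<Sum>B\<in>Pow A. of_real (l n ^ card B * sym_coeff b (card B) * fact (card B)) * label_sum b l n (A - B))"
  proof (rule sum.cong[OF refl])
    fix B assume "B \<in> Pow A"
    then have B: "B \<subseteq> A" by simp
    then have fB: "finite B" using A finite_subset by auto
    have "?f (glue B n J) = of_real (l n ^ card B * sym_coeff b (card B) * fact (card B)) *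
        (of_real (\<Prod>i\<in>A - B. l (J i)) *
         (\<Sum>r | r permutes (A - B) \<and> (\<forall>i\<in>A - B. J (r i) = J i). wsign b r))"
      if J: "J \<in> (A - B) \<rightarrow>\<^sub>E {..<n}" for J
    proof -
      have "(\<Prod>i\<in>A. l (glue B n J i)) = (\<Prod>i\<in>A - B. l (glue B n J i)) * (\<Prod>i\<in>B. l (glue B n J i))"
        by (rule prod.subset_diff[OF B A])
      also have "\<dots> = l n ^ card B * (\<Prod>i\<in>A - B. l (J i))"
        by (simp add: glue_def)
      finally show ?thesis
        unfolding sum_wsign_glue[OF A B J] sum_wsign[OF fB] by simp
    qed
    note eq = this
    show "(\<Sum>J\<in>(A - B) \<rightarrow>\<^sub>E {..<n}. ?f (glue B n J)) =
        of_real (l n ^ card B * sym_coeff b (card B) * fact (card B)) * label_sum b l n (A - B)"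
      unfolding label_sum_def sum_distrib_left[where A = "(A - B) \<rightarrow>\<^sub>E {..<n}"]
      by (rule sum.cong[OF refl eq])
  qed
  finally show ?thesis .
qed

text \<open>Since \<open>(k choose i) * i! * (k - i)! = k!\<close>, grouping the subsets by size
  turns the recursion of \<open>label_sum\<close> into that of \<open>sym_fun\<close>, up to the
  factor \<open>k!\<close>.\<close>

lemma label_sum_eq:
  assumes "finite A"
  shows "label_sum b l n A = of_real (fact (card A) * sym_fun b l n (card A))"
  using assms
proof (induction n arbitrary: A)
  case 0
  have "{p. p permutes ({} :: 'a set) } = {id}" by auto
  then show ?case
    using 0 by (cases "A = {}") (auto simp: label_sum_def PiE_eq_empty_iff wsign_def)
next
  case (Suc n)
  let ?F = "\<lambda>i. l n ^ i * sym_coeff b i * fact i * (fact (card A - i) * sym_fun b l n (card A - i))"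
  have "label_sum b l (Suc n) A = (\<Sum>B\<in>Pow A. of_real (?F (card B)))"
    unfolding label_sum_Suc[OF Suc.prems]
  proof (rule sum.cong[OF refl])
    fix B assume "B \<in> Pow A"
    then have "finite (A - B)" "card (A - B) = card A - card B"
      using Suc.prems by (auto simp: card_Diff_subset finite_subset)
    then show "of_real (l n ^ card B * sym_coeff b (card B) * fact (card B)) * label_sum b l n (A - B) =
        of_real (?F (card B))"
      using Suc.IH[of "A - B"] by simp
  qed
  also have "\<dots> = of_real (\<Sum>B\<in>Pow A. ?F (card B))" by simp
  also have "(\<Sum>B\<in>Pow A. ?F (card B)) = (\<Sum>i\<le>card A. of_nat (card A choose i) * ?F i)"
    by (rule sum_Pow_card[OF Suc.prems])
  also have "\<dots> = fact (card A) * sym_fun b l (Suc n) (card A)"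
    unfolding sym_fun.simps sum_distrib_left
    by (intro sum.cong refl) (auto simp: binomial_fact field_simps)
  finally show ?case .
qed

section \<open>Mercer kernels\<close>

text \<open>Instances have \<open>w j = sqrt (\<lambda>\<^sub>j) \<phi>\<^sub>j\<close> on \<open>D\<close>. The series for \<open>K\<close> need only converge where those
  for the diagonal do, which is almost everywhere.\<close>

locale mercer_kernel =
  fixes \<mu> :: "'a::euclidean_space measure" and D :: "'a set"
    and w :: "nat \<Rightarrow> 'a \<Rightarrow> complex" and l :: "nat \<Rightarrow> real" and K :: "'a \<Rightarrow> 'a \<Rightarrow> complex"
  assumes sigma: "sigma_finite_measure \<mu>" and sets_\<mu>: "sets \<mu> = sets borel"
    and w_meas: "\<And>j. w j \<in> borel_measurable borel"
    and w_int: "\<And>j. integrable \<mu> (\<lambda>x. (cmod (w j x))\<^sup>2)"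
    and w_orth: "\<And>i j. (\<integral>x. w i x * cnj (w j x) \<partial>\<mu>) = (if i = j then of_real (l i) else 0)"
    and l_nonneg: "\<And>j. 0 \<le> l j" and l_summable: "summable l"
    and K_lim: "\<And>x y. summable (\<lambda>j. (cmod (w j x))\<^sup>2) \<Longrightarrow> summable (\<lambda>j. (cmod (w j y))\<^sup>2) \<Longrightarrow>
      (\<lambda>n. \<Sum>j<n. w j x * cnj (w j y)) \<longlonglongrightarrow> K x y"
    and K_out: "\<And>x y. x \<notin> D \<Longrightarrow> K x y = 0"
begin

sublocale product_sigma_finite "\<lambda>_::nat. \<mu>"
  by (simp add: product_sigma_finite_def sigma)

definition good :: "'a \<Rightarrow> bool" where
  "good x \<longleftrightarrow> summable (\<lambda>j. (cmod (w j x))\<^sup>2)"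

definition trunc_kernel :: "nat \<Rightarrow> 'a \<Rightarrow> 'a \<Rightarrow> complex" where
  "trunc_kernel n x y = (\<Sum>j<n. w j x * cnj (w j y))"

text \<open>Valued in \<open>ennreal\<close> so that it is defined and measurable everywhere; it is
  finite exactly at the \<open>good\<close> points.\<close>

definition diag :: "'a \<Rightarrow> ennreal" where
  "diag x = (\<Sum>j. ennreal ((cmod (w j x))\<^sup>2))"

lemma borel_imp_meas: "f \<in> borel_measurable borel \<Longrightarrow> f \<in> borel_measurable \<mu>"
  using measurable_cong_sets[OF sets_\<mu> refl] by blast

lemma diag_meas: "diag \<in> borel_measurable borel"
proof -
  have [measurable]: "w j \<in> borel_measurable borel" for j by (rule w_meas)
  show ?thesis unfolding diag_def[abs_def] by measurable
qed

lemma w_norm: "(\<integral>\<^sup>+x. ennreal ((cmod (w j x))\<^sup>2) \<partial>\<mu>) = ennreal (l j)"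
proof -
  have "complex_of_real (\<integral>x. (cmod (w j x))\<^sup>2 \<partial>\<mu>) = (\<integral>x. w j x * cnj (w j x) \<partial>\<mu>)"
    by (simp only: complex_norm_square[symmetric] integral_complex_of_real)
  then have "(\<integral>x. (cmod (w j x))\<^sup>2 \<partial>\<mu>) = l j"
    by (simp add: w_orth)
  then show ?thesis
    using w_int[of j] by (subst nn_integral_eq_integral) auto
qed

lemma diag_integral: "(\<integral>\<^sup>+x. diag x \<partial>\<mu>) = ennreal (\<Sum>j. l j)"
proof -
  have [measurable]: "w j \<in> borel_measurable \<mu>" for j by (intro borel_imp_meas w_meas)
  have "(\<integral>\<^sup>+x. diag x \<partial>\<mu>) = (\<Sum>j. \<integral>\<^sup>+x. ennreal ((cmod (w j x))\<^sup>2) \<partial>\<mu>)"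
    unfolding diag_def by (rule nn_integral_suminf) measurable
  also have "\<dots> = (\<Sum>j. ennreal (l j))" by (simp only: w_norm)
  also have "\<dots> = ennreal (\<Sum>j. l j)"
    by (rule suminf_ennreal2[OF l_nonneg l_summable])
  finally show ?thesis .
qed

lemma good_iff: "good x \<longleftrightarrow> diag x \<noteq> \<infinity>"
proof
  assume "good x"
  then have "diag x = ennreal (\<Sum>j. (cmod (w j x))\<^sup>2)"
    unfolding diag_def good_def by (intro suminf_ennreal2) auto
  then show "diag x \<noteq> \<infinity>" by simp
next
  assume "diag x \<noteq> \<infinity>"
  then show "good x"
    unfolding diag_def good_def by (intro summable_suminf_not_top) auto
qed

text \<open>The integral of \<open>diag\<close> is the trace, which is finite.\<close>

lemma AE_good: "AE x in \<mu>. good x"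
  unfolding good_iff
  by (rule nn_integral_PInf_AE) (use diag_meas borel_imp_meas diag_integral in auto)

lemma AE_PiM_good:
  fixes k :: nat
  shows "AE x in (\<Pi>\<^sub>M i\<in>{..<k}. \<mu>). \<forall>i<k. good (x i)"
proof -
  let ?N = "{x. diag x = \<infinity>}"
  have N: "?N \<in> sets \<mu>" using diag_meas sets_\<mu> by simp
  have N0: "emeasure \<mu> ?N = 0"
  proof -
    have "AE x in \<mu>. x \<notin> ?N" using AE_good by (simp add: good_iff)
    then show ?thesis
      using N sets_eq_imp_space_eq[OF sets_\<mu>] by (subst (asm) AE_iff_measurable[OF N]) auto
  qed
  have "AE x in (\<Pi>\<^sub>M i\<in>{..<k}. \<mu>). x i \<notin> ?N" if i: "i < k" for i
  proof (rule AE_I[where N = "PiE {..<k} (\<lambda>j. if j = i then ?N else UNIV)"])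
    have m: "(if j = i then ?N else UNIV) \<in> sets \<mu>" for j
      using N sets.top[of \<mu>] sets_eq_imp_space_eq[OF sets_\<mu>] by auto
    \<comment> \<open>One factor is 0, which makes the product 0 even if \<open>\<mu>\<close> has
      infinite total mass.\<close>
    show "emeasure (\<Pi>\<^sub>M i\<in>{..<k}. \<mu>) (PiE {..<k} (\<lambda>j. if j = i then ?N else UNIV)) = 0"
      using i N0 emeasure_PiM[of "{..<k}" "\<lambda>j. if j = i then ?N else UNIV", OF finite_lessThan m]
      by (auto intro!: prod_zero bexI[of _ i])
    show "PiE {..<k} (\<lambda>j. if j = i then ?N else UNIV) \<in> sets (\<Pi>\<^sub>M i\<in>{..<k}. \<mu>)"
      using m by (intro sets_PiM_I_finite) auto
  qed (auto simp: space_PiM PiE_def)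
  then have "AE x in (\<Pi>\<^sub>M i\<in>{..<k}. \<mu>). \<forall>i\<in>{..<k}. x i \<notin> ?N"
    by (intro AE_finite_allI) auto
  then show ?thesis
    by eventually_elim (simp add: good_iff)
qed

lemma K_diag:
  assumes "good x"
  shows "Im (K x x) = 0" "0 \<le> Re (K x x)" "diag x = ennreal (Re (K x x))"
proof -
  have "(\<lambda>n. \<Sum>j<n. w j x * cnj (w j x)) \<longlonglongrightarrow> K x x"
    using K_lim assms by (simp add: good_def)
  then have *: "(\<lambda>n. of_real (\<Sum>j<n. (cmod (w j x))\<^sup>2)) \<longlonglongrightarrow> K x x"
    by (simp only: complex_norm_square[symmetric] of_real_sum)
  have s: "(\<lambda>n. \<Sum>j<n. (cmod (w j x))\<^sup>2) \<longlonglongrightarrow> (\<Sum>j. (cmod (w j x))\<^sup>2)"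
    using assms by (auto simp: good_def intro: summable_LIMSEQ)
  have K: "K x x = of_real (\<Sum>j. (cmod (w j x))\<^sup>2)"
    by (rule LIMSEQ_unique[OF *]) (intro tendsto_of_real s)
  then show "Im (K x x) = 0" "0 \<le> Re (K x x)"
    using assms by (auto simp: good_def intro!: suminf_nonneg)
  have "diag x = ennreal (\<Sum>j. (cmod (w j x))\<^sup>2)"
    using assms unfolding diag_def good_def by (intro suminf_ennreal2) auto
  then show "diag x = ennreal (Re (K x x))" using K by simp
qed

definition immK :: "bool \<Rightarrow> nat \<Rightarrow> (nat \<Rightarrow> 'a) \<Rightarrow> complex" where
  "immK b k x = imm b {..<k} (\<lambda>i j. K (x i) (x j))"

definition immT :: "bool \<Rightarrow> nat \<Rightarrow> nat \<Rightarrow> (nat \<Rightarrow> 'a) \<Rightarrow> complex" where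
  "immT b k n x = imm b {..<k} (\<lambda>i j. trunc_kernel n (x i) (x j))"

lemma immT_tendsto:
  assumes "\<forall>i<k. good (x i)"
  shows "(\<lambda>n. immT b k n x) \<longlonglongrightarrow> immK b k x"
  unfolding immT_def immK_def imm_def
proof (intro tendsto_sum tendsto_mult tendsto_const tendsto_prod)
  fix p i assume "p \<in> {p. p permutes {..<k}}" "i \<in> {..<k}"
  then have "i < k" "p i < k" using permutes_in_image[of p "{..<k}" i] by auto
  then show "(\<lambda>n. trunc_kernel n (x i) (x (p i))) \<longlonglongrightarrow> K (x i) (x (p i))"
    unfolding trunc_kernel_def using assms by (intro K_lim) (auto simp: good_def)
qed

lemma immT_nonneg: "immT b k n x \<in> \<real>\<^sub>\<ge>\<^sub>0"
  unfolding immT_def trunc_kernel_def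
  by (rule imm_gram_nonneg[where v = "\<lambda>j i. w j (x i)"]) auto

lemma immT_mono: "Re (immT b k n x) \<le> Re (immT b k (Suc n) x)"
proof -
  have "immT b k (Suc n) x - immT b k n x \<in> \<real>\<^sub>\<ge>\<^sub>0"
    unfolding immT_def trunc_kernel_def
    by (rule imm_gram_mono[where v = "\<lambda>j i. w j (x i)"]) auto
  then show ?thesis by (simp add: complex_nonneg_Reals_iff)
qed

text \<open>At good points every matrix entry is a limit of truncated entries, and the inequalities
  for finite Gram matrices are closed conditions.\<close>

lemma immK_compare:
  assumes "\<forall>i<k. good (x i)"
  shows "immK b k x \<in> \<real>\<^sub>\<ge>\<^sub>0"
    and "Re (immK True k x) \<le> (\<Prod>i<k. Re (K (x i) (x i)))"
    and "(\<Prod>i<k. Re (K (x i) (x i))) \<le> Re (immK False k x)"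
proof -
  note lim = immT_tendsto[OF assms]
  have "0 \<le> Re (immK b k x)"
    by (rule LIMSEQ_le_const[OF tendsto_Re[OF lim]])
      (use immT_nonneg in \<open>auto simp: complex_nonneg_Reals_iff\<close>)
  moreover have "Im (immK b k x) = 0"
    by (rule LIMSEQ_unique[OF tendsto_Im[OF lim[of b]]])
      (use immT_nonneg in \<open>auto simp: complex_nonneg_Reals_iff\<close>)
  ultimately show "immK b k x \<in> \<real>\<^sub>\<ge>\<^sub>0" by (simp add: complex_nonneg_Reals_iff)
  have pl: "(\<lambda>n. \<Prod>i<k. Re (trunc_kernel n (x i) (x i))) \<longlonglongrightarrow> (\<Prod>i<k. Re (K (x i) (x i)))"
    unfolding trunc_kernel_def using assms
    by (intro tendsto_prod tendsto_Re K_lim) (auto simp: good_def)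
  note cmp = imm_gram_compare_prod[where S = "{..<k}" and I = "{..<n}" and v = "\<lambda>j i. w j (x i)" and
      A = "\<lambda>i j. trunc_kernel n (x i) (x j)" for n, OF finite_lessThan finite_lessThan trunc_kernel_def]
  show "Re (immK True k x) \<le> (\<Prod>i<k. Re (K (x i) (x i)))"
    by (rule LIMSEQ_le[OF tendsto_Re[OF lim] pl]) (use cmp(1) in \<open>auto simp: immT_def\<close>)
  show "(\<Prod>i<k. Re (K (x i) (x i))) \<le> Re (immK False k x)"
    by (rule LIMSEQ_le[OF pl tendsto_Re[OF lim]]) (use cmp(2) in \<open>auto simp: immT_def\<close>)
qed

section \<open>Integrals of truncated determinants and permanents\<close>

lemma w_prod_integrable: "integrable \<mu> (\<lambda>x. w i x * cnj (w j x))"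
proof (rule Bochner_Integration.integrable_bound)
  show "integrable \<mu> (\<lambda>x. (cmod (w i x))\<^sup>2 + (cmod (w j x))\<^sup>2)"
    by (intro Bochner_Integration.integrable_add w_int)
  have [measurable]: "w j \<in> borel_measurable \<mu>" for j by (intro borel_imp_meas w_meas)
  show "(\<lambda>x. w i x * cnj (w j x)) \<in> borel_measurable \<mu>"
    by (intro borel_measurable_times measurable_compose[OF _ borel_measurable_continuous_onI[of cnj]]
        continuous_intros) measurable
  have "a * b \<le> a\<^sup>2 + b\<^sup>2" if "0 \<le> a" "0 \<le> b" for a b :: real
    using sum_squares_bound[of a b] mult_nonneg_nonneg[OF that] by linarith
  then show "AE x in \<mu>. norm (w i x * cnj (w j x)) \<le> norm ((cmod (w i x))\<^sup>2 + (cmod (w j x))\<^sup>2)"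
    by (intro AE_I2) (simp add: norm_mult)
qed

text \<open>After expansion into labellings, with the permutation moved onto the labels, the
  integrand is a product of functions of single coordinates. By orthogonality only permutations with
  \<open>J (p i) = J i\<close> for all \<open>i\<close> contribute, which leaves
  \<open>label_sum\<close>.\<close>

lemma immT_integral:
  shows "integrable (\<Pi>\<^sub>M i\<in>{..<k}. \<mu>) (immT b k n)"
    and "(\<integral>x. immT b k n x \<partial>(\<Pi>\<^sub>M i\<in>{..<k}. \<mu>)) = of_real (fact k * sym_fun b l n k)"
proof -
  let ?P = "\<Pi>\<^sub>M i\<in>{..<k}. \<mu>"
  let ?S = "{p. p permutes {..<k}}"
  let ?g = "\<lambda>J p x. \<Prod>i<k. w (J i) (x i) * cnj (w (J (p i)) (x i))"
  have eq: "immT b k n x = (\<Sum>J\<in>{..<k} \<rightarrow>\<^sub>E {..<n}. \<Sum>p\<in>?S. wsign b p * ?g J p x)" for x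
  proof -
    have "immT b k n x = (\<Sum>J\<in>{..<k} \<rightarrow>\<^sub>E {..<n}. \<Sum>p\<in>?S. wsign b p *
        (\<Prod>i<k. w (J i) (x i) * cnj (w (J i) (x (p i)))))"
      unfolding immT_def trunc_kernel_def by (rule imm_gram[where v = "\<lambda>j i. w j (x i)"]) auto
    also have "\<dots> = (\<Sum>J\<in>{..<k} \<rightarrow>\<^sub>E {..<n}. \<Sum>p\<in>?S. wsign b p * ?g J p x)"
    proof (rule sum.cong[OF refl])
      fix J
      \<comment> \<open>Passing to the inverse permutation and shifting the index of the conjugated
        product moves \<open>p\<close> from points to labels; factor \<open>i\<close> then depends
        on \<open>x i\<close> alone.\<close>
      have "(\<Sum>p\<in>?S. wsign b p * (\<Prod>i<k. w (J i) (x i) * cnj (w (J i) (x (p i))))) =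
          (\<Sum>p\<in>?S. wsign b (inv_into UNIV p) * (\<Prod>i<k. w (J i) (x i) * cnj (w (J i) (x (inv_into UNIV p i)))))"
        by (rule sum.reindex_bij_betw[symmetric], rule bij_betw_byWitness[where f' = "inv_into UNIV"])
          (auto simp: permutes_inv permutes_inv_inv)
      also have "\<dots> = (\<Sum>p\<in>?S. wsign b p * ?g J p x)"
      proof (rule sum.cong[OF refl])
        fix p assume "p \<in> ?S"
        then have p: "p permutes {..<k}" by simp
        have "(\<Prod>i<k. cnj (w (J i) (x (inv_into UNIV p i)))) =
            (\<Prod>i<k. cnj (w (J (p i)) (x (inv_into UNIV p (p i)))))"
          by (rule prod.reindex_bij_betw[OF permutes_imp_bij[OF p], symmetric])
        then have "(\<Prod>i<k. cnj (w (J i) (x (inv_into UNIV p i)))) = (\<Prod>i<k. cnj (w (J (p i)) (x i)))"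
          using permutes_inverses[OF p] by simp
        then show "wsign b (inv_into UNIV p) * (\<Prod>i<k. w (J i) (x i) * cnj (w (J i) (x (inv_into UNIV p i)))) =
            wsign b p * ?g J p x"
          using p by (simp add: wsign_inv[OF finite_lessThan] prod.distrib)
      qed
      finally show "(\<Sum>p\<in>?S. wsign b p * (\<Prod>i<k. w (J i) (x i) * cnj (w (J i) (x (p i))))) =
          (\<Sum>p\<in>?S. wsign b p * ?g J p x)" .
    qed
    finally show ?thesis .
  qed
  have int: "integrable ?P (?g J p)" for J p
    by (rule product_integrable_prod) (auto intro: w_prod_integrable)
  have val: "(\<integral>x. ?g J p x \<partial>?P) =
      (if \<forall>i\<in>{..<k}. J (p i) = J i then of_real (\<Prod>i<k. l (J i)) else 0)" for J p
  proof -
    have "(\<integral>x. ?g J p x \<partial>?P) = (\<Prod>i<k. \<integral>x. w (J i) x * cnj (w (J (p i)) x) \<partial>\<mu>)"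
      by (rule product_integral_prod) (auto intro: w_prod_integrable)
    also have "\<dots> = (\<Prod>i<k. if J i = J (p i) then of_real (l (J i)) else 0)"
      by (simp only: w_orth)
    also have "\<dots> = (if \<forall>i\<in>{..<k}. J (p i) = J i then of_real (\<Prod>i<k. l (J i)) else 0)"
    proof (cases "\<forall>i\<in>{..<k}. J (p i) = J i")
      case False
      then obtain i where "i < k" "J i \<noteq> J (p i)" by force
      then show ?thesis using False by (auto intro!: prod_zero bexI[of _ i])
    qed (simp add: of_real_prod)
    finally show ?thesis .
  qed
  show "integrable ?P (immT b k n)"
    unfolding eq[abs_def] by (intro Bochner_Integration.integrable_sum integrable_mult_right int)
  have "(\<integral>x. immT b k n x \<partial>?P) = (\<Sum>J\<in>{..<k} \<rightarrow>\<^sub>E {..<n}. \<Sum>p\<in>?S. wsign b p * (\<integral>x. ?g J p x \<partial>?P))"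
    unfolding eq
    by (subst Bochner_Integration.integral_sum, intro Bochner_Integration.integrable_sum integrable_mult_right int)
      (subst Bochner_Integration.integral_sum, intro integrable_mult_right int, simp)
  also have "\<dots> = label_sum b l n {..<k}"
    unfolding label_sum_def
  proof (rule sum.cong[OF refl])
    fix J :: "nat \<Rightarrow> nat"
    have fin: "finite ?S" by (rule finite_permutations) simp
    have "(\<Sum>p\<in>?S. wsign b p * (\<integral>x. ?g J p x \<partial>?P)) =
        (\<Sum>p\<in>?S. if \<forall>i\<in>{..<k}. J (p i) = J i then wsign b p * of_real (\<Prod>i<k. l (J i)) else 0)"
      unfolding val by (intro sum.cong refl) simp
    also have "\<dots> = (\<Sum>p\<in>?S \<inter> {p. \<forall>i\<in>{..<k}. J (p i) = J i}. wsign b p * of_real (\<Prod>i<k. l (J i)))"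
      by (subst sum.inter_restrict[OF fin]) simp
    also have "?S \<inter> {p. \<forall>i\<in>{..<k}. J (p i) = J i} = {p. p permutes {..<k} \<and> (\<forall>i\<in>{..<k}. J (p i) = J i)}"
      by auto
    finally show "(\<Sum>p\<in>?S. wsign b p * (\<integral>x. ?g J p x \<partial>?P)) = of_real (\<Prod>i<k. l (J i)) *
        (\<Sum>p | p permutes {..<k} \<and> (\<forall>i\<in>{..<k}. J (p i) = J i). wsign b p)"
      by (simp only: sum_distrib_right[symmetric] mult.commute)
  qed
  also have "\<dots> = of_real (fact k * sym_fun b l n k)"
    using label_sum_eq[of "{..<k}" b l n] by simp
  finally show "(\<integral>x. immT b k n x \<partial>?P) = of_real (fact k * sym_fun b l n k)" .
qed

lemma immT_nn_integral:
  "(\<integral>\<^sup>+x. ennreal (Re (immT b k n x)) \<partial>(\<Pi>\<^sub>M i\<in>{..<k}. \<mu>)) = ennreal (fact k * sym_fun b l n k)"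
proof -
  have "(\<integral>x. Re (immT b k n x) \<partial>(\<Pi>\<^sub>M i\<in>{..<k}. \<mu>)) = fact k * sym_fun b l n k"
    using immT_integral[of k b n] by (subst integral_Re) auto
  moreover have "integrable (\<Pi>\<^sub>M i\<in>{..<k}. \<mu>) (\<lambda>x. Re (immT b k n x))"
    using immT_integral(1) by (rule integrable_Re)
  ultimately show ?thesis
    using immT_nonneg by (subst nn_integral_eq_integral) (auto simp: complex_nonneg_Reals_iff)
qed

text \<open>The truncations increase to the kernel's value at good points, so this is monotone
  convergence.\<close>

lemma immK_nn_integral:
  "(\<integral>\<^sup>+x. ennreal (Re (immK b k x)) \<partial>(\<Pi>\<^sub>M i\<in>{..<k}. \<mu>)) = (SUP n. ennreal (fact k * sym_fun b l n k))"
proof -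
  let ?P = "\<Pi>\<^sub>M i\<in>{..<k}. \<mu>"
  have "AE x in ?P. (SUP n. ennreal (Re (immT b k n x))) = ennreal (Re (immK b k x))"
    using AE_PiM_good
  proof eventually_elim
    case (elim x)
    show ?case
      by (rule SUP_eq_of_tendsto) (intro tendsto_ennrealI tendsto_Re immT_tendsto elim ennreal_leI immT_mono)+
  qed
  then have "(\<integral>\<^sup>+x. ennreal (Re (immK b k x)) \<partial>?P) = (\<integral>\<^sup>+x. (SUP n. ennreal (Re (immT b k n x))) \<partial>?P)"
    by (intro nn_integral_cong_AE) (auto elim: eventually_mono)
  also have "\<dots> = (SUP n. \<integral>\<^sup>+x. ennreal (Re (immT b k n x)) \<partial>?P)"
  proof (rule nn_integral_monotone_convergence_SUP_AE)
    show "(\<lambda>x. ennreal (Re (immT b k n x))) \<in> borel_measurable ?P" for n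
      using borel_measurable_integrable[OF integrable_Re[OF immT_integral(1)[of k b n]]] by measurable
  qed (intro AE_I2 ennreal_leI immT_mono)
  finally show ?thesis unfolding immT_nn_integral .
qed

lemma immK_out:
  assumes "i < k" "x i \<notin> D"
  shows "immK b k x = 0"
  unfolding immK_def imm_def
proof (rule sum.neutral, rule ballI)
  fix p
  have "(\<Prod>i<k. K (x i) (x (p i))) = 0"
    using assms K_out by (intro prod_zero bexI[of _ i]) auto
  then show "wsign b p * (\<Prod>i<k. K (x i) (x (p i))) = 0" by simp
qed

end

section \<open>Determinantal and permanental processes\<close>

definition imm_process ::
  "bool \<Rightarrow> 'w measure \<Rightarrow> ('w \<Rightarrow> 'a::euclidean_space measure) \<Rightarrow> 'a measure \<Rightarrow> ('a \<Rightarrow> 'a \<Rightarrow> complex) \<Rightarrow> bool" where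
  "imm_process b M \<Phi> \<mu> K \<longleftrightarrow>
     simple_point_process M \<Phi> \<and>
     (\<forall>k\<ge>1. \<exists>\<rho>. joint_intensity M \<Phi> \<mu> k \<rho> \<and>
        (AE x in (\<Pi>\<^sub>M i\<in>{..<k}. \<mu>). complex_of_real (\<rho> x) = imm b {..<k} (\<lambda>i j. K (x i) (x j))))"

lemma prod_kernel_mat:
  fixes p :: "nat \<Rightarrow> nat"
  assumes "p permutes {..<k}"
  shows "(\<Prod>i = 0..<k. kernel_mat K k x $$ (i, p i)) = (\<Prod>i<k. K (x i) (x (p i)))"
proof (rule prod.cong)
  fix i assume i: "i \<in> {..<k}"
  then have "p i < k" using permutes_in_image[OF assms, of i] by simp
  then show "kernel_mat K k x $$ (i, p i) = K (x i) (x (p i))"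
    using i by (simp add: kernel_mat_def)
qed auto

lemma det_kernel_mat: "Determinant.det (kernel_mat K k x) = imm True {..<k} (\<lambda>i j. K (x i) (x j))"
proof -
  have d: "dim_row (kernel_mat K k x) = k" "dim_col (kernel_mat K k x) = k"
    by (simp_all add: kernel_mat_def)
  have "Determinant.det (kernel_mat K k x) =
      (\<Sum>p | p permutes {..<k}. signof p * (\<Prod>i = 0..<k. kernel_mat K k x $$ (i, p i)))"
    by (simp only: Determinant.det_def d refl if_True atLeast0LessThan)
  also have "\<dots> = imm True {..<k} (\<lambda>i j. K (x i) (x j))"
    unfolding imm_def by (intro sum.cong refl) (simp only: mem_Collect_eq prod_kernel_mat wsign_def if_True)
  finally show ?thesis .
qed

lemma permanent_kernel_mat: "permanent (kernel_mat K k x) = imm False {..<k} (\<lambda>i j. K (x i) (x j))"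
proof -
  have d: "dim_row (kernel_mat K k x) = k" by (simp add: kernel_mat_def)
  have "permanent (kernel_mat K k x) =
      (\<Sum>p | p permutes {..<k}. (\<Prod>i = 0..<k. kernel_mat K k x $$ (i, p i)))"
    by (simp only: permanent_def d atLeast0LessThan)
  also have "\<dots> = imm False {..<k} (\<lambda>i j. K (x i) (x j))"
    unfolding imm_def by (intro sum.cong refl) (simp only: mem_Collect_eq prod_kernel_mat wsign_def if_False mult_1)
  finally show ?thesis .
qed

lemma determinantal_iff_imm_process: "determinantal M \<Phi> \<mu> K \<longleftrightarrow> imm_process True M \<Phi> \<mu> K"
  by (simp add: determinantal_def imm_process_def det_kernel_mat)

lemma permanental_iff_imm_process: "permanental M \<Phi> \<mu> K \<longleftrightarrow> imm_process False M \<Phi> \<mu> K"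
  by (simp add: permanental_def imm_process_def permanent_kernel_mat)

text \<open>A probability measure on a countable discrete space is carried by its atoms, which is
  the condition that defines the type \<open>pmf\<close>.\<close>

lemma ex_law_pmf:
  fixes X :: "'w \<Rightarrow> nat"
  assumes "prob_space M" and X: "X \<in> measurable M (count_space UNIV)"
  shows "\<exists>p. measure_pmf p = distr M (count_space UNIV) X"
proof -
  interpret D: prob_space "distr M (count_space UNIV) X"
    using assms by (rule prob_space.prob_space_distr)
  have "AE x in distr M (count_space UNIV) X. measure (distr M (count_space UNIV) X) {x} \<noteq> 0"
    using D.AE_support_countable by (auto intro!: exI[of _ UNIV])
  then show ?thesis
    by (intro exI[of _ "Abs_pmf (distr M (count_space UNIV) X)"] Abs_pmf_inverse)
      (simp add: D.prob_space_axioms)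
qed

lemma emeasure_restrict_process:
  assumes "point_process M \<Phi>" "\<omega> \<in> space M" "D \<in> sets borel" "B \<in> sets borel"
  shows "emeasure (restrict_process D \<Phi> \<omega>) B = emeasure (\<Phi> \<omega>) (D \<inter> B)"
proof -
  have s: "sets (\<Phi> \<omega>) = sets borel"
    using assms(1,2) by (simp add: point_process_def counting_measure_def)
  have D: "D \<in> sets (\<Phi> \<omega>)" and B: "B \<in> sets (\<Phi> \<omega>)" using assms(3,4) s by simp_all
  have "emeasure (restrict_process D \<Phi> \<omega>) B = (\<integral>\<^sup>+x. indicator D x * indicator B x \<partial>\<Phi> \<omega>)"
    unfolding restrict_process_def using D B by (intro emeasure_density) auto
  also have "\<dots> = (\<integral>\<^sup>+x. indicator (D \<inter> B) x \<partial>\<Phi> \<omega>)"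
    by (simp add: indicator_inter_arith)
  also have "\<dots> = emeasure (\<Phi> \<omega>) (D \<inter> B)"
    using D B by simp
  finally show ?thesis .
qed

context mercer_kernel
begin

lemma imm_process_joint_intensity:
  assumes "imm_process b M \<Phi> \<mu> K" "1 \<le> k"
  obtains \<rho> where "joint_intensity M \<Phi> \<mu> k \<rho>"
    "AE x in (\<Pi>\<^sub>M i\<in>{..<k}. \<mu>). ennreal (\<rho> x) = ennreal (Re (immK b k x))"
proof -
  have "\<exists>\<rho>. joint_intensity M \<Phi> \<mu> k \<rho> \<and>
      (AE x in (\<Pi>\<^sub>M i\<in>{..<k}. \<mu>). complex_of_real (\<rho> x) = immK b k x)"
    using assms by (simp add: imm_process_def immK_def)
  then obtain \<rho> where \<rho>: "joint_intensity M \<Phi> \<mu> k \<rho>"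
    "AE x in (\<Pi>\<^sub>M i\<in>{..<k}. \<mu>). complex_of_real (\<rho> x) = immK b k x"
    by (elim exE conjE)
  have "AE x in (\<Pi>\<^sub>M i\<in>{..<k}. \<mu>). ennreal (\<rho> x) = ennreal (Re (immK b k x))"
    using \<rho>(2) by eventually_elim (metis Re_complex_of_real)
  with \<rho>(1) that show ?thesis by blast
qed

text \<open>A 1 by 1 determinant or permanent is its entry, so the first intensity is the diagonal
  of the kernel.\<close>

lemma mean_eq_diag:
  assumes "imm_process b M \<Phi> \<mu> K" and B: "B \<in> sets borel" "bounded B"
  shows "(\<integral>\<^sup>+\<omega>. emeasure (\<Phi> \<omega>) B \<partial>M) = (\<integral>\<^sup>+x. diag x * indicator B x \<partial>\<mu>)"
proof -
  obtain \<rho> where \<rho>: "joint_intensity M \<Phi> \<mu> 1 \<rho>"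
    "AE x in (\<Pi>\<^sub>M i\<in>{..<1::nat}. \<mu>). ennreal (\<rho> x) = ennreal (Re (immK b 1 x))"
    using imm_process_joint_intensity[OF assms(1), of 1] by auto
  have one: "{..<1::nat} = {0}" by auto
  have "(\<integral>\<^sup>+\<omega>. emeasure (\<Phi> \<omega>) B \<partial>M) = (\<integral>\<^sup>+\<omega>. (\<Prod>i<(1::nat). emeasure (\<Phi> \<omega>) ((\<lambda>_. B) i)) \<partial>M)"
    by (simp add: one)
  also have "\<dots> = (\<integral>\<^sup>+x\<in>{..<1::nat} \<rightarrow>\<^sub>E B. ennreal (\<rho> x) \<partial>(\<Pi>\<^sub>M i\<in>{..<1::nat}. \<mu>))"
    using \<rho>(1) B unfolding joint_intensity_def by (auto simp: disjoint_family_on_def)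
  also have "\<dots> = (\<integral>\<^sup>+x. diag (x 0) * indicator B (x 0) \<partial>(\<Pi>\<^sub>M i\<in>{..<1::nat}. \<mu>))"
  proof (rule nn_integral_cong_AE)
    show "AE x in (\<Pi>\<^sub>M i\<in>{..<1::nat}. \<mu>). ennreal (\<rho> x) * indicator ({..<1::nat} \<rightarrow>\<^sub>E B) x =
        diag (x 0) * indicator B (x 0)"
      using \<rho>(2) AE_PiM_good[of 1] AE_space
    proof eventually_elim
      case (elim x)
      then have g: "good (x 0)" by simp
      have "immK b 1 x = K (x 0) (x 0)"
        unfolding immK_def imm_def one by (simp add: permutes_sing wsign_def del: lessThan_0 lessThan_Suc)
      moreover have "(indicator ({..<1::nat} \<rightarrow>\<^sub>E B) x :: ennreal) = indicator B (x 0)"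
        using elim(3) by (auto simp: indicator_def space_PiM PiE_iff one)
      ultimately show ?case using elim(1) K_diag(3)[OF g] by simp
    qed
  qed
  also have "\<dots> = (\<integral>\<^sup>+x. diag x * indicator B x \<partial>\<mu>)"
    unfolding one using diag_meas B
    by (intro product_nn_integral_singleton borel_imp_meas borel_measurable_times_ennreal
        borel_measurable_indicator)
  finally show ?thesis .
qed

lemma diag_integral_D: "(\<integral>\<^sup>+x. diag x * indicator D x \<partial>\<mu>) = ennreal (\<Sum>j. l j)"
proof -
  have "(\<integral>\<^sup>+x. diag x * indicator D x \<partial>\<mu>) = (\<integral>\<^sup>+x. diag x \<partial>\<mu>)"
  proof (rule nn_integral_cong_AE)
    show "AE x in \<mu>. diag x * indicator D x = diag x"
      using AE_good
      by eventually_elim (use K_diag(3) K_out in \<open>auto simp: indicator_def\<close>)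
  qed
  then show ?thesis by (simp add: diag_integral)
qed

text \<open>Fubini writes the product of the means as an integral of the product of diagonal entries
  over the same box; \<open>immK_compare\<close> then applies under the integral.\<close>

lemma moment_prod_compare:
  fixes k :: nat and B :: "nat \<Rightarrow> 'a set"
  assumes ip: "imm_process b M \<Phi> \<mu> K" and k: "1 \<le> k"
    and B: "\<And>i. i < k \<Longrightarrow> B i \<in> sets borel" "\<And>i. i < k \<Longrightarrow> bounded (B i)"
    and disj: "disjoint_family_on B {..<k}"
  shows "b \<Longrightarrow> (\<integral>\<^sup>+\<omega>. (\<Prod>i<k. emeasure (\<Phi> \<omega>) (B i)) \<partial>M) \<le> (\<Prod>i<k. \<integral>\<^sup>+\<omega>. emeasure (\<Phi> \<omega>) (B i) \<partial>M)"
    and "\<not> b \<Longrightarrow> (\<Prod>i<k. \<integral>\<^sup>+\<omega>. emeasure (\<Phi> \<omega>) (B i) \<partial>M) \<le> (\<integral>\<^sup>+\<omega>. (\<Prod>i<k. emeasure (\<Phi> \<omega>) (B i)) \<partial>M)"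
proof -
  let ?P = "\<Pi>\<^sub>M i\<in>{..<k}. \<mu>"
  obtain \<rho> where \<rho>: "joint_intensity M \<Phi> \<mu> k \<rho>"
    "AE x in ?P. ennreal (\<rho> x) = ennreal (Re (immK b k x))"
    using imm_process_joint_intensity[OF ip k] .
  have 1: "(\<integral>\<^sup>+\<omega>. (\<Prod>i<k. emeasure (\<Phi> \<omega>) (B i)) \<partial>M) = (\<integral>\<^sup>+x\<in>PiE {..<k} B. ennreal (\<rho> x) \<partial>?P)"
    using \<rho>(1) B disj unfolding joint_intensity_def by simp
  have "(\<Prod>i<k. \<integral>\<^sup>+\<omega>. emeasure (\<Phi> \<omega>) (B i) \<partial>M) = (\<Prod>i<k. \<integral>\<^sup>+x. diag x * indicator (B i) x \<partial>\<mu>)"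
    using B by (intro prod.cong refl mean_eq_diag[OF ip]) auto
  also have "\<dots> = (\<integral>\<^sup>+x. (\<Prod>i<k. diag (x i) * indicator (B i) (x i)) \<partial>?P)"
    using B diag_meas
    by (intro product_nn_integral_prod[symmetric] borel_imp_meas) auto
  also have "\<dots> = (\<integral>\<^sup>+x\<in>PiE {..<k} B. ennreal (\<Prod>i<k. Re (K (x i) (x i))) \<partial>?P)"
  proof (rule nn_integral_cong_AE)
    show "AE x in ?P. (\<Prod>i<k. diag (x i) * indicator (B i) (x i)) =
        ennreal (\<Prod>i<k. Re (K (x i) (x i))) * indicator (PiE {..<k} B) x"
      using AE_PiM_good[of k] AE_space
    proof eventually_elim
      case (elim x)
      have "(\<Prod>i<k. diag (x i)) = (\<Prod>i<k. ennreal (Re (K (x i) (x i))))"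
        using elim(1) by (intro prod.cong refl K_diag(3)) auto
      also have "\<dots> = ennreal (\<Prod>i<k. Re (K (x i) (x i)))"
        using elim(1) K_diag(2) by (intro prod_ennreal) auto
      finally have d: "(\<Prod>i<k. diag (x i)) = ennreal (\<Prod>i<k. Re (K (x i) (x i)))" .
      have "(\<Prod>i<k. indicator (B i) (x i)) = (indicator (PiE {..<k} B) x :: ennreal)"
      proof (cases "x \<in> PiE {..<k} B")
        case True
        then have "x i \<in> B i" if "i < k" for i using that by (auto simp: PiE_iff)
        then show ?thesis using True by simp
      next
        case False
        then obtain i where "i < k" "x i \<notin> B i"
          using elim(2) by (auto simp: space_PiM PiE_iff)
        then have "(\<Prod>i<k. indicator (B i) (x i)) = (0::ennreal)"
          by (intro prod_zero bexI[of _ i]) auto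
        then show ?thesis using False by simp
      qed
      then show ?case using d by (simp add: prod.distrib)
    qed
  qed
  finally have 2: "(\<Prod>i<k. \<integral>\<^sup>+\<omega>. emeasure (\<Phi> \<omega>) (B i) \<partial>M) =
      (\<integral>\<^sup>+x\<in>PiE {..<k} B. ennreal (\<Prod>i<k. Re (K (x i) (x i))) \<partial>?P)" .
  show "(\<integral>\<^sup>+\<omega>. (\<Prod>i<k. emeasure (\<Phi> \<omega>) (B i)) \<partial>M) \<le> (\<Prod>i<k. \<integral>\<^sup>+\<omega>. emeasure (\<Phi> \<omega>) (B i) \<partial>M)" if b
    unfolding 1 2
  proof (rule nn_integral_mono_AE)
    show "AE x in ?P. ennreal (\<rho> x) * indicator (PiE {..<k} B) x \<le>
        ennreal (\<Prod>i<k. Re (K (x i) (x i))) * indicator (PiE {..<k} B) x"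
      using \<rho>(2) AE_PiM_good[of k]
    proof eventually_elim
      case (elim x)
      have "ennreal (\<rho> x) \<le> ennreal (\<Prod>i<k. Re (K (x i) (x i)))"
        unfolding elim(1) using immK_compare(2)[OF elim(2)] that by (intro ennreal_leI) simp
      then show ?case by (rule mult_right_mono) simp
    qed
  qed
  show "(\<Prod>i<k. \<integral>\<^sup>+\<omega>. emeasure (\<Phi> \<omega>) (B i) \<partial>M) \<le> (\<integral>\<^sup>+\<omega>. (\<Prod>i<k. emeasure (\<Phi> \<omega>) (B i)) \<partial>M)" if "\<not> b"
    unfolding 1 2
  proof (rule nn_integral_mono_AE)
    show "AE x in ?P. ennreal (\<Prod>i<k. Re (K (x i) (x i))) * indicator (PiE {..<k} B) x \<le>
        ennreal (\<rho> x) * indicator (PiE {..<k} B) x"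
      using \<rho>(2) AE_PiM_good[of k]
    proof eventually_elim
      case (elim x)
      have "ennreal (\<Prod>i<k. Re (K (x i) (x i))) \<le> ennreal (\<rho> x)"
        unfolding elim(1) using immK_compare(3)[OF elim(2)] that by (intro ennreal_leI) simp
      then show ?case by (rule mult_right_mono) simp
    qed
  qed
qed

text \<open>The factorial moment is the integral of the intensity over tuples in \<open>D\<close>.
  The kernel vanishes outside \<open>D\<close>, so this is the full integral, known as a limit over
  truncations.\<close>

lemma bmom_law:
  assumes ip: "imm_process b M \<Phi> \<mu> K" and D: "D \<in> sets borel" "bounded D"
    and p: "measure_pmf p = distr M (count_space UNIV) (npoints \<Phi> D)"
  shows "(\<lambda>n. ennreal (sym_fun b l n k)) \<longlonglongrightarrow> bmom p k"
proof -
  have simple: "simple_point_process M \<Phi>" using ip by (simp add: imm_process_def)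
  then have pp: "point_process M \<Phi>" by (simp add: simple_point_process_def)
  note X = npoints_measurable[OF pp D(1)]
  have "ennreal (fact k) * bmom p k = (SUP n. ennreal (fact k * sym_fun b l n k))"
  \<comment> \<open>Intensities are given for \<open>k \<ge> 1\<close> only; for
    \<open>k = 0\<close> both sides are 1.\<close>
  proof (cases "k = 0")
    case True
    have "sym_fun b l n 0 = 1" for n by (induction n) (auto simp: sym_coeff_def)
    then show ?thesis using True by (simp add: bmom_def)
  next
    case False
    then have k: "1 \<le> k" by simp
    obtain \<rho> where \<rho>: "joint_intensity M \<Phi> \<mu> k \<rho>"
      "AE x in (\<Pi>\<^sub>M i\<in>{..<k}. \<mu>). ennreal (\<rho> x) = ennreal (Re (immK b k x))"
      using imm_process_joint_intensity[OF ip k] .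
    have "ennreal (fact k) * bmom p k = (\<integral>\<^sup>+x. of_nat (fact k * (x choose k)) \<partial>measure_pmf p)"
      unfolding bmom_def by (subst nn_integral_cmult[symmetric])
        (auto simp: ennreal_of_nat_eq_real_of_nat simp flip: ennreal_mult)
    also have "\<dots> = (\<integral>\<^sup>+\<omega>. of_nat (fact k * (npoints \<Phi> D \<omega> choose k)) \<partial>M)"
      unfolding p by (rule nn_integral_distr[OF X]) simp
    also have "\<dots> = (\<integral>\<^sup>+x\<in>{..<k} \<rightarrow>\<^sub>E D. ennreal (\<rho> x) \<partial>(\<Pi>\<^sub>M i\<in>{..<k}. \<mu>))"
      by (rule factorial_moment_eq[OF simple \<rho>(1) sets_\<mu> D])
    also have "\<dots> = (\<integral>\<^sup>+x. ennreal (Re (immK b k x)) \<partial>(\<Pi>\<^sub>M i\<in>{..<k}. \<mu>))"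
    proof (rule nn_integral_cong_AE)
      show "AE x in (\<Pi>\<^sub>M i\<in>{..<k}. \<mu>). ennreal (\<rho> x) * indicator ({..<k} \<rightarrow>\<^sub>E D) x = ennreal (Re (immK b k x))"
        using \<rho>(2) AE_space
      proof eventually_elim
        case (elim x)
        show ?case
        proof (cases "x \<in> {..<k} \<rightarrow>\<^sub>E D")
          case False
          then obtain i where "i < k" "x i \<notin> D"
            using elim(2) by (auto simp: space_PiM PiE_iff)
          then show ?thesis using False immK_out[of i k x b] by simp
        qed (simp add: elim)
      qed
    qed
    finally show ?thesis by (simp add: immK_nn_integral)
  qed
  moreover have "(\<lambda>n. ennreal (fact k * sym_fun b l n k)) \<longlonglongrightarrow> (SUP n. ennreal (fact k * sym_fun b l n k))"
    unfolding immT_nn_integral[symmetric]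
    by (intro LIMSEQ_SUP incseq_SucI nn_integral_mono ennreal_leI immT_mono)
  ultimately have "(\<lambda>n. ennreal (fact k * sym_fun b l n k)) \<longlonglongrightarrow> ennreal (fact k) * bmom p k" by simp
  then have "(\<lambda>n. ennreal (1 / fact k) * ennreal (fact k * sym_fun b l n k)) \<longlonglongrightarrow>
      ennreal (1 / fact k) * (ennreal (fact k) * bmom p k)"
    by (intro ennreal_tendsto_cmult) auto
  moreover have "ennreal (1 / fact k) * ennreal (fact k * sym_fun b l n k) = ennreal (sym_fun b l n k)" for n
    using sym_fun_nonneg[where l = l and b = b and n = n and k = k, OF l_nonneg] by (simp flip: ennreal_mult)
  moreover have "ennreal (1 / fact k) * (ennreal (fact k) * bmom p k) = bmom p k"
    by (simp flip: mult.assoc ennreal_mult)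
  ultimately show ?thesis by simp
qed

text \<open>\<open>P n\<close> and \<open>Q n\<close> are the laws of the first \<open>n\<close>
  independent weights and of the corresponding Poisson variables, added up. They are ordered summand
  by summand, and their binomial moments, bounded by powers of the trace \<open>L\<close>, converge
  to those of the two laws in question.\<close>

lemma put_compare_law:
  assumes ip: "imm_process b M \<Phi> \<mu> K" and D: "D \<in> sets borel" "bounded D"
    and p: "measure_pmf p = distr M (count_space UNIV) (npoints \<Phi> D)"
    and le1: "\<And>j. b \<Longrightarrow> l j \<le> 1"
  shows "b \<Longrightarrow> put_le p (Poi (\<Sum>j. l j))" "\<not> b \<Longrightarrow> put_le (Poi (\<Sum>j. l j)) p"
    and "\<And>k. bmom p k \<le> ennreal ((\<Sum>j. l j) ^ k)"
proof -
  define L where "L = (\<Sum>j. l j)"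
  have sL: "(\<Sum>j<n. l j) \<le> L" "0 \<le> (\<Sum>j<n. l j)" for n
    unfolding L_def using l_summable l_nonneg by (auto intro!: sum_le_suminf sum_nonneg)
  then have L: "0 \<le> L" using order_trans by blast
  define P where "P = sum_law (\<lambda>j. weight_pmf b (l j))"
  define Q where "Q = sum_law (\<lambda>j. Poi (l j))"
  have P: "bmom (P n) k = ennreal (sym_fun b l n k)" for n k
    unfolding P_def using l_nonneg le1 by (rule bmom_sum_law)
  have Q: "bmom (Q n) k = ennreal ((\<Sum>j<n. l j) ^ k / fact k)" for n k
    unfolding Q_def using l_nonneg by (rule bmom_Poi_sum_law)
  have PL: "bmom (P n) k \<le> ennreal (L ^ k)" for n k
    unfolding P using sym_fun_le_power[where l = l and b = b and n = n and k = k, OF l_nonneg] power_mono[OF sL(1)[of n] sL(2)[of n], of k]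
    by (intro ennreal_leI) linarith
  have divle: "a / fact k \<le> a" if "0 \<le> a" for a :: real and k
    using that by (simp add: divide_le_eq mult_le_cancel_left1)
  have QL: "bmom (Q n) k \<le> ennreal (L ^ k)" for n k
    unfolding Q using divle[of "(\<Sum>j<n. l j) ^ k" k] power_mono[OF sL(1)[of n] sL(2)[of n], of k] sL(2)
    by (intro ennreal_leI) (meson order_trans zero_le_power)
  have pl: "(\<lambda>n. bmom (P n) k) \<longlonglongrightarrow> bmom p k" for k
    unfolding P by (rule bmom_law[OF ip D p])
  show pL: "bmom p k \<le> ennreal ((\<Sum>j. l j) ^ k)" for k
    using LIMSEQ_le_const2[OF pl[of k]] PL unfolding L_def by blast
  have ql: "(\<lambda>n. bmom (Q n) k) \<longlonglongrightarrow> bmom (Poi L) k" for k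
    unfolding Q bmom_Poi[OF L] using summable_LIMSEQ[OF l_summable]
    by (intro tendsto_ennrealI tendsto_divide tendsto_power) (auto simp: L_def)
  have qL: "bmom (Poi L) k \<le> ennreal (L ^ k)" for k
    unfolding bmom_Poi[OF L] using divle L by (intro ennreal_leI) auto
  have pm: "(\<lambda>n. pmf (P n) m) \<longlonglongrightarrow> pmf p m" for m
    by (rule pmf_tendsto_of_bmom_tendsto[OF PL _ L pl]) (use pL in \<open>simp add: L_def\<close>)
  have qm: "(\<lambda>n. pmf (Q n) m) \<longlonglongrightarrow> pmf (Poi L) m" for m
    by (rule pmf_tendsto_of_bmom_tendsto[OF QL qL L ql])
  show "put_le p (Poi (\<Sum>j. l j))" if b
  proof (rule put_le_tendsto[OF pm qm, unfolded L_def])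
    show "put_le (P n) (Q n)" for n
      unfolding P_def Q_def using that le1 l_nonneg
      by (intro put_le_sum_law) (simp add: put_le_Bernoulli_Poi)
  qed
  show "put_le (Poi (\<Sum>j. l j)) p" if "\<not> b"
  proof (rule put_le_tendsto[OF qm pm, unfolded L_def])
    show "put_le (Q n) (P n)" for n
      unfolding P_def Q_def using that l_nonneg
      by (intro put_le_sum_law) (simp add: put_le_Poi_geometric)
  qed
qed

end

section \<open>Void probabilities\<close>

lemma mean_measure_borel: "point_process M \<Phi> \<Longrightarrow> B \<in> sets borel \<Longrightarrow> (\<lambda>\<omega>. emeasure (\<Phi> \<omega>) B) \<in> borel_measurable M"
  by (simp add: point_process_def)

lemma sets_point_process: "point_process M \<Phi> \<Longrightarrow> \<omega> \<in> space M \<Longrightarrow> sets (\<Phi> \<omega>) = sets borel"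
  by (simp add: point_process_def counting_measure_def)

lemma mean_measure_suminf:
  assumes pp: "point_process M \<Phi>" and A: "\<And>i. A i \<in> sets borel" "disjoint_family A"
  shows "mean_measure M \<Phi> (\<Union>i. A i) = (\<Sum>i. mean_measure M \<Phi> (A i))"
proof -
  have "mean_measure M \<Phi> (\<Union>i. A i) = (\<integral>\<^sup>+\<omega>. (\<Sum>i. emeasure (\<Phi> \<omega>) (A i)) \<partial>M)"
    unfolding mean_measure_def using A sets_point_process[OF pp]
    by (intro nn_integral_cong suminf_emeasure[symmetric]) auto
  also have "\<dots> = (\<Sum>i. mean_measure M \<Phi> (A i))"
    unfolding mean_measure_def by (intro nn_integral_suminf mean_measure_borel[OF pp] A)
  finally show ?thesis .
qed

lemma mean_measure_mono:
  assumes pp: "point_process M \<Phi>" and "A \<subseteq> B" "B \<in> sets borel"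
  shows "mean_measure M \<Phi> A \<le> mean_measure M \<Phi> B"
  unfolding mean_measure_def using assms sets_point_process[OF pp]
  by (intro nn_integral_mono emeasure_mono) auto

lemma mean_measure_diff:
  assumes pp: "point_process M \<Phi>" and "A \<subseteq> B" "A \<in> sets borel" "B \<in> sets borel"
  shows "mean_measure M \<Phi> B = mean_measure M \<Phi> A + mean_measure M \<Phi> (B - A)"
proof -
  have "mean_measure M \<Phi> B = (\<integral>\<^sup>+\<omega>. emeasure (\<Phi> \<omega>) A + emeasure (\<Phi> \<omega>) (B - A) \<partial>M)"
    unfolding mean_measure_def
  proof (rule nn_integral_cong)
    fix \<omega> assume "\<omega> \<in> space M"
    then show "emeasure (\<Phi> \<omega>) B = emeasure (\<Phi> \<omega>) A + emeasure (\<Phi> \<omega>) (B - A)"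
      using assms sets_point_process[OF pp] by (subst plus_emeasure) (auto simp: Un_absorb1)
  qed
  also have "\<dots> = mean_measure M \<Phi> A + mean_measure M \<Phi> (B - A)"
    unfolding mean_measure_def using mean_measure_borel[OF pp] assms by (intro nn_integral_add) auto
  finally show ?thesis .
qed

text \<open>Cut off by a ball that contains \<open>B\<close>, the mean measure is a finite Borel
  measure on a Euclidean space, hence inner regular with respect to compact sets.\<close>

lemma mean_measure_inner_regular:
  fixes \<Phi> :: "'w \<Rightarrow> 'a::euclidean_space measure"
  assumes pp: "point_process M \<Phi>" and fin: "\<And>C. compact C \<Longrightarrow> mean_measure M \<Phi> C < \<infinity>"
    and B: "B \<in> sets borel" "bounded B"
  shows "mean_measure M \<Phi> B = (SUP C\<in>{C. C \<subseteq> B \<and> compact C}. mean_measure M \<Phi> C)"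
proof -
  obtain r where "\<forall>x\<in>B. norm x \<le> r"
    using B(2) unfolding bounded_iff by (rule exE)
  then have r: "B \<subseteq> cball 0 r" by auto
  define N where "N = measure_of UNIV (sets borel) (\<lambda>A. mean_measure M \<Phi> (A \<inter> cball (0::'a) r))"
  have sigma: "sigma_algebra UNIV (sets (borel :: 'a measure))"
    using sets.sigma_algebra_axioms[of "borel :: 'a measure"] by simp
  have N_sets: "sets N = sets borel"
    unfolding N_def using sigma_algebra.sets_measure_of_eq[OF sigma] by simp
  have N_em: "emeasure N A = mean_measure M \<Phi> (A \<inter> cball 0 r)" if "A \<in> sets borel" for A
  proof (rule emeasure_measure_of_sigma[OF sigma, of "\<lambda>A. mean_measure M \<Phi> (A \<inter> cball 0 r)" A,
        folded N_def])
    show "positive (sets borel) (\<lambda>A. mean_measure M \<Phi> (A \<inter> cball (0::'a) r))"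
      by (simp add: positive_def mean_measure_def)
    show "countably_additive (sets borel) (\<lambda>A. mean_measure M \<Phi> (A \<inter> cball (0::'a) r))"
    proof (rule countably_additiveI)
      fix A :: "nat \<Rightarrow> 'a set"
      assume A: "range A \<subseteq> sets borel" "disjoint_family A" "(\<Union>i. A i) \<in> sets borel"
      have "mean_measure M \<Phi> (\<Union>i. A i \<inter> cball 0 r) = (\<Sum>i. mean_measure M \<Phi> (A i \<inter> cball 0 r))"
        using A by (intro mean_measure_suminf[OF pp]) (auto simp: disjoint_family_on_def)
      then show "(\<Sum>i. mean_measure M \<Phi> (A i \<inter> cball 0 r)) = mean_measure M \<Phi> ((\<Union>i. A i) \<inter> cball 0 r)"
        by (simp add: Int_UN_distrib2 flip: UN_simps)
    qed
  qed fact
  have "emeasure N (space N) \<noteq> \<infinity>"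
    using N_em[of UNIV] fin[of "cball 0 r"] sets_eq_imp_space_eq[OF N_sets] by simp
  then have sup: "emeasure N B = (SUP C\<in>{C. C \<subseteq> B \<and> compact C}. emeasure N C)"
    by (intro inner_regular N_sets B)
  have NB: "emeasure N B = mean_measure M \<Phi> B"
    using r B by (simp add: N_em Int_absorb2)
  have NC: "emeasure N C = mean_measure M \<Phi> C" if "C \<in> {C. C \<subseteq> B \<and> compact C}" for C
  proof -
    have "C \<inter> cball 0 r = C" using that r by auto
    moreover have "C \<in> sets borel" using that by (auto intro: borel_compact)
    ultimately show ?thesis using N_em[of C] by simp
  qed
  show ?thesis
    unfolding NB[symmetric] sup by (rule SUP_cong[OF refl NC])
qed

lemma UN_cball_nat: "(\<Union>n. cball (0::'a::euclidean_space) (real n)) = UNIV"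
proof (rule UNIV_eq_I[symmetric])
  fix x :: 'a
  obtain n where "norm x \<le> real n" using real_arch_simple by (rule exE)
  then show "x \<in> (\<Union>n. cball 0 (real n))" by (intro UN_I[of n]) simp_all
qed

lemma mean_measure_SUP_cball:
  fixes \<Phi> :: "'w \<Rightarrow> 'a::euclidean_space measure"
  assumes pp: "point_process M \<Phi>" and B: "B \<in> sets borel"
  shows "mean_measure M \<Phi> B = (SUP n. mean_measure M \<Phi> (B \<inter> cball 0 (real n)))"
proof -
  let ?B = "\<lambda>n. B \<inter> cball (0::'a) (real n)"
  have inc: "incseq ?B" by (auto simp: incseq_def)
  have U: "(\<Union>n. ?B n) = B"
    unfolding Int_UN_distrib[symmetric] UN_cball_nat by simp
  have "mean_measure M \<Phi> B = (\<integral>\<^sup>+\<omega>. (SUP n. emeasure (\<Phi> \<omega>) (?B n)) \<partial>M)"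
    unfolding mean_measure_def
  proof (rule nn_integral_cong)
    fix \<omega> assume \<omega>: "\<omega> \<in> space M"
    have "(SUP n. emeasure (\<Phi> \<omega>) (?B n)) = emeasure (\<Phi> \<omega>) (\<Union>n. ?B n)"
      by (rule SUP_emeasure_incseq[OF _ inc])
        (use B in \<open>simp add: image_subset_iff sets_point_process[OF pp \<omega>]\<close>)
    then show "emeasure (\<Phi> \<omega>) B = (SUP n. emeasure (\<Phi> \<omega>) (?B n))" using U by simp
  qed
  also have "\<dots> = (SUP n. \<integral>\<^sup>+\<omega>. emeasure (\<Phi> \<omega>) (?B n) \<partial>M)"
  proof (rule nn_integral_monotone_convergence_SUP_AE)
    show "AE \<omega> in M. emeasure (\<Phi> \<omega>) (?B i) \<le> emeasure (\<Phi> \<omega>) (?B (Suc i))" for i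
      using B sets_point_process[OF pp] by (intro AE_I2 emeasure_mono) auto
    show "(\<lambda>\<omega>. emeasure (\<Phi> \<omega>) (?B i)) \<in> borel_measurable M" for i
      using B by (intro mean_measure_borel[OF pp]) auto
  qed
  finally show ?thesis by (simp add: mean_measure_def)
qed

lemma void_event: "point_process M \<Phi> \<Longrightarrow> B \<in> sets borel \<Longrightarrow> {\<omega> \<in> space M. emeasure (\<Phi> \<omega>) B = 0} \<in> sets M"
  using measurable_sets[OF mean_measure_borel[of M \<Phi> B], of "{0}"]
  by (simp add: vimage_def Int_def conj_commute)

lemma void_prob_antimono:
  assumes pp: "point_process M \<Phi>" and "A \<subseteq> B" "A \<in> sets borel" "B \<in> sets borel"
  shows "void_prob M \<Phi> B \<le> void_prob M \<Phi> A"
proof -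
  interpret prob_space M using pp by (simp add: point_process_def)
  have "emeasure (\<Phi> \<omega>) A = 0" if "\<omega> \<in> space M" "emeasure (\<Phi> \<omega>) B = 0" for \<omega>
    using emeasure_mono[OF assms(2), of "\<Phi> \<omega>"] assms(4) sets_point_process[OF pp that(1)] that(2) by simp
  then show ?thesis
    unfolding void_prob_def by (intro finite_measure_mono void_event[OF pp] assms) auto
qed

text \<open>If \<open>A\<close> is void and \<open>B\<close> is not, the integer count of
  \<open>B - A\<close> is at least 1, so this event has probability at most the mean of that
  count.\<close>

lemma void_prob_diff:
  assumes pp: "point_process M \<Phi>" and "A \<subseteq> B" "A \<in> sets borel" "B \<in> sets borel" "bounded B"
  shows "ennreal (void_prob M \<Phi> A) \<le> ennreal (void_prob M \<Phi> B) + mean_measure M \<Phi> (B - A)"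
proof -
  interpret prob_space M using pp by (simp add: point_process_def)
  let ?V = "\<lambda>B. {\<omega> \<in> space M. emeasure (\<Phi> \<omega>) B = 0}"
  have "(\<integral>\<^sup>+\<omega>. indicator (?V A) \<omega> \<partial>M) \<le> (\<integral>\<^sup>+\<omega>. indicator (?V B) \<omega> + emeasure (\<Phi> \<omega>) (B - A) \<partial>M)"
  proof (rule nn_integral_mono)
    fix \<omega> assume \<omega>: "\<omega> \<in> space M"
    have plus: "emeasure (\<Phi> \<omega>) B = emeasure (\<Phi> \<omega>) A + emeasure (\<Phi> \<omega>) (B - A)"
      using assms sets_point_process[OF pp \<omega>] by (subst plus_emeasure) (auto simp: Un_absorb1)
    have "bounded (B - A)" using assms(5) by (rule bounded_subset) auto
    then have n: "emeasure (\<Phi> \<omega>) (B - A) = of_nat (npoints \<Phi> (B - A) \<omega>)"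
      using assms by (intro npoints_eq[OF pp \<omega>]) auto
    show "indicator (?V A) \<omega> \<le> (indicator (?V B) \<omega> + emeasure (\<Phi> \<omega>) (B - A) :: ennreal)"
    proof (cases "emeasure (\<Phi> \<omega>) A = 0 \<and> emeasure (\<Phi> \<omega>) B \<noteq> 0")
      case True
      then have "emeasure (\<Phi> \<omega>) (B - A) \<noteq> 0" using plus by simp
      then have "1 \<le> npoints \<Phi> (B - A) \<omega>" using n by (cases "npoints \<Phi> (B - A) \<omega>") auto
      then have "1 \<le> emeasure (\<Phi> \<omega>) (B - A)"
        unfolding n by (metis of_nat_1 of_nat_mono)
      then show ?thesis using True \<omega> by simp
    qed (auto simp: indicator_def)
  qed
  also have "\<dots> = emeasure M (?V B) + mean_measure M \<Phi> (B - A)"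
    unfolding mean_measure_def using void_event[OF pp] mean_measure_borel[OF pp] assms
    by (subst nn_integral_add) auto
  finally show ?thesis
    using void_event[OF pp] assms by (simp add: void_prob_def emeasure_eq_measure)
qed

text \<open>A void set has void compact subsets, so it suffices to take compact subsets of
  \<open>B\<close> whose means exceed any given \<open>r\<close> below the mean of \<open>B\<close>.
  If that mean is infinite, \<open>r\<close> grows without bound and the void probability is
  0.\<close>

lemma nu_weakly_sub_PoissonI:
  fixes \<Phi> :: "'w \<Rightarrow> 'a::euclidean_space measure"
  assumes pp: "point_process M \<Phi>" and fin: "\<And>C. compact C \<Longrightarrow> mean_measure M \<Phi> C < \<infinity>"
    and void: "\<And>C. compact C \<Longrightarrow> void_prob M \<Phi> C \<le> exp_minus (mean_measure M \<Phi> C)"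
  shows "nu_weakly_sub_Poisson M \<Phi>"
  unfolding nu_weakly_sub_Poisson_def
proof
  fix B :: "'a set" assume B: "B \<in> sets borel"
  have key: "void_prob M \<Phi> B \<le> exp (- r)" if r: "ennreal r < mean_measure M \<Phi> B" "0 \<le> r" for r
  proof -
    obtain n where n: "ennreal r < mean_measure M \<Phi> (B \<inter> cball 0 (real n))"
      using r unfolding mean_measure_SUP_cball[OF pp B] less_SUP_iff by auto
    have m: "B \<inter> cball 0 (real n) \<in> sets borel" "bounded (B \<inter> cball 0 (real n))" using B by auto
    obtain C where C: "C \<subseteq> B" "compact C" "ennreal r < mean_measure M \<Phi> C"
    proof -
      have "mean_measure M \<Phi> (B \<inter> cball 0 (real n)) =
          (SUP C\<in>{C. C \<subseteq> B \<inter> cball 0 (real n) \<and> compact C}. mean_measure M \<Phi> C)"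
        by (rule mean_measure_inner_regular[OF pp fin m])
      then obtain C where "C \<in> {C. C \<subseteq> B \<inter> cball 0 (real n) \<and> compact C}" "ennreal r < mean_measure M \<Phi> C"
        using n by (auto simp: less_SUP_iff)
      then show ?thesis using that by auto
    qed
    obtain c where c: "mean_measure M \<Phi> C = ennreal c" "0 \<le> c"
      using fin[OF C(2)] by (cases "mean_measure M \<Phi> C") auto
    then have "r < c" using C(3) r by (simp add: ennreal_less_iff)
    have "void_prob M \<Phi> B \<le> void_prob M \<Phi> C"
      using C B by (intro void_prob_antimono[OF pp]) (auto intro: borel_compact)
    also have "\<dots> \<le> exp (- c)" using void[OF C(2)] c by (simp add: exp_minus_def)
    also have "\<dots> \<le> exp (- r)" using \<open>r < c\<close> by simp
    finally show ?thesis .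
  qed
  have le1: "void_prob M \<Phi> B \<le> 1"
    using pp by (simp add: void_prob_def point_process_def prob_space.prob_le_1)
  show "void_prob M \<Phi> B \<le> exp_minus (mean_measure M \<Phi> B)"
  proof (cases "mean_measure M \<Phi> B")
    case top
    have "void_prob M \<Phi> B \<le> exp (- real n)" for n
      using key[of "real n"] top by simp
    moreover have "(\<lambda>n. exp (- real n)) \<longlonglongrightarrow> 0" by real_asymp
    ultimately have "void_prob M \<Phi> B \<le> 0" by (intro LIMSEQ_le_const) auto
    then show ?thesis using top by (simp add: exp_minus_def)
  next
    case (real a)
    have "void_prob M \<Phi> B \<le> exp (- a)"
    proof (cases "a = 0")
      case False
      have "void_prob M \<Phi> B \<le> exp (- (a - a / real (Suc n)))" for n
        using key[of "a - a / real (Suc n)"] real False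
        by (simp add: ennreal_less_iff divide_le_eq mult_le_cancel_left1)
      moreover have "(\<lambda>n. exp (- (a - a / real (Suc n)))) \<longlonglongrightarrow> exp (- a)" by real_asymp
      ultimately show ?thesis by (intro LIMSEQ_le_const) auto
    qed (use le1 in simp)
    then show ?thesis using real by (simp add: exp_minus_def)
  qed
qed

text \<open>Compact subsets are void more often than the set itself, so here the loss must be
  controlled: by \<open>void_prob_diff\<close> it is at most the mean of \<open>A - C\<close>.
  Unbounded sets follow from continuity from above along the void events of growing balls.\<close>

lemma nu_weakly_super_PoissonI:
  fixes \<Phi> :: "'w \<Rightarrow> 'a::euclidean_space measure"
  assumes pp: "point_process M \<Phi>" and fin: "\<And>C. compact C \<Longrightarrow> mean_measure M \<Phi> C < \<infinity>"
    and void: "\<And>C. compact C \<Longrightarrow> exp_minus (mean_measure M \<Phi> C) \<le> void_prob M \<Phi> C"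
  shows "nu_weakly_super_Poisson M \<Phi>"
  unfolding nu_weakly_super_Poisson_def
proof
  interpret prob_space M using pp by (simp add: point_process_def)
  fix B :: "'a set" assume B: "B \<in> sets borel"
  have anti: "exp_minus y \<le> exp_minus x" if "x \<le> y" for x y
    using that by (auto simp: exp_minus_def top_unique less_top intro: enn2real_mono)
  have bdd: "exp_minus (mean_measure M \<Phi> A) \<le> void_prob M \<Phi> A" if A: "A \<in> sets borel" "bounded A" for A
  proof (rule field_le_epsilon)
    fix e :: real assume e: "0 < e"
    have "mean_measure M \<Phi> (closure A) < \<infinity>" using A(2) by (intro fin) simp
    then have Afin: "mean_measure M \<Phi> A < \<infinity>"
      using mean_measure_mono[OF pp closure_subset[of A]] by (auto intro: le_less_trans)
    have "\<exists>C. C \<subseteq> A \<and> compact C \<and> mean_measure M \<Phi> A \<le> mean_measure M \<Phi> C + ennreal e"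
    \<comment> \<open>For mean 0 the empty set serves as \<open>C\<close>; a positive finite mean
      leaves room strictly below the supremum.\<close>
    proof (cases "mean_measure M \<Phi> A = 0")
      case False
      have "mean_measure M \<Phi> A - ennreal e < mean_measure M \<Phi> A"
        using False Afin e by (intro ennreal_between) (auto simp: zero_less_iff_neq_zero)
      also have "mean_measure M \<Phi> A = (SUP C\<in>{C. C \<subseteq> A \<and> compact C}. mean_measure M \<Phi> C)"
        by (rule mean_measure_inner_regular[OF pp fin A])
      finally obtain C where "C \<subseteq> A" "compact C" "mean_measure M \<Phi> A - ennreal e < mean_measure M \<Phi> C"
        unfolding less_SUP_iff by auto
      then show ?thesis
        by (intro exI[of _ C]) (auto simp: ennreal_minus_le_iff add.commute dest: less_imp_le)
    qed auto
    then obtain C where C: "C \<subseteq> A" "compact C" "mean_measure M \<Phi> A \<le> mean_measure M \<Phi> C + ennreal e" by blast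
    have Cb: "C \<in> sets borel" using C by (auto intro: borel_compact)
    have "mean_measure M \<Phi> C + mean_measure M \<Phi> (A - C) \<le> mean_measure M \<Phi> C + ennreal e"
      using C(3) mean_measure_diff[OF pp C(1) Cb A(1)] by simp
    then have d: "mean_measure M \<Phi> (A - C) \<le> ennreal e"
      using fin[OF C(2)] by (subst (asm) ennreal_add_left_cancel_le) auto
    have "exp_minus (mean_measure M \<Phi> A) \<le> exp_minus (mean_measure M \<Phi> C)"
      using A C by (intro anti mean_measure_mono[OF pp])
    also have "\<dots> \<le> void_prob M \<Phi> C" by (rule void[OF C(2)])
    also have "\<dots> \<le> void_prob M \<Phi> A + e"
    proof -
      have "ennreal (void_prob M \<Phi> C) \<le> ennreal (void_prob M \<Phi> A) + ennreal e"
        using void_prob_diff[OF pp C(1) Cb A] d by (meson add_left_mono order_trans)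
      also have "\<dots> = ennreal (void_prob M \<Phi> A + e)"
        using e by (simp add: void_prob_def)
      finally show ?thesis
        using e by (subst (asm) ennreal_le_iff) (simp_all add: void_prob_def add_nonneg_nonneg)
    qed
    finally show "exp_minus (mean_measure M \<Phi> A) \<le> void_prob M \<Phi> A + e" .
  qed
  let ?B = "\<lambda>n. B \<inter> cball (0::'a) (real n)"
  let ?V = "\<lambda>n. {\<omega> \<in> space M. emeasure (\<Phi> \<omega>) (?B n) = 0}"
  have Bm: "?B n \<in> sets borel" for n using B by auto
  have V: "(\<Inter>n. ?V n) = {\<omega> \<in> space M. emeasure (\<Phi> \<omega>) B = 0}"
  proof (rule Set.set_eqI)
    fix \<omega>
    have "(\<forall>n. emeasure (\<Phi> \<omega>) (?B n) = 0) \<longleftrightarrow> emeasure (\<Phi> \<omega>) B = 0" if \<omega>: "\<omega> \<in> space M"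
    proof -
      have "(SUP n. emeasure (\<Phi> \<omega>) (?B n)) = emeasure (\<Phi> \<omega>) (\<Union>n. ?B n)"
        by (rule SUP_emeasure_incseq)
          (auto simp: image_subset_iff sets_point_process[OF pp \<omega>] incseq_def intro: Bm)
      also have "(\<Union>n. ?B n) = B" unfolding Int_UN_distrib[symmetric] UN_cball_nat by simp
      finally show ?thesis
        by (metis (no_types, lifting) SUP_eq_const SUP_upper UNIV_I UNIV_not_empty le_zero_eq)
    qed
    then show "\<omega> \<in> (\<Inter>n. ?V n) \<longleftrightarrow> \<omega> \<in> {\<omega> \<in> space M. emeasure (\<Phi> \<omega>) B = 0}" by auto
  qed
  have "decseq ?V"
  proof (rule decseq_SucI, rule subsetI)
    fix n \<omega> assume *: "\<omega> \<in> ?V (Suc n)"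
    have "emeasure (\<Phi> \<omega>) (?B n) \<le> emeasure (\<Phi> \<omega>) (?B (Suc n))"
      using * Bm[of "Suc n"] sets_point_process[OF pp, of \<omega>] by (intro emeasure_mono) auto
    then show "\<omega> \<in> ?V n" using * by simp
  qed
  then have "(\<lambda>n. measure M (?V n)) \<longlonglongrightarrow> measure M (\<Inter>n. ?V n)"
    using void_event[OF pp Bm] by (intro finite_Lim_measure_decseq) auto
  then have lim: "(\<lambda>n. void_prob M \<Phi> (?B n)) \<longlonglongrightarrow> void_prob M \<Phi> B"
    unfolding V by (simp add: void_prob_def)
  have "exp_minus (mean_measure M \<Phi> B) \<le> void_prob M \<Phi> (?B n)" for n
  proof -
    have "exp_minus (mean_measure M \<Phi> B) \<le> exp_minus (mean_measure M \<Phi> (?B n))"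
      using B by (intro anti mean_measure_mono[OF pp]) auto
    also have "\<dots> \<le> void_prob M \<Phi> (?B n)" by (intro bdd Bm) auto
    finally show ?thesis .
  qed
  then show "exp_minus (mean_measure M \<Phi> B) \<le> void_prob M \<Phi> B"
    by (intro LIMSEQ_le_const[OF lim]) auto
qed

section \<open>The number of points in a compact set\<close>

context mercer_kernel
begin

text \<open>The condition \<open>bad\<close> reflects that \<open>infsum\<close> is 0 for a family
  that is not summable. As \<open>enn2real\<close> sends infinity to 0, the diagonal of the kernel
  agrees with \<open>enn2real (diag x)\<close> at every point.\<close>

lemma diag_K_integral:
  assumes bad: "\<And>x. \<not> summable (\<lambda>j. (cmod (w j x))\<^sup>2) \<Longrightarrow> K x x = 0" and D: "D \<in> sets borel"
  shows "set_integrable \<mu> D (\<lambda>x. K x x)" "(LINT x:D|\<mu>. K x x) = of_real (\<Sum>j. l j)"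
proof -
  have K: "K x x = of_real (enn2real (diag x))" for x
  proof (cases "good x")
    case True
    then show ?thesis using K_diag[OF True] by (simp add: complex_eq_iff)
  next
    case False
    then show ?thesis using bad[of x] good_iff[of x] by (simp add: good_def)
  qed
  have KD: "indicator D x *\<^sub>R K x x = of_real (enn2real (diag x))" for x
    using K[of x] K_out[of x x] by (simp add: indicator_def)
  have nn: "(\<integral>\<^sup>+x. ennreal (enn2real (diag x)) \<partial>\<mu>) = ennreal (\<Sum>j. l j)"
  proof -
    have "(\<integral>\<^sup>+x. ennreal (enn2real (diag x)) \<partial>\<mu>) = (\<integral>\<^sup>+x. diag x \<partial>\<mu>)"
    proof (rule nn_integral_cong_AE)
      show "AE x in \<mu>. ennreal (enn2real (diag x)) = diag x"
        using AE_good by eventually_elim (simp add: good_iff less_top)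
    qed
    then show ?thesis by (simp add: diag_integral)
  qed
  have m: "(\<lambda>x. enn2real (diag x)) \<in> borel_measurable \<mu>"
    using borel_imp_meas[OF diag_meas] by measurable
  have L: "0 \<le> (\<Sum>j. l j)" by (intro suminf_nonneg l_summable l_nonneg)
  have i: "has_bochner_integral \<mu> (\<lambda>x. enn2real (diag x)) (\<Sum>j. l j)"
    by (intro has_bochner_integral_nn_integral m) (use nn L in auto)
  then show "set_integrable \<mu> D (\<lambda>x. K x x)"
    unfolding set_integrable_def KD by (intro integrable_of_real) (rule integrable.intros)
  show "(LINT x:D|\<mu>. K x x) = of_real (\<Sum>j. l j)"
    unfolding set_lebesgue_integral_def KD using i by (simp add: has_bochner_integral_iff)
qed

text \<open>The intensities belong to the restriction of the process to \<open>D\<close>, which has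
  the same count on \<open>D\<close>; all claims are transferred to the law \<open>p\<close> of that
  count. Its mean is the trace, as for the Poisson law, which the passage from puts to convex
  functions requires.\<close>

lemma process_on_compact:
  assumes D: "compact D" and pp: "point_process M \<Phi>"
    and ip: "imm_process b M (restrict_process D \<Phi>) \<mu> K" and le1: "\<And>j. b \<Longrightarrow> l j \<le> 1"
  shows "mean_measure M \<Phi> D = ennreal (\<Sum>j. l j)"
    and "b \<Longrightarrow> void_prob M \<Phi> D \<le> exp (- (\<Sum>j. l j))"
    and "\<not> b \<Longrightarrow> exp (- (\<Sum>j. l j)) \<le> void_prob M \<Phi> D"
    and "b \<Longrightarrow> convex_order M (\<lambda>\<omega>. measure (\<Phi> \<omega>) D) (measure_pmf (Poi (\<Sum>j. l j))) real"
    and "\<not> b \<Longrightarrow> convex_order (measure_pmf (Poi (\<Sum>j. l j))) real M (\<lambda>\<omega>. measure (\<Phi> \<omega>) D)"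
proof -
  define L where "L = (\<Sum>j. l j)"
  have L: "0 \<le> L" unfolding L_def by (intro suminf_nonneg l_summable l_nonneg)
  have Db: "D \<in> sets borel" "bounded D"
    using D by (auto intro: borel_compact compact_imp_bounded)
  have r: "emeasure (restrict_process D \<Phi> \<omega>) D = emeasure (\<Phi> \<omega>) D" if "\<omega> \<in> space M" for \<omega>
    using emeasure_restrict_process[OF pp that Db(1) Db(1)] by simp
  let ?X = "npoints \<Phi> D"
  note X = npoints_measurable[OF pp Db(1)]
  have PM: "prob_space M" using pp by (simp add: point_process_def)
  obtain p where p: "measure_pmf p = distr M (count_space UNIV) ?X"
    using ex_law_pmf[OF PM X] by (rule exE)
  have "distr M (count_space UNIV) (npoints (restrict_process D \<Phi>) D) = distr M (count_space UNIV) ?X"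
    by (rule distr_cong) (auto simp: npoints_def measure_def r)
  then have p': "measure_pmf p = distr M (count_space UNIV) (npoints (restrict_process D \<Phi>) D)"
    using p by simp
  have mean: "mean_measure M \<Phi> D = ennreal L"
  proof -
    have "mean_measure M \<Phi> D = (\<integral>\<^sup>+\<omega>. emeasure (restrict_process D \<Phi> \<omega>) D \<partial>M)"
      unfolding mean_measure_def by (rule nn_integral_cong) (simp add: r)
    also have "\<dots> = ennreal L"
      unfolding mean_eq_diag[OF ip Db] diag_integral_D L_def ..
    finally show ?thesis .
  qed
  then show "mean_measure M \<Phi> D = ennreal (\<Sum>j. l j)" by (simp add: L_def)
  have b1: "bmom p 1 = ennreal L"
  proof -
    have "bmom p 1 = (\<integral>\<^sup>+\<omega>. of_nat (?X \<omega>) \<partial>M)"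
      unfolding bmom_def p using X by (subst nn_integral_distr) auto
    also have "\<dots> = mean_measure M \<Phi> D"
      unfolding mean_measure_def by (rule nn_integral_cong) (simp add: npoints_eq(1)[OF pp _ Db])
    finally show ?thesis by (simp add: mean)
  qed
  have pint: "integrable (measure_pmf p) real"
    using bmom_real(1)[of p 1 L] b1 by simp
  have "ennreal (measure_pmf.expectation p real) = ennreal L"
    using bmom_real(2)[of p 1 L] b1 by simp
  then have pmean: "measure_pmf.expectation p real = L"
    using L by (subst (asm) ennreal_inj) auto
  note put = put_compare_law[OF ip Db p' le1, folded L_def]
  have void: "void_prob M \<Phi> D = pmf p 0"
  proof -
    have "pmf p 0 = measure M (?X -` {0} \<inter> space M)"
      unfolding pmf.rep_eq p using X by (subst measure_distr) auto
    also have "?X -` {0} \<inter> space M = {\<omega> \<in> space M. emeasure (\<Phi> \<omega>) D = 0}"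
      using npoints_eq(1)[OF pp _ Db] by auto
    finally show ?thesis by (simp add: void_prob_def)
  qed
  have Poi0: "pmf (Poi L) 0 = exp (- L)" using L by (simp add: pmf_Poi)
  show "void_prob M \<Phi> D \<le> exp (- (\<Sum>j. l j))" if b
    using put_le_pmf_0[OF put(1)[OF _ that]] that by (simp add: void Poi0 flip: L_def)
  show "exp (- (\<Sum>j. l j)) \<le> void_prob M \<Phi> D" if "\<not> b"
    using put_le_pmf_0[OF put(2)[OF _ that]] that by (simp add: void Poi0 flip: L_def)
  have meq: "measure (\<Phi> \<omega>) D = real (?X \<omega>)" if "\<omega> \<in> space M" for \<omega>
    using npoints_eq(2)[OF pp that Db] .
  have tr: "integrable M (\<lambda>\<omega>. f (measure (\<Phi> \<omega>) D)) \<longleftrightarrow> integrable (measure_pmf p) (\<lambda>x. f (real x))"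
    "(LINT \<omega>|M. f (measure (\<Phi> \<omega>) D)) = measure_pmf.expectation p (\<lambda>x. f (real x))" for f :: "real \<Rightarrow> real"
  proof -
    have "integrable M (\<lambda>\<omega>. f (measure (\<Phi> \<omega>) D)) \<longleftrightarrow> integrable M (\<lambda>\<omega>. f (real (?X \<omega>)))"
      by (rule Bochner_Integration.integrable_cong) (simp_all add: meq)
    also have "\<dots> \<longleftrightarrow> integrable (measure_pmf p) (\<lambda>x. f (real x))"
      unfolding p by (rule integrable_distr_eq[OF X, symmetric]) simp
    finally show "integrable M (\<lambda>\<omega>. f (measure (\<Phi> \<omega>) D)) \<longleftrightarrow> integrable (measure_pmf p) (\<lambda>x. f (real x))" .
    have "(LINT \<omega>|M. f (measure (\<Phi> \<omega>) D)) = (LINT \<omega>|M. f (real (?X \<omega>)))"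
      by (rule Bochner_Integration.integral_cong) (simp_all add: meq)
    also have "\<dots> = measure_pmf.expectation p (\<lambda>x. f (real x))"
      unfolding p by (rule integral_distr[OF X, symmetric]) simp
    finally show "(LINT \<omega>|M. f (measure (\<Phi> \<omega>) D)) = measure_pmf.expectation p (\<lambda>x. f (real x))" .
  qed
  show "convex_order M (\<lambda>\<omega>. measure (\<Phi> \<omega>) D) (measure_pmf (Poi (\<Sum>j. l j))) real" if b
    unfolding convex_order_def tr L_def[symmetric]
    using put_le_imp_convex_le[OF put(1)[OF _ that] pint Poi_mean(1)[OF L]] pmean Poi_mean(2)[OF L] that by simp
  show "convex_order (measure_pmf (Poi (\<Sum>j. l j))) real M (\<lambda>\<omega>. measure (\<Phi> \<omega>) D)" if "\<not> b"
    unfolding convex_order_def tr L_def[symmetric]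
    using put_le_imp_convex_le[OF put(2)[OF _ that] Poi_mean(1)[OF L] pint] pmean Poi_mean(2)[OF L] that by simp
qed

end

section \<open>From eigensystems to Mercer kernels\<close>

lemma radon_imp_sigma_finite:
  fixes \<mu> :: "'a::euclidean_space measure"
  assumes \<mu>: "radon_measure \<mu>"
  shows "sigma_finite_measure \<mu>"
proof
  show "\<exists>A. countable A \<and> A \<subseteq> sets \<mu> \<and> \<Union>A = space \<mu> \<and> (\<forall>a\<in>A. emeasure \<mu> a \<noteq> \<infinity>)"
    using \<mu> UN_cball_nat[where 'a = 'a] sets_eq_imp_space_eq[of \<mu> borel]
    by (intro exI[of _ "range (\<lambda>n. cball (0::'a) (real n))"]) (auto simp: radon_measure_def less_top)
qed

lemma kernel_op_measurable:
  fixes \<mu> :: "'a::euclidean_space measure"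
  assumes \<mu>: "radon_measure \<mu>" and K: "case_prod K \<in> borel_measurable (borel \<Otimes>\<^sub>M borel)"
    and f: "f \<in> borel_measurable borel" and D: "D \<in> sets borel"
  shows "kernel_op \<mu> K D f \<in> borel_measurable borel"
proof -
  have s: "sets \<mu> = sets borel" using \<mu> by (simp add: radon_measure_def)
  have "(\<lambda>(x, y). indicator D y *\<^sub>R (K x y * f y)) \<in> borel_measurable (borel \<Otimes>\<^sub>M borel)"
    using K f D by measurable
  then have "(\<lambda>(x, y). indicator D y *\<^sub>R (K x y * f y)) \<in> borel_measurable (borel \<Otimes>\<^sub>M \<mu>)"
    by (subst measurable_cong_sets[OF sets_pair_measure_cong[OF refl s] refl])
  then show ?thesis
    unfolding kernel_op_def[abs_def] set_lebesgue_integral_def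
    by (intro sigma_finite_measure.borel_measurable_lebesgue_integral radon_imp_sigma_finite \<mu>)
qed

text \<open>The quadratic form of the operator at a normalized eigenfunction is the
  eigenvalue.\<close>

lemma eigenvalue_nonneg:
  fixes \<mu> :: "'a::euclidean_space measure"
  assumes \<mu>: "radon_measure \<mu>" and K: "trace_class_kernel \<mu> K" and D: "compact D"
    and es: "eigensystem \<mu> K D J lam \<phi>" and j: "j \<in> J"
  shows "0 \<le> lam j"
proof -
  have s: "sets \<mu> = sets borel" using \<mu> by (simp add: radon_measure_def)
  have Db: "D \<in> sets borel" using D by (rule borel_compact)
  have L2: "L2_on \<mu> D (\<phi> j)" and one: "L2_inner \<mu> D (\<phi> j) (\<phi> j) = 1"
    and ev: "AE x in \<mu>. x \<in> D \<longrightarrow> kernel_op \<mu> K D (\<phi> j) x = complex_of_real (lam j) * \<phi> j x"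
    using es j by (simp_all add: eigensystem_def)
  have phi: "\<phi> j \<in> borel_measurable borel" using L2 by (simp add: L2_on_def)
  have Km: "kernel_op \<mu> K D (\<phi> j) \<in> borel_measurable borel"
    using K by (intro kernel_op_measurable \<mu> phi Db)
      (simp add: trace_class_kernel_def locally_square_integrable_def)
  have m: "f \<in> borel_measurable \<mu>" if "f \<in> borel_measurable borel" for f :: "'a \<Rightarrow> complex"
    using that by (subst measurable_cong_sets[OF s refl])
  have c: "(\<lambda>x. cnj (\<phi> j x)) \<in> borel_measurable borel"
    by (intro measurable_compose[OF phi borel_measurable_continuous_onI] continuous_intros)
  have "L2_inner \<mu> D (kernel_op \<mu> K D (\<phi> j)) (\<phi> j) =
      (\<integral>x. indicator D x *\<^sub>R (kernel_op \<mu> K D (\<phi> j) x * cnj (\<phi> j x)) \<partial>\<mu>)"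
    by (simp add: L2_inner_def set_lebesgue_integral_def)
  also have "\<dots> = (\<integral>x. complex_of_real (lam j) * (indicator D x *\<^sub>R (\<phi> j x * cnj (\<phi> j x))) \<partial>\<mu>)"
  proof (rule integral_cong_AE)
    show "(\<lambda>x. indicator D x *\<^sub>R (kernel_op \<mu> K D (\<phi> j) x * cnj (\<phi> j x))) \<in> borel_measurable \<mu>"
      "(\<lambda>x. complex_of_real (lam j) * (indicator D x *\<^sub>R (\<phi> j x * cnj (\<phi> j x)))) \<in> borel_measurable \<mu>"
      using Km phi c Db by (auto intro!: m)
    show "AE x in \<mu>. indicator D x *\<^sub>R (kernel_op \<mu> K D (\<phi> j) x * cnj (\<phi> j x)) =
        complex_of_real (lam j) * (indicator D x *\<^sub>R (\<phi> j x * cnj (\<phi> j x)))"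
      using ev by eventually_elim (auto simp: indicator_def)
  qed
  also have "\<dots> = complex_of_real (lam j) * L2_inner \<mu> D (\<phi> j) (\<phi> j)"
    unfolding L2_inner_def set_lebesgue_integral_def by (rule integral_mult_right_zero)
  also have "\<dots> = complex_of_real (lam j)" by (simp add: one)
  finally have "L2_inner \<mu> D (kernel_op \<mu> K D (\<phi> j)) (\<phi> j) = complex_of_real (lam j)" .
  moreover have "L2_inner \<mu> D (kernel_op \<mu> K D (\<phi> j)) (\<phi> j) \<in> \<real>\<^sub>\<ge>\<^sub>0"
    using K D L2 by (simp add: trace_class_kernel_def psd_on_def)
  ultimately show ?thesis by simp
qed

text \<open>Extended by zero in the index and in the point, so that series run over all naturals and
  integrals over the whole space.\<close>

definition mercer_fun :: "'a set \<Rightarrow> nat set \<Rightarrow> (nat \<Rightarrow> real) \<Rightarrow> (nat \<Rightarrow> 'a \<Rightarrow> complex) \<Rightarrow> nat \<Rightarrow> 'a \<Rightarrow> complex" where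
  "mercer_fun D J lam \<phi> j x = (if j \<in> J \<and> x \<in> D then of_real (sqrt (lam j)) * \<phi> j x else 0)"

definition mercer_val :: "nat set \<Rightarrow> (nat \<Rightarrow> real) \<Rightarrow> nat \<Rightarrow> real" where
  "mercer_val J lam j = (if j \<in> J then lam j else 0)"

text \<open>The kernel version is an unconditional sum, while the locale speaks of limits of partial
  sums. Where both diagonal series converge, \<open>a * b \<le> a^2 + b^2\<close> gives absolute
  convergence and the two agree; where a diagonal series diverges, the unconditional sum on the
  diagonal is 0 by convention.\<close>

lemma mercer_kernel_eigensystem:
  fixes \<mu> :: "'a::euclidean_space measure"
  assumes \<mu>: "radon_measure \<mu>" and K: "trace_class_kernel \<mu> K" and D: "compact D"
    and es: "eigensystem \<mu> K D J lam \<phi>"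
  shows "mercer_kernel \<mu> D (mercer_fun D J lam \<phi>) (mercer_val J lam) (kernel_version D J lam \<phi>)"
    and "(\<Sum>j. mercer_val J lam j) = (\<Sum>\<^sub>\<infinity>j\<in>J. lam j)"
    and "\<And>x. \<not> summable (\<lambda>j. (cmod (mercer_fun D J lam \<phi> j x))\<^sup>2) \<Longrightarrow> kernel_version D J lam \<phi> x x = 0"
proof -
  let ?w = "mercer_fun D J lam \<phi>" and ?l = "mercer_val J lam"
  have s: "sets \<mu> = sets borel" using \<mu> by (simp add: radon_measure_def)
  have Db: "D \<in> sets borel" using D by (rule borel_compact)
  have nn: "0 \<le> lam j" if "j \<in> J" for j by (rule eigenvalue_nonneg[OF \<mu> K D es that])
  have lnn: "0 \<le> ?l j" for j using nn by (simp add: mercer_val_def)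
  have phi: "\<phi> j \<in> borel_measurable borel" "set_integrable \<mu> D (\<lambda>x. (cmod (\<phi> j x))\<^sup>2)" if "j \<in> J" for j
    using es that by (simp_all add: eigensystem_def L2_on_def)
  have orth: "L2_inner \<mu> D (\<phi> i) (\<phi> j) = (if i = j then 1 else 0)" if "i \<in> J" "j \<in> J" for i j
    using es that by (simp add: eigensystem_def)
  have "\<forall>J lam \<phi>. eigensystem \<mu> K D J lam \<phi> \<longrightarrow> lam summable_on J"
    using K D unfolding trace_class_kernel_def by blast
  then have "lam summable_on J" using es by (elim allE impE)
  moreover have "lam summable_on J \<longleftrightarrow> ?l summable_on UNIV"
    by (rule summable_on_cong_neutral) (auto simp: mercer_val_def)
  ultimately have "(?l has_sum infsum ?l UNIV) UNIV" by simp
  then have sums: "?l sums infsum ?l UNIV" by (rule has_sum_imp_sums)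
  have "infsum ?l UNIV = infsum lam J"
    by (rule infsum_cong_neutral) (auto simp: mercer_val_def)
  with sums show "(\<Sum>j. ?l j) = (\<Sum>\<^sub>\<infinity>j\<in>J. lam j)" by (simp add: sums_iff)
  have K_eq: "kernel_version D J lam \<phi> x y = infsum (\<lambda>j. ?w j x * cnj (?w j y)) UNIV" for x y
  proof (cases "x \<in> D \<and> y \<in> D")
    case True
    then have "kernel_version D J lam \<phi> x y =
        (\<Sum>\<^sub>\<infinity>j\<in>J. complex_of_real (lam j) * \<phi> j x * cnj (\<phi> j y))"
      by (simp add: kernel_version_def)
    also have "\<dots> = infsum (\<lambda>j. ?w j x * cnj (?w j y)) UNIV"
    proof (rule infsum_cong_neutral)
      fix j assume "j \<in> J \<inter> UNIV"
      then have j: "j \<in> J" by simp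
      let ?s = "complex_of_real (sqrt (lam j))"
      have "?w j x * cnj (?w j y) = (?s * ?s) * (\<phi> j x * cnj (\<phi> j y))"
        using True j by (simp add: mercer_fun_def mult_ac)
      also have "?s * ?s = complex_of_real (lam j)"
        using nn[OF j] by (simp flip: of_real_mult)
      finally show "complex_of_real (lam j) * \<phi> j x * cnj (\<phi> j y) = ?w j x * cnj (?w j y)"
        by (simp add: mult.assoc)
    qed (auto simp: mercer_fun_def)
    finally show ?thesis .
  next
    case False
    then have "(\<lambda>j. ?w j x * cnj (?w j y)) = (\<lambda>j. 0)" by (auto simp: mercer_fun_def fun_eq_iff)
    moreover have "kernel_version D J lam \<phi> x y = 0" using False by (auto simp: kernel_version_def)
    ultimately show ?thesis by simp
  qed
  show "kernel_version D J lam \<phi> x x = 0" if bad: "\<not> summable (\<lambda>j. (cmod (?w j x))\<^sup>2)" for x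
  proof -
    have Re: "Re (z * cnj z) = (cmod z)\<^sup>2" for z
      unfolding complex_norm_square[symmetric] by (rule Re_complex_of_real)
    have "\<not> (\<lambda>j. ?w j x * cnj (?w j x)) summable_on UNIV"
    proof
      assume "(\<lambda>j. ?w j x * cnj (?w j x)) summable_on UNIV"
      then have "(\<lambda>j. Re (?w j x * cnj (?w j x))) summable_on UNIV" by (rule summable_on_Re)
      then have "summable (\<lambda>j. (cmod (?w j x))\<^sup>2)"
        unfolding Re by (rule summable_on_imp_summable)
      then show False by (rule notE[OF bad])
    qed
    then show ?thesis unfolding K_eq by (rule infsum_not_exists)
  qed
  show "mercer_kernel \<mu> D ?w ?l (kernel_version D J lam \<phi>)"
  proof
    show "\<exists>A. countable A \<and> A \<subseteq> sets \<mu> \<and> \<Union>A = space \<mu> \<and> (\<forall>a\<in>A. emeasure \<mu> a \<noteq> \<infinity>)"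
      using radon_imp_sigma_finite[OF \<mu>] by (simp add: sigma_finite_measure_def)
    show "sets \<mu> = sets borel" by (rule s)
    show "summable ?l" using sums by (rule sums_summable)
    show "0 \<le> ?l j" for j by (rule lnn)
    show "kernel_version D J lam \<phi> x y = 0" if "x \<notin> D" for x y
      using that by (simp add: kernel_version_def)
    show "?w j \<in> borel_measurable borel" for j
    proof (cases "j \<in> J")
      case True
      have "?w j = (\<lambda>x. indicator D x *\<^sub>R (of_real (sqrt (lam j)) * \<phi> j x))"
        using True by (auto simp: mercer_fun_def fun_eq_iff indicator_def)
      then show ?thesis using phi(1)[OF True] Db by simp
    next
      case False
      then have "?w j = (\<lambda>x. 0)" by (auto simp: mercer_fun_def fun_eq_iff)
      then show ?thesis by simp
    qed
    show "integrable \<mu> (\<lambda>x. (cmod (?w j x))\<^sup>2)" for j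
    proof (cases "j \<in> J")
      case True
      have "(\<lambda>x. (cmod (?w j x))\<^sup>2) = (\<lambda>x. lam j * (indicator D x *\<^sub>R (cmod (\<phi> j x))\<^sup>2))"
        using True nn[OF True] by (auto simp: mercer_fun_def fun_eq_iff indicator_def norm_mult power_mult_distrib)
      then show ?thesis using phi(2)[OF True] by (simp add: set_integrable_def)
    next
      case False
      then show ?thesis by (simp add: mercer_fun_def)
    qed
    show "(\<integral>x. ?w i x * cnj (?w j x) \<partial>\<mu>) = (if i = j then of_real (?l i) else 0)" for i j
    proof (cases "i \<in> J \<and> j \<in> J")
      case True
      have "(\<lambda>x. ?w i x * cnj (?w j x)) = (\<lambda>x. (of_real (sqrt (lam i)) * of_real (sqrt (lam j))) *
          (indicator D x *\<^sub>R (\<phi> i x * cnj (\<phi> j x))))"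
        using True by (auto simp: mercer_fun_def fun_eq_iff indicator_def)
      then have "(\<integral>x. ?w i x * cnj (?w j x) \<partial>\<mu>) =
          (of_real (sqrt (lam i)) * of_real (sqrt (lam j))) * L2_inner \<mu> D (\<phi> i) (\<phi> j)"
        by (simp only: L2_inner_def set_lebesgue_integral_def integral_mult_right_zero)
      then show ?thesis
        using True orth[of i j] nn[of i] by (auto simp: mercer_val_def simp flip: of_real_mult)
    next
      case False
      then have "(\<lambda>x. ?w i x * cnj (?w j x)) = (\<lambda>x. 0)" by (auto simp: mercer_fun_def fun_eq_iff)
      then show ?thesis using False by (auto simp: mercer_val_def)
    qed
    show "(\<lambda>n. \<Sum>j<n. ?w j x * cnj (?w j y)) \<longlonglongrightarrow> kernel_version D J lam \<phi> x y"
      if sx: "summable (\<lambda>j. (cmod (?w j x))\<^sup>2)" and sy: "summable (\<lambda>j. (cmod (?w j y))\<^sup>2)" for x y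
    proof -
      have ab: "a * b \<le> a\<^sup>2 + b\<^sup>2" if "0 \<le> a" "0 \<le> b" for a b :: real
        using sum_squares_bound[of a b] mult_nonneg_nonneg[OF that] by linarith
      have sn: "summable (\<lambda>j. norm (?w j x * cnj (?w j y)))"
        by (rule summable_comparison_test'[OF summable_add[OF sx sy]]) (simp add: norm_mult ab)
      have t: "(\<lambda>j. ?w j x * cnj (?w j y)) sums (\<Sum>j. ?w j x * cnj (?w j y))"
        by (rule summable_sums[OF summable_norm_cancel[OF sn]])
      have "infsum (\<lambda>j. ?w j x * cnj (?w j y)) UNIV = (\<Sum>j. ?w j x * cnj (?w j y))"
        by (rule infsumI) (rule norm_summable_imp_has_sum[OF sn t])
      then show ?thesis unfolding K_eq using t by (simp add: sums_def)
    qed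
  qed
qed

text \<open>Kernels of different compact sets are never compared: each claim reduces to one compact
  set at a time, through regularity for void probabilities and through a common ball for finitely
  many bounded sets.\<close>

lemma imm_process_comparison:
  fixes \<mu> :: "'a::euclidean_space measure"
  assumes \<mu>: "radon_measure \<mu>" and K: "trace_class_kernel \<mu> K"
    and es: "\<And>D. compact D \<Longrightarrow> eigensystem \<mu> K D (J D) (lam D) (\<phi> D)"
    and pp: "point_process M \<Phi>"
    and ip: "\<And>D. compact D \<Longrightarrow>
      imm_process b M (restrict_process D \<Phi>) \<mu> (kernel_version D (J D) (lam D) (\<phi> D))"
    and le1: "\<And>D j. b \<Longrightarrow> compact D \<Longrightarrow> j \<in> J D \<Longrightarrow> lam D j \<le> 1"
  shows "\<And>D. compact D \<Longrightarrow> mean_measure M \<Phi> D = ennreal (\<Sum>\<^sub>\<infinity>j\<in>J D. lam D j)"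
    and "b \<Longrightarrow> alpha_weakly_sub_Poisson M \<Phi>"
    and "\<not> b \<Longrightarrow> alpha_weakly_super_Poisson M \<Phi>"
    and "\<And>D. b \<Longrightarrow> compact D \<Longrightarrow> convex_order M (\<lambda>\<omega>. measure (\<Phi> \<omega>) D)
      (measure_pmf (Poi (\<Sum>\<^sub>\<infinity>j\<in>J D. lam D j))) real"
    and "\<And>D. \<not> b \<Longrightarrow> compact D \<Longrightarrow> convex_order (measure_pmf (Poi (\<Sum>\<^sub>\<infinity>j\<in>J D. lam D j))) real
      M (\<lambda>\<omega>. measure (\<Phi> \<omega>) D)"
    and "b \<Longrightarrow> nu_weakly_sub_Poisson M \<Phi>"
    and "\<not> b \<Longrightarrow> nu_weakly_super_Poisson M \<Phi>"
proof -
  note mk = mercer_kernel_eigensystem[OF \<mu> K _ es]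
  have lle: "mercer_val (J D) (lam D) j \<le> 1" if "compact D" b for D j
    using le1[OF that(2,1)] by (simp add: mercer_val_def)
  have pc: "mean_measure M \<Phi> D = ennreal (\<Sum>\<^sub>\<infinity>j\<in>J D. lam D j)"
      "b \<Longrightarrow> void_prob M \<Phi> D \<le> exp (- (\<Sum>\<^sub>\<infinity>j\<in>J D. lam D j))"
      "\<not> b \<Longrightarrow> exp (- (\<Sum>\<^sub>\<infinity>j\<in>J D. lam D j)) \<le> void_prob M \<Phi> D"
      "b \<Longrightarrow> convex_order M (\<lambda>\<omega>. measure (\<Phi> \<omega>) D) (measure_pmf (Poi (\<Sum>\<^sub>\<infinity>j\<in>J D. lam D j))) real"
      "\<not> b \<Longrightarrow> convex_order (measure_pmf (Poi (\<Sum>\<^sub>\<infinity>j\<in>J D. lam D j))) real M (\<lambda>\<omega>. measure (\<Phi> \<omega>) D)"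
    if D: "compact D" for D
    using mercer_kernel.process_on_compact[OF mk(1)[OF D D] D pp ip[OF D] lle[OF D]]
    unfolding mk(2)[OF D D] by blast+
  show mean: "mean_measure M \<Phi> D = ennreal (\<Sum>\<^sub>\<infinity>j\<in>J D. lam D j)" if "compact D" for D
    by (rule pc(1)[OF that])
  show "convex_order M (\<lambda>\<omega>. measure (\<Phi> \<omega>) D) (measure_pmf (Poi (\<Sum>\<^sub>\<infinity>j\<in>J D. lam D j))) real"
    if b "compact D" for D
    by (rule pc(4)[OF that(2,1)])
  show "convex_order (measure_pmf (Poi (\<Sum>\<^sub>\<infinity>j\<in>J D. lam D j))) real M (\<lambda>\<omega>. measure (\<Phi> \<omega>) D)"
    if "\<not> b" "compact D" for D
    by (rule pc(5)[OF that(2,1)])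
  have fin: "mean_measure M \<Phi> C < \<infinity>" if "compact C" for C
    using mean[OF that] by simp
  have nn: "0 \<le> (\<Sum>\<^sub>\<infinity>j\<in>J D. lam D j)" if "compact D" for D
    by (intro infsum_nonneg eigenvalue_nonneg[OF \<mu> K that es[OF that]])
  have em: "exp_minus (mean_measure M \<Phi> C) = exp (- (\<Sum>\<^sub>\<infinity>j\<in>J C. lam C j))" if "compact C" for C
    using mean[OF that] nn[OF that] by (simp add: exp_minus_def)
  show "nu_weakly_sub_Poisson M \<Phi>" if b
  proof (rule nu_weakly_sub_PoissonI[OF pp fin])
    show "void_prob M \<Phi> C \<le> exp_minus (mean_measure M \<Phi> C)" if "compact C" for C
      unfolding em[OF that] by (rule pc(2)[OF that \<open>b\<close>])
  qed
  show "nu_weakly_super_Poisson M \<Phi>" if "\<not> b"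
  proof (rule nu_weakly_super_PoissonI[OF pp fin])
    show "exp_minus (mean_measure M \<Phi> C) \<le> void_prob M \<Phi> C" if "compact C" for C
      unfolding em[OF that] by (rule pc(3)[OF that \<open>\<not> b\<close>])
  qed
  have prods: "(b \<longrightarrow> (\<integral>\<^sup>+\<omega>. (\<Prod>i<k. emeasure (\<Phi> \<omega>) (B i)) \<partial>M) \<le> (\<Prod>i<k. mean_measure M \<Phi> (B i))) \<and>
      (\<not> b \<longrightarrow> (\<Prod>i<k. mean_measure M \<Phi> (B i)) \<le> (\<integral>\<^sup>+\<omega>. (\<Prod>i<k. emeasure (\<Phi> \<omega>) (B i)) \<partial>M))"
    if k: "1 \<le> k" and B: "\<forall>i<k. B i \<in> sets borel \<and> bounded (B i)" and disj: "disjoint_family_on B {..<k}"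
    for k :: nat and B :: "nat \<Rightarrow> 'a set"
  proof -
    have "bounded (\<Union>i\<in>{..<k}. B i)" using B by (intro bounded_UN) auto
    then obtain r where r: "\<forall>x\<in>(\<Union>i\<in>{..<k}. B i). norm x \<le> r"
      unfolding bounded_iff by (rule exE)
    \<comment> \<open>A ball around all the \<open>B i\<close>, on which the process and its
      restriction agree.\<close>
    define D where "D = cball (0::'a) r"
    have D: "compact D" "D \<in> sets borel" by (simp_all add: D_def)
    have sub: "D \<inter> B i = B i" if "i < k" for i
      using r that by (auto simp: D_def)
    have e: "emeasure (restrict_process D \<Phi> \<omega>) (B i) = emeasure (\<Phi> \<omega>) (B i)" if "\<omega> \<in> space M" "i < k" for \<omega> i
      using emeasure_restrict_process[OF pp that(1) D(2), of "B i"] B sub that(2) by simp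
    have 1: "(\<integral>\<^sup>+\<omega>. (\<Prod>i<k. emeasure (restrict_process D \<Phi> \<omega>) (B i)) \<partial>M) =
        (\<integral>\<^sup>+\<omega>. (\<Prod>i<k. emeasure (\<Phi> \<omega>) (B i)) \<partial>M)"
      by (intro nn_integral_cong prod.cong refl e) auto
    have 2: "(\<Prod>i<k. \<integral>\<^sup>+\<omega>. emeasure (restrict_process D \<Phi> \<omega>) (B i) \<partial>M) = (\<Prod>i<k. mean_measure M \<Phi> (B i))"
      unfolding mean_measure_def by (intro prod.cong refl nn_integral_cong e) auto
    show ?thesis
      using mercer_kernel.moment_prod_compare[OF mk(1)[OF D(1) D(1)] ip[OF D(1)] k _ _ disj] B
      unfolding 1 2 by auto
  qed
  show "alpha_weakly_sub_Poisson M \<Phi>" if b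
    unfolding alpha_weakly_sub_Poisson_def using prods that by blast
  show "alpha_weakly_super_Poisson M \<Phi>" if "\<not> b"
    unfolding alpha_weakly_super_Poisson_def using prods that by blast
qed

theorem mainTheorem17:
  fixes \<mu> :: "'a::euclidean_space measure"
    and K :: "'a \<Rightarrow> 'a \<Rightarrow> complex"
    and J :: "'a set \<Rightarrow> nat set"
    and lam :: "'a set \<Rightarrow> nat \<Rightarrow> real"
    and \<phi> :: "'a set \<Rightarrow> nat \<Rightarrow> 'a \<Rightarrow> complex"
    and P :: "'v measure" and \<Phi>perm :: "'v \<Rightarrow> 'a measure"
    and Q :: "'w measure" and \<Phi>det :: "'w \<Rightarrow> 'a measure"
  assumes radon: "radon_measure \<mu>"
    and kernel: "trace_class_kernel \<mu> K"
    and eigen: "\<And>D. compact D \<Longrightarrow> eigensystem \<mu> K D (J D) (lam D) (\<phi> D)"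
  shows "(\<forall>D. compact D \<longrightarrow>
            set_integrable \<mu> D (\<lambda>x. kernel_version D (J D) (lam D) (\<phi> D) x x) \<and>
            (LINT x:D|\<mu>. kernel_version D (J D) (lam D) (\<phi> D) x x) =
              complex_of_real (\<Sum>\<^sub>\<infinity>j\<in>J D. lam D j)) \<and>
         ((\<forall>D. compact D \<longrightarrow> (\<forall>j\<in>J D. lam D j \<in> {0..1})) \<and>
            determinantal_process Q \<Phi>det \<mu> J lam \<phi> \<longrightarrow>
            (\<forall>D. compact D \<longrightarrow> mean_measure Q \<Phi>det D = ennreal (\<Sum>\<^sub>\<infinity>j\<in>J D. lam D j)) \<and>
            alpha_weakly_sub_Poisson Q \<Phi>det \<and>
            (\<forall>D. compact D \<longrightarrow>
               convex_order Q (\<lambda>\<omega>. measure (\<Phi>det \<omega>) D)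
                 (measure_pmf (Poi (\<Sum>\<^sub>\<infinity>j\<in>J D. lam D j))) real) \<and>
            nu_weakly_sub_Poisson Q \<Phi>det \<and>
            weakly_sub_Poisson Q \<Phi>det) \<and>
         (permanental_process P \<Phi>perm \<mu> J lam \<phi> \<longrightarrow>
            (\<forall>D. compact D \<longrightarrow> mean_measure P \<Phi>perm D = ennreal (\<Sum>\<^sub>\<infinity>j\<in>J D. lam D j)) \<and>
            alpha_weakly_super_Poisson P \<Phi>perm \<and>
            (\<forall>D. compact D \<longrightarrow>
               convex_order (measure_pmf (Poi (\<Sum>\<^sub>\<infinity>j\<in>J D. lam D j))) real
                 P (\<lambda>\<omega>. measure (\<Phi>perm \<omega>) D)) \<and>
            nu_weakly_super_Poisson P \<Phi>perm \<and>
            weakly_super_Poisson P \<Phi>perm)"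
proof -
  have es: "eigensystem \<mu> K D (J D) (lam D) (\<phi> D)" if "compact D" for D
    by (rule eigen[OF that])
  have first: "set_integrable \<mu> D (\<lambda>x. kernel_version D (J D) (lam D) (\<phi> D) x x) \<and>
      (LINT x:D|\<mu>. kernel_version D (J D) (lam D) (\<phi> D) x x) =
        complex_of_real (\<Sum>\<^sub>\<infinity>j\<in>J D. lam D j)" if D: "compact D" for D
  proof -
    note mk = mercer_kernel_eigensystem[OF radon kernel D es[OF D]]
    show ?thesis
      using mercer_kernel.diag_K_integral[OF mk(1) mk(3) borel_compact[OF D]] by (simp add: mk(2))
  qed
  have det: "(\<forall>D. compact D \<longrightarrow> mean_measure Q \<Phi>det D = ennreal (\<Sum>\<^sub>\<infinity>j\<in>J D. lam D j)) \<and>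
      alpha_weakly_sub_Poisson Q \<Phi>det \<and>
      (\<forall>D. compact D \<longrightarrow>
         convex_order Q (\<lambda>\<omega>. measure (\<Phi>det \<omega>) D)
           (measure_pmf (Poi (\<Sum>\<^sub>\<infinity>j\<in>J D. lam D j))) real) \<and>
      nu_weakly_sub_Poisson Q \<Phi>det \<and> weakly_sub_Poisson Q \<Phi>det"
    if lam: "\<forall>D. compact D \<longrightarrow> (\<forall>j\<in>J D. lam D j \<in> {0..1})"
      and proc: "determinantal_process Q \<Phi>det \<mu> J lam \<phi>"
  proof -
    have pp: "point_process Q \<Phi>det" using proc by (simp add: determinantal_process_def)
    have ip: "imm_process True Q (restrict_process D \<Phi>det) \<mu> (kernel_version D (J D) (lam D) (\<phi> D))"
      if "compact D" for D
      using proc that by (simp add: determinantal_process_def determinantal_iff_imm_process)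
    have le1: "lam D j \<le> 1" if "compact D" "j \<in> J D" for D j
      using lam that by simp
    note cmp = imm_process_comparison[OF radon kernel es pp ip le1]
    show ?thesis
      by (simp add: cmp weakly_sub_Poisson_def)
  qed
  have perm: "(\<forall>D. compact D \<longrightarrow> mean_measure P \<Phi>perm D = ennreal (\<Sum>\<^sub>\<infinity>j\<in>J D. lam D j)) \<and>
      alpha_weakly_super_Poisson P \<Phi>perm \<and>
      (\<forall>D. compact D \<longrightarrow>
         convex_order (measure_pmf (Poi (\<Sum>\<^sub>\<infinity>j\<in>J D. lam D j))) real
           P (\<lambda>\<omega>. measure (\<Phi>perm \<omega>) D)) \<and>
      nu_weakly_super_Poisson P \<Phi>perm \<and> weakly_super_Poisson P \<Phi>perm"
    if proc: "permanental_process P \<Phi>perm \<mu> J lam \<phi>"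
  proof -
    have pp: "point_process P \<Phi>perm" using proc by (simp add: permanental_process_def)
    have ip: "imm_process False P (restrict_process D \<Phi>perm) \<mu> (kernel_version D (J D) (lam D) (\<phi> D))"
      if "compact D" for D
      using proc that by (simp add: permanental_process_def permanental_iff_imm_process)
    have le1: "lam D j \<le> 1" if False "compact D" "j \<in> J D" for D j
      using that by simp
    note cmp = imm_process_comparison[OF radon kernel es pp ip le1]
    show ?thesis
      by (simp add: cmp weakly_super_Poisson_def)
  qed
  show ?thesis
    using first det perm by blast
qed

end
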